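(* Let $k\ge1$, let $v=\prod_{i=1}^k x_i^{m_i}$ with $m_1>m_2>\dots>m_\ell>m_{\ell+1}=0=\dots=m_k$ (where $0\le\ell\le k$) be a vertex of $\mathcal{SY}_k$, and let $u=\prod_{i=1}^k x_i^{n_i}$ be another vertex of $\mathcal{SY}_k$ with $n_i\ge m_i$ for all $i$. Put $m=\sum_i m_i$, $n=\sum_i n_i$, and $$g(x_1,\dots,x_k)=\varphi_v(x_1,\dots,x_k)\cdot (x_1+\dots+x_k-m)^{\underline{n-m}}.$$ Then: 1) The antipolynomial component $Q[g]$ vanishes on the simplex $\Delta_k^n$. 2) The polynomial component of $g$ has the expansion $$P[g]=\sum_{c_1+\dots+c_k=n,\ c_i\ge0}\frac{(n-m)!}{\prod_{i=1}^k c_i!}\cdot\varphi_v(c_1,\dots,c_k)\cdot\prod_{i=1}^k x_i^{\underline{c_i}},$$ the sum being over $k$-tuples of non-negative integers. 3) The number of directed paths in $\mathcal{SY}_k$ from $v$ to $u$ equals $$\frac{(n-m)!}{\prod_{i=1}^k n_i!}\cdot\varphi_v(n_1,\dots,n_k).$$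
   Context: Graph. $\mathbb{Z}^k$ is regarded as a directed graph: $(c_1,\dots,c_k)\in\mathbb{Z}^k$ is identified with the Laurent monomial $x_1^{c_1}\cdots x_k^{c_k}$, and there is an edge from $w$ to $x_iw$ for every monomial $w$ and every $i$. The graph of strict partitions $\mathcal{SY}_k$ is the induced subgraph of $\mathbb{Z}^k$ on the vectors $(c_1,\dots,c_k)$ of non-negative integers with $c_1\ge c_2\ge\dots\ge c_k\ge 0$ such that $c_i=c_j$ with $i\ne j$ implies $c_i=0$. Notation. $x^{\underline{n}}=x(x-1)\cdots(x-n+1)$, $x^{\underline{0}}=1$. $\Delta_k^n=\{(t_1,\dots,t_k)\in\mathbb{Z}^k: t_i\ge0,\ \sum t_i\le n\}$. For a function $F$, $\mathrm{Sym}\,F(x_1,\dots,x_k)=\sum_\pi F(x_{\pi_1},\dots,x_{\pi_k})$, the sum over all $k!$ permutations $\pi$ of $\{1,\dots,k\}$. Functions. For $v$ as in the claim, $$\psi_v(x_1,\dots,x_k)=\frac1{(k-\ell)!}\,\mathrm{Sym}\left(\prod_{i\le\ell}x_i^{\underline{m_i}}\prod_{i\le\ell,\ i<j\le k}\frac{x_i+x_j}{x_i-x_j}\right),$$ which is a polynomial, and $$\varphi_v(x_1,\dots,x_k)=\prod_{1\le i<j\le k}\frac{x_i-x_j}{x_i+x_j}\cdot\psi_v(x_1,\dots,x_k).$$ Components and values. Let $\mathcal{M}$ be the set of rational functions in $x_1,\dots,x_k$ (with rational coefficients) of the form $p/\prod_{1\le i<j\le k}(x_i+x_j)$ with $p$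 a polynomial. Functions in $\mathcal{M}$ are expanded as Laurent series in $x_1,x_2/x_1,\dots,x_k/x_{k-1}$, i.e. using $(x_i+x_j)^{-1}=x_i^{-1}-x_jx_i^{-2}+x_j^2x_i^{-3}-\dots$ for $i<j$. Each $f\in\mathcal{M}$ is uniquely written as $f=P[f]+Q[f]$, where $P[f]$ (polynomial component) is the polynomial formed by the terms of the expansion with all exponents non-negative, and $Q[f]$ (antipolynomial component) consists of the terms $\prod x_i^{c_i}$ with at least one $c_i<0$; $Q[f]=f-P[f]$ is again an element of $\mathcal{M}$. The value of a function in $\mathcal{M}$ at a point $(c_1,\dots,c_k)$ with non-negative coordinates is defined as follows: if all coordinates are positive, substitute them; if $i_1<\dots<i_r$ are the indices of the vanishing coordinates, replace these coordinates by $t,t^2,\dots,t^r$ respectively and take the limit as $t\to+0$. The values $\varphi_v(c_1,\dots,c_k)$, $\varphi_v(n_1,\dots,n_k)$ and the values of $Q[g]$ are understood in this sense. *)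

theory Defs
  imports
    Complex_Main
    "HOL-Library.FuncSet"
    "HOL-Library.Poly_Mapping"
    "HOL-Computational_Algebra.Fraction_Field"
    "HOL-Combinatorics.Permutations"
    "Graph_Theory.Arc_Walk"
    "Graph_Theory.Digraph_Component"
begin

section \<open>The graph of strict partitions\<close>

text \<open>
  A vector in $\mathbb{Z}^k$ is a function on \<open>nat\<close> that vanishes outside \<open>{1..k}\<close>.
\<close>

definition Zvecs :: "nat \<Rightarrow> (nat \<Rightarrow> int) set" where
  "Zvecs k = {c. \<forall>i. i \<notin> {1..k} \<longrightarrow> c i = 0}"

definition Zgraph :: "nat \<Rightarrow> (nat \<Rightarrow> int, (nat \<Rightarrow> int) \<times> (nat \<Rightarrow> int)) pre_digraph" where
  "Zgraph k =
     \<lparr>verts = Zvecs k,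
      arcs = {(w, w(i := w i + 1)) | w i. w \<in> Zvecs k \<and> i \<in> {1..k}},
      tail = fst, head = snd\<rparr>"

definition SYgraph :: "nat \<Rightarrow> (nat \<Rightarrow> int, (nat \<Rightarrow> int) \<times> (nat \<Rightarrow> int)) pre_digraph" where
  "SYgraph k = Zgraph k \<restriction>
     {c \<in> Zvecs k. (\<forall>i\<in>{1..k}. 0 \<le> c i) \<and> (\<forall>i\<in>{1..<k}. c (Suc i) \<le> c i) \<and>
        (\<forall>i\<in>{1..k}. \<forall>j\<in>{1..k}. i \<noteq> j \<and> c i = c j \<longrightarrow> c i = 0)}"

definition num_paths :: "('a, 'b) pre_digraph \<Rightarrow> 'a \<Rightarrow> 'a \<Rightarrow> nat" where
  "num_paths G v u = card {p. pre_digraph.apath G v p u}"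

definition Delta :: "nat \<Rightarrow> nat \<Rightarrow> (nat \<Rightarrow> int) set" where
  "Delta k n = {t \<in> Zvecs k. (\<forall>i\<in>{1..k}. 0 \<le> t i) \<and> (\<Sum>i=1..k. t i) \<le> int n}"


section \<open>Polynomials and rational functions\<close>

text \<open>
  A monomial $\prod x_i^{b_i}$ is its finitely supported exponent function \<open>b\<close>; variables are
  indexed by \<open>nat\<close>, and \<open>polys k\<close> are the polynomials in $x_1,\dots,x_k$.
\<close>

type_synonym mpoly = "(nat \<Rightarrow>\<^sub>0 nat) \<Rightarrow>\<^sub>0 rat"
type_synonym ratfun = "mpoly fract"

definition Var :: "nat \<Rightarrow> mpoly" where
  "Var i = Poly_Mapping.single (Poly_Mapping.single i 1) 1"

definition Const :: "rat \<Rightarrow> mpoly" where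
  "Const a = Poly_Mapping.single 0 a"

definition polys :: "nat \<Rightarrow> mpoly set" where
  "polys k = {p. \<forall>b \<in> Poly_Mapping.keys p. Poly_Mapping.keys b \<subseteq> {1..k}}"

definition poly_eval :: "(nat \<Rightarrow> real) \<Rightarrow> mpoly \<Rightarrow> real" where
  "poly_eval a p = (\<Sum>b\<in>Poly_Mapping.keys p. of_rat (Poly_Mapping.lookup p b) *
      (\<Prod>i\<in>Poly_Mapping.keys b. a i ^ Poly_Mapping.lookup b i))"

definition rf :: "mpoly \<Rightarrow> ratfun" where
  "rf p = Fraction_Field.Fract p 1"

abbreviation X :: "nat \<Rightarrow> ratfun" where
  "X i \<equiv> rf (Var i)"

definition ffact :: "'a::comm_ring_1 \<Rightarrow> nat \<Rightarrow> 'a" where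
  "ffact x n = (\<Prod>i<n. x - of_nat i)"

definition pairs :: "nat \<Rightarrow> (nat \<times> nat) set" where
  "pairs k = {(i, j). 1 \<le> i \<and> i < j \<and> j \<le> k}"

definition Sym :: "nat \<Rightarrow> ((nat \<Rightarrow> ratfun) \<Rightarrow> ratfun) \<Rightarrow> ratfun" where
  "Sym k F = (\<Sum>\<pi> | \<pi> permutes {1..k}. F (\<lambda>i. X (\<pi> i)))"

definition psi :: "nat \<Rightarrow> nat \<Rightarrow> (nat \<Rightarrow> nat) \<Rightarrow> ratfun" where
  "psi k l m = 1 / of_nat (fact (k - l)) *
     Sym k (\<lambda>x. (\<Prod>i=1..l. ffact (x i) (m i)) *
                (\<Prod>(i, j) \<in> {(i, j) \<in> pairs k. i \<le> l}. (x i + x j) / (x i - x j)))"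

definition phi :: "nat \<Rightarrow> nat \<Rightarrow> (nat \<Rightarrow> nat) \<Rightarrow> ratfun" where
  "phi k l m = (\<Prod>(i, j) \<in> pairs k. (X i - X j) / (X i + X j)) * psi k l m"


section \<open>The class M, Laurent expansion, components and values\<close>

definition den :: "nat \<Rightarrow> mpoly" where
  "den k = (\<Prod>(i, j) \<in> pairs k. Var i + Var j)"

definition Mclass :: "nat \<Rightarrow> ratfun set" where
  "Mclass k = {rf p / rf (den k) | p. p \<in> polys k}"

text \<open>For \<open>f \<in> Mclass k\<close> the numerator over \<open>den k\<close> is unique (lemma \<open>numer_unique\<close>).\<close>

definition numer :: "nat \<Rightarrow> ratfun \<Rightarrow> mpoly" where
  "numer k f = (THE p. p \<in> polys k \<and> f = rf p / rf (den k))"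

text \<open>
  Multiplying the expansions $(x_i+x_j)^{-1} = \sum_{a\ge 0} (-1)^a x_j^a x_i^{-1-a}$ over all
  $i<j$, a choice \<open>A\<close> of one term $a = A(i,j)$ from each factor contributes the sign
  $(-1)^{\sum A}$ to the monomial whose exponent vector is \<open>expo k A\<close>. Only finitely many choices
  yield a given monomial (lemma \<open>finite_expo\<close>).
\<close>

definition expo :: "nat \<Rightarrow> (nat \<times> nat \<Rightarrow> nat) \<Rightarrow> nat \<Rightarrow> int" where
  "expo k A s = (\<Sum>(i, j) \<in> pairs k.
      (if s = j then int (A (i, j)) else 0) - (if s = i then 1 + int (A (i, j)) else 0))"

definition inv_den_coeff :: "nat \<Rightarrow> (nat \<Rightarrow> int) \<Rightarrow> rat" where
  "inv_den_coeff k e =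
     (\<Sum>A | A \<in> pairs k \<rightarrow>\<^sub>E UNIV \<and> expo k A = e. (-1) ^ (\<Sum>q\<in>pairs k. A q))"

text \<open>Coefficient of $\prod x_i^{e_i}$ in the expansion of \<open>f \<in> Mclass k\<close>:\<close>

definition laurent_coeff :: "nat \<Rightarrow> ratfun \<Rightarrow> (nat \<Rightarrow> int) \<Rightarrow> rat" where
  "laurent_coeff k f e = (\<Sum>b\<in>Poly_Mapping.keys (numer k f).
      Poly_Mapping.lookup (numer k f) b *
      inv_den_coeff k (\<lambda>i. e i - int (Poly_Mapping.lookup b i)))"

text \<open>
  \<open>Abs_poly_mapping\<close> is applied to a finitely supported function here
  (lemma \<open>finite_poly_part\<close>).
\<close>

definition poly_part :: "nat \<Rightarrow> ratfun \<Rightarrow> mpoly" where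
  "poly_part k f = Abs_poly_mapping (\<lambda>b. if Poly_Mapping.keys b \<subseteq> {1..k}
      then laurent_coeff k f (\<lambda>i. int (Poly_Mapping.lookup b i)) else 0)"

definition antipoly_part :: "nat \<Rightarrow> ratfun \<Rightarrow> ratfun" where
  "antipoly_part k f = f - rf (poly_part k f)"

text \<open>
  The \<open>r\<close>-th vanishing coordinate of \<open>c\<close> is replaced by $t^r$. If no coordinate vanishes,
  the curve is constant and the limit below is plain substitution.
\<close>

definition curve :: "(nat \<Rightarrow> rat) \<Rightarrow> real \<Rightarrow> nat \<Rightarrow> real" where
  "curve c t i = (if c i = 0 then t ^ card {j \<in> {1..i}. c j = 0} else of_rat (c i))"

definition has_value :: "nat \<Rightarrow> ratfun \<Rightarrow> (nat \<Rightarrow> rat) \<Rightarrow> rat \<Rightarrow> bool" where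
  "has_value k f c y \<longleftrightarrow> f \<in> Mclass k \<and>
     ((\<lambda>t. poly_eval (curve c t) (numer k f) / poly_eval (curve c t) (den k))
        \<longlongrightarrow> of_rat y) (at_right 0)"

text \<open>
  A finite value of a function with rational coefficients at a rational point is rational (a ratio
  of lowest-order coefficients in \<open>t\<close>), so values can be taken in \<open>rat\<close>.
\<close>

definition value_at :: "nat \<Rightarrow> ratfun \<Rightarrow> (nat \<Rightarrow> rat) \<Rightarrow> rat" where
  "value_at k f c = (THE y. has_value k f c y)"

definition compositions :: "nat \<Rightarrow> nat \<Rightarrow> (nat \<Rightarrow> nat) set" where
  "compositions k n = {c. (\<forall>i. i \<notin> {1..k} \<longrightarrow> c i = 0) \<and> (\<Sum>i=1..k. c i) = n}"


section \<open>Well-definedness\<close>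

lemma finite_pairs [simp]: "finite (pairs k)"
proof -
  have "pairs k \<subseteq> {1..k} \<times> {1..k}" by (auto simp: pairs_def)
  then show ?thesis by (rule finite_subset) simp
qed

lemma Var_add_nonzero: "Var i + Var j \<noteq> 0"
proof
  assume "Var i + Var j = 0"
  then have "Poly_Mapping.lookup (Var i + Var j) (Poly_Mapping.single i 1) = 0" by simp
  then show False
    by (auto simp: Var_def lookup_add lookup_single when_def split: if_splits)
qed

lemma den_nonzero: "den k \<noteq> 0"
  by (auto simp: den_def Var_add_nonzero)

lemma numer_unique:
  assumes "p \<in> polys k"
  shows "numer k (rf p / rf (den k)) = p"
  unfolding numer_def using assms den_nonzero[of k]
  by (intro the_equality) (auto simp: rf_def eq_fract Zero_fract_def)

lemma sum_weighted_expo: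
  "(\<Sum>s=1..k. w s * expo k A s) =
   (\<Sum>(i, j) \<in> pairs k. w j * int (A (i, j)) - w i * (1 + int (A (i, j))))"
proof -
  have "(\<Sum>s=1..k. w s * expo k A s) = (\<Sum>s=1..k. \<Sum>(i, j) \<in> pairs k.
      (if s = j then w s * int (A (i, j)) else 0) - (if s = i then w s * (1 + int (A (i, j))) else 0))"
    unfolding expo_def sum_distrib_left
    by (intro sum.cong refl) (auto simp: algebra_simps split: prod.splits)
  also have "\<dots> = (\<Sum>(i, j) \<in> pairs k. \<Sum>s=1..k.
      (if s = j then w s * int (A (i, j)) else 0) - (if s = i then w s * (1 + int (A (i, j))) else 0))"
    by (subst sum.swap) (intro sum.cong refl, auto)
  also have "\<dots> = (\<Sum>(i, j) \<in> pairs k. w j * int (A (i, j)) - w i * (1 + int (A (i, j))))"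
    by (intro sum.cong refl) (auto simp: pairs_def sum_subtractf sum.delta')
  finally show ?thesis .
qed

lemma finite_expo: "finite {A. A \<in> pairs k \<rightarrow>\<^sub>E UNIV \<and> expo k A = e}"
proof -
  define B where "B = (\<Sum>s=1..k. int s * e s) + (\<Sum>(i, j) \<in> pairs k. int i)"
  have "A (i, j) \<le> nat B" if "expo k A = e" "(i, j) \<in> pairs k" for A i j
  proof -
    have "(\<Sum>s=1..k. int s * e s) =
        (\<Sum>(i, j) \<in> pairs k. (int j - int i) * int (A (i, j)) - int i)"
      using sum_weighted_expo[of int k A] that(1) by (simp add: algebra_simps)
    then have B: "B = (\<Sum>(i, j) \<in> pairs k. (int j - int i) * int (A (i, j)))"
      by (simp add: B_def case_prod_unfold sum_subtractf)
    have "(case (i, j) of (i, j) \<Rightarrow> (int j - int i) * int (A (i, j))) \<le> B"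
      unfolding B using that(2) by (intro member_le_sum finite_pairs) (auto simp: pairs_def)
    moreover have "1 * int (A (i, j)) \<le> (int j - int i) * int (A (i, j))"
      using that(2) by (intro mult_right_mono) (auto simp: pairs_def)
    ultimately show ?thesis by simp
  qed
  then have "{A. A \<in> pairs k \<rightarrow>\<^sub>E UNIV \<and> expo k A = e} \<subseteq> pairs k \<rightarrow>\<^sub>E {..nat B}"
    by (fastforce simp: PiE_iff)
  then show ?thesis by (rule finite_subset) (simp add: finite_PiE)
qed

lemma finite_poly_part:
  "finite {b. (if Poly_Mapping.keys b \<subseteq> {1..k}
      then laurent_coeff k f (\<lambda>i. int (Poly_Mapping.lookup b i)) else 0) \<noteq> 0}" (is "finite ?S")
proof -
  define K where "K = Poly_Mapping.keys (numer k f)"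
  define N where "N = (\<Sum>b\<in>K. \<Sum>s=1..k. Poly_Mapping.lookup b s)"
  have bound: "Poly_Mapping.lookup b i \<le> N" if "b \<in> ?S" "i \<in> {1..k}" for b i
  proof -
    from that(1) have "laurent_coeff k f (\<lambda>i. int (Poly_Mapping.lookup b i)) \<noteq> 0"
      by (auto split: if_splits)
    then obtain b' where b': "b' \<in> K"
      and nz: "inv_den_coeff k (\<lambda>i. int (Poly_Mapping.lookup b i) - int (Poly_Mapping.lookup b' i)) \<noteq> 0"
      unfolding laurent_coeff_def K_def
      by (elim sum.not_neutral_contains_not_neutral) auto
    then obtain A where A: "expo k A =
        (\<lambda>i. int (Poly_Mapping.lookup b i) - int (Poly_Mapping.lookup b' i))"
      unfolding inv_den_coeff_def
      by (elim sum.not_neutral_contains_not_neutral) auto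
    have "(\<Sum>s=1..k. expo k A s) = - int (card (pairs k))"
      using sum_weighted_expo[of "\<lambda>_. 1" k A] by (simp add: case_prod_unfold)
    then have "(\<Sum>s=1..k. int (Poly_Mapping.lookup b s)) \<le> (\<Sum>s=1..k. int (Poly_Mapping.lookup b' s))"
      by (simp add: A sum_subtractf)
    then have "int (\<Sum>s=1..k. Poly_Mapping.lookup b s) \<le> int (\<Sum>s=1..k. Poly_Mapping.lookup b' s)"
      by simp
    then have "(\<Sum>s=1..k. Poly_Mapping.lookup b s) \<le> (\<Sum>s=1..k. Poly_Mapping.lookup b' s)"
      by (simp only: of_nat_le_iff)
    moreover have "Poly_Mapping.lookup b i \<le> (\<Sum>s=1..k. Poly_Mapping.lookup b s)"
      using that(2) by (intro member_le_sum) auto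
    moreover have "(\<Sum>s=1..k. Poly_Mapping.lookup b' s) \<le> N"
      unfolding N_def using b' by (intro member_le_sum) (auto simp: K_def)
    ultimately show ?thesis by linarith
  qed
  have "Poly_Mapping.lookup ` ?S \<subseteq>
      {c. \<forall>i. (i \<in> {1..k} \<longrightarrow> c i \<in> {..N}) \<and> (i \<notin> {1..k} \<longrightarrow> c i = 0)}"
  proof (intro subsetI CollectI allI conjI impI)
    fix c i assume "c \<in> Poly_Mapping.lookup ` ?S"
    then obtain b where b: "b \<in> ?S" "c = Poly_Mapping.lookup b" by auto
    show "c i \<in> {..N}" if "i \<in> {1..k}" using bound[OF b(1) that] b(2) by simp
    show "c i = 0" if "i \<notin> {1..k}"
      using b that by (auto simp: in_keys_iff split: if_splits)
  qed
  then have "finite (Poly_Mapping.lookup ` ?S)"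
    by (rule finite_subset) (rule finite_set_of_finite_funs; simp)
  then show ?thesis
    by (rule finite_imageD) (auto intro!: inj_onI poly_mapping_eqI)
qed

lemma has_value_unique:
  assumes "has_value k f c y" "has_value k f c z"
  shows "y = z"
proof -
  have "(of_rat y :: real) = of_rat z"
    using assms unfolding has_value_def
    by (intro tendsto_unique[of "at_right (0::real)"]) auto
  then show ?thesis by simp
qed

lemma value_at_eq: "has_value k f c y \<Longrightarrow> value_at k f c = y"
  unfolding value_at_def by (blast intro: the_equality has_value_unique)

lemma finite_compositions: "finite (compositions k n)"
proof -
  have "compositions k n \<subseteq> {c. \<forall>i. (i \<in> {1..k} \<longrightarrow> c i \<in> {..n}) \<and> (i \<notin> {1..k} \<longrightarrow> c i = 0)}"
    by (auto simp: compositions_def intro: member_le_sum)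
  then show ?thesis
    by (rule finite_subset) (rule finite_set_of_finite_funs; simp)
qed

end

theory Submission
  imports Defs
begin

text \<open>
  The function \<open>phi k l mu\<close> is a combination of products of two kinds of factors in disjoint sets of
  variables: falling factorials of single variables, and quotients $(x_a-x_b)/(x_a+x_b)$ of pairs.
  Once this is known, all three claims become statements about such products that hold factor by
  factor.

  \<^bold>\<open>Reduction to products.\<close> Cancelling $\prod_{i<j}(x_i-x_j)/(x_i+x_j)$ against the quotients in
  \<open>psi\<close> leaves the signed sum over permutations $\pi$ of
  $\prod_{i\le\ell}x_{\pi i}^{\underline{m_i}}\prod_{\ell<i<j}(x_{\pi i}-x_{\pi j})/(x_{\pi i}+x_{\pi j})$
  (\<open>phi_expansion\<close>). The last product is a Schur Pfaffian: it is a signed sum over matchings of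
  products of $(x_a-x_b)/(x_a+x_b)$ over the matched pairs. The expansion is obtained recursively
  (\<open>pfaffian_span_schur\<close>) from the partial fraction decomposition of $\prod_j (z-y_j)/(z+y_j)$
  (\<open>partial_fraction_product\<close>). So \<open>phi k l mu\<close> lies in the span \<open>pfaffian_span {1..k} m\<close>, where the
  index \<open>m\<close> is the total number of falling factorial steps.

  \<^bold>\<open>The factor of degree n - m.\<close> Multiplying an element of index \<open>r\<close> by $x_1+\dots+x_k-r$ gives an
  element of index $r+1$, by the Leibniz-like splitting
  $\sum_i x_i - r = \sum_i (x_i-c_i) + \sum_{\mathrm{pairs}}(x_a+x_b)$: the first terms lengthen a falling
  factorial, the others turn a quotient into the polynomial $x_a-x_b$ (\<open>pfaffian_span_step\<close>). So \<open>g\<close>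
  lies in \<open>pfaffian_span {1..k} n\<close>.

  \<^bold>\<open>Components and values.\<close> For an element \<open>f\<close> of index \<open>n\<close>, the polynomial component replaces each
  remaining quotient $(x_a-x_b)/(x_a+x_b)=1-2x_b/(x_a+x_b)$ by 1, because every term of the
  expansion of $x_b/(x_a+x_b)$ has a negative power of $x_a$. At a point with coordinate sum at most
  \<open>n\<close>, this replacement does not change the value: the value vanishes when the sum is below \<open>n\<close>, and a
  quotient contributes no steps to \<open>n\<close>, so a nonzero value forces $x_a=x_b=0$, where the quotient has
  the value 1 (\<open>pfaffian_span_poly_component\<close>). This is claim 1. The polynomial component is moreover a
  combination of $\prod_i x_i^{\underline{c_i}}$ with $\sum_i c_i=n$, and such a combination is determined
  by its values at the points with coordinate sum \<open>n\<close> (\<open>ffact_span_coefficients\<close>), which gives claim 2.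

  \<^bold>\<open>Paths.\<close> At decreasing points the values \<open>h\<close> of an element of index \<open>m\<close> satisfy
  $\sum_i c_i\,h(c-e_i)=(\sum_i c_i-m)\,h(c)$ (\<open>has_value_fun\<close>), since each factor does. With the factorials in
  front, this is the recursion for the number of paths by the last step. Steps from outside the graph
  do not contribute, since \<open>phi\<close> is antisymmetric and its value vanishes where two nonzero coordinates
  agree (\<open>phi_val_antisymmetric\<close>), and the initial values are right (\<open>phi_val_base\<close>).
\<close>

section \<open>Polynomials, their embedding, evaluation and action on Laurent series\<close>

text \<open>
  The sets \<open>polys k\<close> generalized to an arbitrary set of variables, so that products of factors in
  disjoint variables can be handled one factor at a time.
\<close>

definition poly_vars :: "nat set \<Rightarrow> mpoly set" where
  "poly_vars S = {p. \<forall>b \<in> Poly_Mapping.keys p. Poly_Mapping.keys b \<subseteq> S}"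

lemma mpoly_induct [case_names single add]:
  fixes p :: "'a \<Rightarrow>\<^sub>0 'b::monoid_add"
  assumes single: "\<And>b r. P (Poly_Mapping.single b r)"
    and add: "\<And>p q. P p \<Longrightarrow> P q \<Longrightarrow> P (p + q)"
  shows "P p"
proof (induction p rule: update_induct)
  case const
  show ?case using single[of undefined 0] by simp
next
  case (update f a b)
  have "Poly_Mapping.update a b f = f + Poly_Mapping.single a b"
    using update(1)
    by (intro poly_mapping_eqI) (auto simp: lookup_update lookup_add lookup_single in_keys_iff)
  then show ?case using update.IH single add by simp
qed

lemma rf_0 [simp]: "rf 0 = 0" by (simp add: rf_def Zero_fract_def)
lemma rf_1 [simp]: "rf 1 = 1" by (simp add: rf_def One_fract_def)
lemma rf_add: "rf (p + q) = rf p + rf q" by (simp add: rf_def)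
lemma rf_minus: "rf (- p) = - rf p" by (simp add: rf_def)
lemma rf_diff: "rf (p - q) = rf p - rf q" by (simp add: rf_def)
lemma rf_mult: "rf (p * q) = rf p * rf q" by (simp add: rf_def)
lemma rf_eq_0_iff [simp]: "rf p = 0 \<longleftrightarrow> p = 0" by (simp add: rf_def Zero_fract_def eq_fract)
lemma rf_eq_iff: "rf p = rf q \<longleftrightarrow> p = q" by (simp add: rf_def eq_fract)
lemma rf_sum: "rf (sum f A) = (\<Sum>x\<in>A. rf (f x))"
  by (induction A rule: infinite_finite_induct) (auto simp: rf_add)
lemma rf_prod: "rf (prod f A) = (\<Prod>x\<in>A. rf (f x))"
  by (induction A rule: infinite_finite_induct) (auto simp: rf_mult)
lemma rf_of_nat [simp]: "rf (of_nat n) = of_nat n"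
  by (induction n) (auto simp: rf_add)
lemma rf_numeral [simp]: "rf (numeral n) = numeral n"
  using rf_of_nat[of "numeral n"] by simp
lemma rf_ffact: "rf (ffact p n) = ffact (rf p) n"
  by (simp add: ffact_def rf_prod rf_diff)

lemmas rf_simps = rf_add rf_minus rf_diff rf_mult rf_sum rf_prod rf_ffact

lemma Const_0 [simp]: "Const 0 = 0" by (simp add: Const_def)
lemma Const_1 [simp]: "Const 1 = 1" by (simp add: Const_def)
lemma Const_add: "Const (a + b) = Const a + Const b" by (simp add: Const_def single_add)
lemma Const_mult: "Const (a * b) = Const a * Const b" by (simp add: Const_def mult_single)
lemma Const_of_nat: "Const (of_nat n) = of_nat n" by (simp add: Const_def)
lemma Const_numeral: "Const (numeral n) = numeral n"
  by (simp add: Const_def)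
lemma Const_minus: "Const (- a) = - Const a" by (simp add: Const_def single_uminus)

lemma rf_Const_inverse: "n \<noteq> 0 \<Longrightarrow> rf (Const (1 / of_nat n)) = 1 / of_nat n"
proof -
  assume "n \<noteq> 0"
  then have "Const (1 / of_nat n) * of_nat n = 1"
    by (simp flip: Const_of_nat Const_mult)
  then have "rf (Const (1 / of_nat n)) * of_nat n = 1"
    by (metis rf_1 rf_mult rf_of_nat)
  then show ?thesis by (metis mult.commute mult_zero_left nonzero_eq_divide_eq zero_neq_one)
qed

lemma polys_eq_poly_vars: "polys k = poly_vars {1..k}"
  by (simp add: polys_def poly_vars_def)

lemma poly_vars_mono: "p \<in> poly_vars S \<Longrightarrow> S \<subseteq> T \<Longrightarrow> p \<in> poly_vars T" unfolding poly_vars_def by blast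
lemma poly_vars_0: "0 \<in> poly_vars S" by (simp add: poly_vars_def)
lemma poly_vars_1: "1 \<in> poly_vars S" by (auto simp: poly_vars_def)
lemma poly_vars_Const: "Const r \<in> poly_vars S" by (auto simp: Const_def poly_vars_def)
lemma poly_vars_Var: "i \<in> S \<Longrightarrow> Var i \<in> poly_vars S" by (auto simp: Var_def poly_vars_def)
lemma poly_vars_add: "p \<in> poly_vars S \<Longrightarrow> q \<in> poly_vars S \<Longrightarrow> p + q \<in> poly_vars S"
  using keys_add[of p q] unfolding poly_vars_def by blast
lemma poly_vars_diff: "p \<in> poly_vars S \<Longrightarrow> q \<in> poly_vars S \<Longrightarrow> p - q \<in> poly_vars S"
  using keys_diff[of p q] unfolding poly_vars_def by blast
lemma poly_vars_mult:
  assumes "p \<in> poly_vars S" "q \<in> poly_vars S" shows "p * q \<in> poly_vars S"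
  unfolding poly_vars_def
proof safe
  fix b i assume b: "b \<in> Poly_Mapping.keys (p * q)" "i \<in> Poly_Mapping.keys b"
  obtain c d where "c \<in> Poly_Mapping.keys p" "d \<in> Poly_Mapping.keys q" "b = c + d"
    using keys_mult[of p q] b by blast
  then show "i \<in> S" using assms b(2) keys_add[of c d] unfolding poly_vars_def by blast
qed
lemma poly_vars_prod: "(\<And>x. x \<in> A \<Longrightarrow> f x \<in> poly_vars S) \<Longrightarrow> prod f A \<in> poly_vars S"
proof (induction A rule: infinite_finite_induct)
  case (insert x F)
  then show ?case using poly_vars_mult[of "f x" S "prod f F"] by simp
qed (auto simp: poly_vars_1)
lemma poly_vars_sum: "(\<And>x. x \<in> A \<Longrightarrow> f x \<in> poly_vars S) \<Longrightarrow> sum f A \<in> poly_vars S"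
  by (induction A rule: infinite_finite_induct) (auto intro: poly_vars_0 poly_vars_add)
lemma poly_vars_of_nat: "of_nat n \<in> poly_vars S"
  using poly_vars_Const[of "of_nat n"] by (simp add: Const_of_nat)
lemma poly_vars_ffact: "p \<in> poly_vars S \<Longrightarrow> ffact p n \<in> poly_vars S"
  unfolding ffact_def by (intro poly_vars_prod poly_vars_diff poly_vars_of_nat)

definition monom_eval :: "(nat \<Rightarrow> real) \<Rightarrow> (nat \<Rightarrow>\<^sub>0 nat) \<Rightarrow> real" where
  "monom_eval a b = (\<Prod>i\<in>Poly_Mapping.keys b. a i ^ Poly_Mapping.lookup b i)"

lemma monom_eval_superset:
  "finite A \<Longrightarrow> Poly_Mapping.keys b \<subseteq> A \<Longrightarrow>
    monom_eval a b = (\<Prod>i\<in>A. a i ^ Poly_Mapping.lookup b i)"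
  unfolding monom_eval_def by (intro prod.mono_neutral_left) (auto simp: in_keys_iff)

lemma monom_eval_add: "monom_eval a (b + c) = monom_eval a b * monom_eval a c"
proof -
  have "monom_eval a (b + c) = (\<Prod>i\<in>Poly_Mapping.keys b \<union> Poly_Mapping.keys c. a i ^ Poly_Mapping.lookup (b + c) i)"
    by (rule monom_eval_superset) (use keys_add[of b c] in auto)
  also have "\<dots> = monom_eval a b * monom_eval a c"
    by (simp add: monom_eval_superset[of "Poly_Mapping.keys b \<union> Poly_Mapping.keys c"] lookup_add power_add prod.distrib)
  finally show ?thesis .
qed

lemma poly_eval_single: "poly_eval a (Poly_Mapping.single b r) = of_rat r * monom_eval a b"
  by (simp add: poly_eval_def monom_eval_def)

lemma poly_eval_add: "poly_eval a (p + q) = poly_eval a p + poly_eval a q"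
  unfolding poly_eval_def by (intro setsum_keys_plus_distrib) (auto simp: of_rat_add algebra_simps)

lemma poly_eval_mult: "poly_eval a (p * q) = poly_eval a p * poly_eval a q"
proof (induction p rule: mpoly_induct)
  case (single b r)
  show ?case
    by (induction q rule: mpoly_induct)
       (auto simp: mult_single poly_eval_single poly_eval_add monom_eval_add of_rat_mult algebra_simps)
qed (auto simp: poly_eval_add algebra_simps)

lemma poly_eval_0 [simp]: "poly_eval a 0 = 0" by (simp add: poly_eval_def)
lemma poly_eval_Const [simp]: "poly_eval a (Const r) = of_rat r"
  by (simp add: Const_def poly_eval_single monom_eval_def)
lemma poly_eval_1 [simp]: "poly_eval a 1 = 1"
  using poly_eval_Const[of a 1] by simp
lemma poly_eval_Var [simp]: "poly_eval a (Var i) = a i"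
  by (simp add: Var_def poly_eval_single monom_eval_def)
lemma poly_eval_of_nat [simp]: "poly_eval a (of_nat n) = of_nat n"
  by (simp flip: Const_of_nat)
lemma poly_eval_minus: "poly_eval a (- p) = - poly_eval a p"
  using poly_eval_add[of a p "- p"] by simp
lemma poly_eval_diff: "poly_eval a (p - q) = poly_eval a p - poly_eval a q"
  using poly_eval_add[of a p "- q"] by (simp add: poly_eval_minus)
lemma poly_eval_sum: "poly_eval a (sum f A) = (\<Sum>x\<in>A. poly_eval a (f x))"
  by (induction A rule: infinite_finite_induct) (auto simp: poly_eval_add)
lemma poly_eval_prod: "poly_eval a (prod f A) = (\<Prod>x\<in>A. poly_eval a (f x))"
  by (induction A rule: infinite_finite_induct) (auto simp: poly_eval_mult)
lemma poly_eval_ffact: "poly_eval a (ffact p n) = ffact (poly_eval a p) n"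
  by (simp add: ffact_def poly_eval_prod poly_eval_diff)
lemmas poly_eval_simps =
  poly_eval_add poly_eval_minus poly_eval_diff poly_eval_mult poly_eval_sum poly_eval_prod poly_eval_ffact

lemma poly_eval_cong:
  "p \<in> poly_vars S \<Longrightarrow> (\<And>i. i \<in> S \<Longrightarrow> a i = a' i) \<Longrightarrow> poly_eval a p = poly_eval a' p"
  unfolding poly_eval_def poly_vars_def
  by (intro sum.cong prod.cong refl arg_cong2[of _ _ _ _ "(*)"] arg_cong2[of _ _ _ _ "(^)"]) auto

text \<open>
  The action of polynomials on formal Laurent series, which are given by their coefficient functions.
  Only finite sums arise, so arbitrary coefficient functions are admitted.
\<close>

definition conv :: "mpoly \<Rightarrow> ((nat \<Rightarrow> int) \<Rightarrow> rat) \<Rightarrow> (nat \<Rightarrow> int) \<Rightarrow> rat" where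
  "conv p G e = (\<Sum>b\<in>Poly_Mapping.keys p.
      Poly_Mapping.lookup p b * G (\<lambda>i. e i - int (Poly_Mapping.lookup b i)))"

lemma conv_single: "conv (Poly_Mapping.single b r) G e = r * G (\<lambda>i. e i - int (Poly_Mapping.lookup b i))"
  by (simp add: conv_def)

lemma conv_add: "conv (p + q) G e = conv p G e + conv q G e"
  unfolding conv_def by (intro setsum_keys_plus_distrib) (auto simp: algebra_simps)

lemma conv_add_right: "conv p (\<lambda>e. G e + H e) e = conv p G e + conv p H e"
  by (simp add: conv_def algebra_simps sum.distrib)
lemma conv_mult: "conv (p * q) G e = conv p (conv q G) e"
proof (induction p rule: mpoly_induct)
  case (single b r)
  show ?case
    by (induction q rule: mpoly_induct)
       (auto simp: mult_single conv_single conv_add conv_add_right lookup_add algebra_simps diff_diff_eq)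
qed (simp_all add: conv_add distrib_right)

lemma conv_1: "conv 1 G e = G e"
  using conv_single[of 0 1 G e] by simp

lemma conv_Const_mult: "conv (Const r * p) G e = r * conv p G e"
  by (simp add: conv_mult Const_def conv_single)

lemma conv_Var: "conv (Var i) G e = G (e(i := e i - 1))"
  by (simp add: Var_def conv_single lookup_single fun_upd_def) 
     (auto intro!: arg_cong[of _ _ G] simp: when_def)

section \<open>Expansion of products of inverse sums\<close>

definition den_on :: "(nat \<times> nat) set \<Rightarrow> mpoly" where
  "den_on M = (\<Prod>(i, j)\<in>M. Var i + Var j)"

text \<open>
  The expansion of the full denominator and its coefficients, relativized to a set \<open>M\<close> of pairs; the
  series with coefficients \<open>inv_coeff M\<close> is the expansion of $\prod_{(i,j)\in M}(x_i+x_j)^{-1}$.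
\<close>

definition expo_on :: "(nat \<times> nat) set \<Rightarrow> (nat \<times> nat \<Rightarrow> nat) \<Rightarrow> nat \<Rightarrow> int" where
  "expo_on M A s = (\<Sum>(i, j) \<in> M.
      (if s = j then int (A (i, j)) else 0) - (if s = i then 1 + int (A (i, j)) else 0))"

definition choices :: "(nat \<times> nat) set \<Rightarrow> (nat \<Rightarrow> int) \<Rightarrow> (nat \<times> nat \<Rightarrow> nat) set" where
  "choices M e = {A. A \<in> M \<rightarrow>\<^sub>E UNIV \<and> expo_on M A = e}"

definition inv_coeff :: "(nat \<times> nat) set \<Rightarrow> (nat \<Rightarrow> int) \<Rightarrow> rat" where
  "inv_coeff M e = (\<Sum>A\<in>choices M e. (-1) ^ (\<Sum>q\<in>M. A q))"

lemma inv_den_coeff_eq_inv_coeff: "inv_den_coeff k = inv_coeff (pairs k)"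
  by (rule ext) (simp add: inv_den_coeff_def inv_coeff_def choices_def expo_def[abs_def] expo_on_def[abs_def])

lemma expo_on_cong: "(\<And>q. q \<in> M \<Longrightarrow> A q = B q) \<Longrightarrow> expo_on M A = expo_on M B"
  by (rule ext) (auto simp: expo_on_def intro!: sum.cong)

lemma expo_on_insert:
  "finite M \<Longrightarrow> (a, b) \<notin> M \<Longrightarrow> expo_on (insert (a, b) M) A s =
    (if s = b then int (A (a, b)) else 0) - (if s = a then 1 + int (A (a, b)) else 0) + expo_on M A s"
  by (simp add: expo_on_def)

text \<open>
  A choice of terms for the pairs in \<open>M\<close> is extended by the first term for the other pairs; this reduces
  the claim to the finiteness for the full set of pairs.
\<close>

lemma finite_choices:
  assumes "M \<subseteq> pairs k"
  shows "finite (choices M e)"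
proof -
  define ext where "ext A = (\<lambda>q. if q \<in> M then A q else if q \<in> pairs k then 0 else undefined)"
    for A :: "nat \<times> nat \<Rightarrow> nat"
  have fin: "finite M" using assms finite_pairs by (rule finite_subset)
  define e' where "e' s = e s + expo_on (pairs k - M) (\<lambda>_. 0) s" for s
  have "ext A \<in> {A. A \<in> pairs k \<rightarrow>\<^sub>E UNIV \<and> expo k A = e'}" if "A \<in> choices M e" for A
  proof -
    have "expo k (ext A) s = e' s" for s
    proof -
      have "expo k (ext A) s = expo_on (M \<union> (pairs k - M)) (ext A) s"
        using assms by (simp add: expo_def expo_on_def Un_absorb1)
      also have "\<dots> = expo_on M (ext A) s + expo_on (pairs k - M) (ext A) s"
        unfolding expo_on_def by (rule sum.union_disjoint) (use fin in auto)
      also have "expo_on M (ext A) = expo_on M A"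
        by (rule expo_on_cong) (simp add: ext_def)
      also have "expo_on (pairs k - M) (ext A) = expo_on (pairs k - M) (\<lambda>_. 0)"
        by (rule expo_on_cong) (simp add: ext_def)
      finally show ?thesis using that by (simp add: e'_def choices_def)
    qed
    then show ?thesis using assms by (auto simp: ext_def PiE_iff extensional_def)
  qed
  then have "ext ` choices M e \<subseteq> {A. A \<in> pairs k \<rightarrow>\<^sub>E UNIV \<and> expo k A = e'}" by blast
  then have "finite (ext ` choices M e)"
    using finite_expo by (rule finite_subset)
  moreover have "inj_on ext (choices M e)"
  proof (rule inj_onI)
    fix A B assume A: "A \<in> choices M e" and B: "B \<in> choices M e" and eq: "ext A = ext B"
    have "A \<in> M \<rightarrow>\<^sub>E UNIV" "B \<in> M \<rightarrow>\<^sub>E UNIV" using A B by (simp_all add: choices_def)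
    then show "A = B"
    proof (rule PiE_ext)
      show "A q = B q" if "q \<in> M" for q using fun_cong[OF eq, of q] that by (simp add: ext_def)
    qed
  qed
  ultimately show ?thesis by (rule finite_imageD)
qed

text \<open>
  The geometric series identity $(x_a+x_b)\sum_{r\ge0}(-1)^r x_b^r x_a^{-1-r}=1$, for one factor of a
  product of such series: the two shifted series telescope, and only the term with $r=0$ survives.
\<close>

lemma conv_binomial_inv_coeff:
  assumes M: "insert (a, b) M \<subseteq> pairs k" and ab: "(a, b) \<notin> M"
  shows "conv (Var a + Var b) (inv_coeff (insert (a, b) M)) e = inv_coeff M e"
proof -
  define q where "q = (a, b)"
  define N where "N = insert q M"
  have neq: "a \<noteq> b" using M by (auto simp: pairs_def)
  have fin: "finite M" using M finite_pairs finite_subset by fastforce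
  have qM: "q \<notin> M" using ab by (simp add: q_def)
  let ?ea = "e(a := e a - 1)" and ?eb = "e(b := e b - 1)"
  let ?sg = "\<lambda>A. (-1::rat) ^ (\<Sum>q\<in>N. A q)"
  have finc: "finite (choices N e')" for e'
    using finite_choices[of N k] M by (simp add: N_def q_def)
  have ins: "expo_on N A s = (if s = b then int (A q) else 0) - (if s = a then 1 + int (A q) else 0)
      + expo_on M A s" for A s
    using expo_on_insert[OF fin ab] by (simp add: N_def q_def)
  have upd: "expo_on M (A(q := x)) = expo_on M A" for A x
    by (rule expo_on_cong) (use qM in auto)
  \<comment> \<open>Split off the choices that take the first term for the pair \<open>q\<close>. Taking one step less at \<open>q\<close>
      matches the others with the choices for \<open>?eb\<close>, with the opposite sign.\<close>
  have dec: "choices N ?ea = {A \<in> choices N ?ea. A q = 0} \<union> {A \<in> choices N ?ea. A q \<noteq> 0}" by auto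
  have "inv_coeff N ?ea = (\<Sum>A | A \<in> choices N ?ea \<and> A q = 0. ?sg A) + (\<Sum>A | A \<in> choices N ?ea \<and> A q \<noteq> 0. ?sg A)"
    unfolding inv_coeff_def by (subst dec, rule sum.union_disjoint) (use finc in auto)
  also have "(\<Sum>A | A \<in> choices N ?ea \<and> A q \<noteq> 0. ?sg A) = (\<Sum>A\<in>choices N ?eb. - ?sg A)"
  proof (rule sum.reindex_bij_witness[where i = "\<lambda>A. A(q := A q + 1)" and j = "\<lambda>A. A(q := A q - 1)"])
    fix A assume "A \<in> {A. A \<in> choices N ?ea \<and> A q \<noteq> 0}"
    then have A: "A \<in> N \<rightarrow>\<^sub>E UNIV" "expo_on N A = ?ea" "A q \<noteq> 0" by (auto simp: choices_def)
    show "(A(q := A q - 1))(q := (A(q := A q - 1)) q + 1) = A" using A by auto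
    have "expo_on N (A(q := A q - 1)) s = ?eb s" for s
      using fun_cong[OF A(2), of s] A(3) neq by (auto simp: ins upd of_nat_diff split: if_splits)
    then show "A(q := A q - 1) \<in> choices N ?eb"
      using A(1) by (auto simp: choices_def N_def PiE_iff extensional_def)
    have "(\<Sum>x\<in>N. A x) = Suc (\<Sum>x\<in>N. (A(q := A q - 1)) x)"
      using A(3) fin qM by (simp add: N_def sum.insert) (auto intro!: sum.cong)
    then show "- ?sg (A(q := A q - 1)) = ?sg A" by simp
  next
    fix A assume "A \<in> choices N ?eb"
    then have A: "A \<in> N \<rightarrow>\<^sub>E UNIV" "expo_on N A = ?eb" by (auto simp: choices_def)
    show "(A(q := A q + 1))(q := (A(q := A q + 1)) q - 1) = A" by auto
    have "expo_on N (A(q := A q + 1)) s = ?ea s" for s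
      using fun_cong[OF A(2), of s] neq by (auto simp: ins upd split: if_splits)
    then show "A(q := A q + 1) \<in> {A. A \<in> choices N ?ea \<and> A q \<noteq> 0}"
      using A(1) by (auto simp: choices_def N_def PiE_iff extensional_def)
  qed
  also have "\<dots> = - inv_coeff N ?eb" by (simp add: inv_coeff_def sum_negf)
  also have "(\<Sum>A | A \<in> choices N ?ea \<and> A q = 0. ?sg A) = inv_coeff M e"
    unfolding inv_coeff_def
  proof (rule sum.reindex_bij_witness[where i = "\<lambda>A. A(q := 0)" and j = "\<lambda>A. A(q := undefined)"])
    fix A assume "A \<in> {A. A \<in> choices N ?ea \<and> A q = 0}"
    then have A: "A \<in> N \<rightarrow>\<^sub>E UNIV" "expo_on N A = ?ea" "A q = 0" by (auto simp: choices_def)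
    show "(A(q := undefined))(q := 0) = A" using A by auto
    have "expo_on M (A(q := undefined)) s = e s" for s
      using fun_cong[OF A(2), of s] A(3) neq by (auto simp: ins upd split: if_splits)
    then show "A(q := undefined) \<in> choices M e"
      using A(1) by (auto simp: choices_def N_def PiE_iff extensional_def)
    have "(\<Sum>x\<in>M. (A(q := undefined)) x) = (\<Sum>x\<in>M. A x)" by (intro sum.cong) (use qM in auto)
    then show "(-1::rat) ^ (\<Sum>x\<in>M. (A(q := undefined)) x) = ?sg A"
      using A(3) fin qM by (simp add: N_def)
  next
    fix A assume "A \<in> choices M e"
    then have A: "A \<in> M \<rightarrow>\<^sub>E UNIV" "expo_on M A = e" by (auto simp: choices_def)
    have "A q = undefined" using A(1) qM by (rule PiE_arb)
    then show "(A(q := 0))(q := undefined) = A" by auto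
    have "expo_on N (A(q := 0)) s = ?ea s" for s
      using fun_cong[OF A(2), of s] neq by (auto simp: ins upd split: if_splits)
    then show "A(q := 0) \<in> {A. A \<in> choices N ?ea \<and> A q = 0}"
      using A(1) by (auto simp: choices_def N_def PiE_iff extensional_def)
  qed
  finally have "inv_coeff N ?ea = inv_coeff M e - inv_coeff N ?eb" by (simp only: add_uminus_conv_diff)
  then show ?thesis unfolding conv_add conv_Var N_def q_def by linarith
qed

lemma conv_den_on_inv_coeff:
  assumes "M \<union> N \<subseteq> pairs k" "M \<inter> N = {}"
  shows "conv (den_on N) (inv_coeff (M \<union> N)) e = inv_coeff M e"
proof -
  have "finite N" using assms finite_pairs finite_subset by fastforce
  then show ?thesis using assms
  proof (induction N arbitrary: e)
    case empty
    then show ?case by (simp add: den_on_def conv_1)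
  next
    case (insert q N)
    obtain a b where q: "q = (a, b)" by fastforce
    have "conv (den_on (insert q N)) (inv_coeff (M \<union> insert q N)) e
        = conv (den_on N * (Var a + Var b)) (inv_coeff (insert (a, b) (M \<union> N))) e"
      using insert.hyps by (simp add: den_on_def q mult.commute)
    also have "\<dots> = conv (den_on N) (inv_coeff (M \<union> N)) e"
    proof -
      have "conv (Var a + Var b) (inv_coeff (insert (a, b) (M \<union> N))) = inv_coeff (M \<union> N)"
        by (rule ext, rule conv_binomial_inv_coeff[of _ _ _ k]) (use insert in \<open>auto simp: q\<close>)
      then show ?thesis by (simp add: conv_mult)
    qed
    also have "\<dots> = inv_coeff M e" using insert by auto
    finally show ?case .
  qed
qed

lemma inv_coeff_empty: "inv_coeff {} e = (if e = (\<lambda>_. 0) then 1 else 0)"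
  by (auto simp: inv_coeff_def choices_def expo_on_def[abs_def])

text \<open>
  Only the pairs with second component \<open>a\<close> can contribute positive powers of $x_a$.
\<close>

lemma inv_coeff_negative_exponent:
  assumes "inv_coeff M e \<noteq> 0" "finite M" "(a, b) \<in> M" "\<And>i j. (i, j) \<in> M \<Longrightarrow> j \<noteq> a"
  shows "e a < 0"
proof -
  obtain A where A: "expo_on M A = e"
    using assms(1) unfolding inv_coeff_def choices_def by (elim sum.not_neutral_contains_not_neutral) auto
  have "expo_on M A a \<le> (\<Sum>q\<in>M. if q = (a, b) then -1 else 0)"
    unfolding expo_on_def
  proof (rule sum_mono)
    fix q assume q: "q \<in> M"
    obtain i j where ij: "q = (i, j)" by fastforce
    show "(case q of (i, j) \<Rightarrow> (if a = j then int (A (i, j)) else 0) -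
        (if a = i then 1 + int (A (i, j)) else 0)) \<le> (if q = (a, b) then -1 else 0)"
      using assms(4)[of i j] q ij by auto
  qed
  also have "\<dots> = -1" using assms(2,3) by simp
  finally show ?thesis using A by simp
qed

lemma conv_vars_support:
  assumes "conv p G e \<noteq> 0" "p \<in> poly_vars S"
  obtains e' where "G e' \<noteq> 0" "\<And>i. i \<notin> S \<Longrightarrow> e' i = e i"
proof -
  obtain b where b: "b \<in> Poly_Mapping.keys p"
     "Poly_Mapping.lookup p b * G (\<lambda>i. e i - int (Poly_Mapping.lookup b i)) \<noteq> 0"
    using assms(1) unfolding conv_def by (elim sum.not_neutral_contains_not_neutral) auto
  show thesis
  proof (rule that[of "\<lambda>i. e i - int (Poly_Mapping.lookup b i)"])
    show "e i - int (Poly_Mapping.lookup b i) = e i" if "i \<notin> S" for i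
      using b(1) assms(2) that unfolding poly_vars_def
      by (simp add: in_keys_iff) (metis in_keys_iff subsetD)
  qed (use b in auto)
qed

lemma den_on_nonzero [simp]: "den_on M \<noteq> 0"
  by (cases "finite M") (auto simp: den_on_def Var_add_nonzero)

lemma den_eq_den_on: "den k = den_on (pairs k)" by (simp add: den_def den_on_def)

lemma den_on_Un: "finite M \<Longrightarrow> finite N \<Longrightarrow> M \<inter> N = {} \<Longrightarrow> den_on (M \<union> N) = den_on M * den_on N"
  unfolding den_on_def by (rule prod.union_disjoint)

lemma poly_vars_den_on: "M \<subseteq> S \<times> S \<Longrightarrow> den_on M \<in> poly_vars S"
  unfolding den_on_def by (intro poly_vars_prod) (auto intro!: poly_vars_add poly_vars_Var)

lemma fraction_extend:
  assumes "M \<union> N \<subseteq> pairs k" "M \<inter> N = {}"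
  shows "rf p / rf (den_on M) = rf (p * den_on N) / rf (den_on (M \<union> N))"
proof -
  have "finite M" "finite N" using assms finite_pairs finite_subset by fastforce+
  then show ?thesis using assms by (simp add: den_on_Un rf_mult)
qed

text \<open>
  The coefficients are defined through the numerator over the full denominator; the factors that this
  numerator has in excess cancel against the expansions of the same factors.
\<close>

lemma laurent_fraction:
  assumes "p \<in> polys k" "M \<subseteq> pairs k"
  shows "rf p / rf (den_on M) \<in> Mclass k"
    and "laurent_coeff k (rf p / rf (den_on M)) e = conv p (inv_coeff M) e"
proof -
  let ?N = "pairs k - M"
  have MN: "M \<union> ?N = pairs k" using assms(2) by auto
  have f: "rf p / rf (den_on M) = rf (p * den_on ?N) / rf (den k)"
    unfolding den_eq_den_on using fraction_extend[of M ?N k p] assms(2) MN by simp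
  have v: "p * den_on ?N \<in> polys k"
    using assms(1) unfolding polys_eq_poly_vars
    by (intro poly_vars_mult poly_vars_den_on) (auto simp: pairs_def)
  then show "rf p / rf (den_on M) \<in> Mclass k" unfolding Mclass_def f by blast
  have "laurent_coeff k (rf p / rf (den_on M)) e = conv (p * den_on ?N) (inv_coeff (pairs k)) e"
    unfolding laurent_coeff_def f numer_unique[OF v] conv_def inv_den_coeff_eq_inv_coeff ..
  also have "\<dots> = conv p (conv (den_on ?N) (inv_coeff (M \<union> ?N))) e" unfolding MN conv_mult ..
  also have "conv (den_on ?N) (inv_coeff (M \<union> ?N)) = inv_coeff M"
    by (rule ext, rule conv_den_on_inv_coeff[of _ _ k]) (use assms(2) in auto)
  finally show "laurent_coeff k (rf p / rf (den_on M)) e = conv p (inv_coeff M) e" .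
qed

lemma Mclass_iff: "f \<in> Mclass k \<longleftrightarrow> (\<exists>p\<in>polys k. f = rf p / rf (den k))"
  by (auto simp: Mclass_def)

lemma laurent_Mclass:
  assumes "p \<in> polys k"
  shows "laurent_coeff k (rf p / rf (den k)) e = conv p (inv_coeff (pairs k)) e"
  using laurent_fraction(2)[OF assms order_refl] by (simp add: den_eq_den_on)

lemma Mclass_add: "f \<in> Mclass k \<Longrightarrow> g \<in> Mclass k \<Longrightarrow> f + g \<in> Mclass k"
  unfolding Mclass_iff polys_eq_poly_vars by (metis add_divide_distrib poly_vars_add rf_add)

lemma laurent_add:
  assumes "f \<in> Mclass k" "g \<in> Mclass k"
  shows "laurent_coeff k (f + g) e = laurent_coeff k f e + laurent_coeff k g e"
proof -
  obtain p q where pq: "p \<in> polys k" "q \<in> polys k" "f = rf p / rf (den k)" "g = rf q / rf (den k)"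
    using assms unfolding Mclass_iff by blast
  have "f + g = rf (p + q) / rf (den k)" by (simp add: pq rf_add add_divide_distrib)
  moreover have "p + q \<in> polys k" using pq(1,2) by (simp add: polys_eq_poly_vars poly_vars_add)
  ultimately show ?thesis using pq by (simp add: laurent_Mclass conv_add)
qed

lemma laurent_poly_mult:
  assumes "f \<in> Mclass k" "q \<in> polys k"
  shows "laurent_coeff k (rf q * f) e = conv q (laurent_coeff k f) e"
proof -
  obtain p where p: "p \<in> polys k" "f = rf p / rf (den k)"
    using assms unfolding Mclass_iff by blast
  have "rf q * f = rf (q * p) / rf (den k)" by (simp add: p rf_mult)
  moreover have "q * p \<in> polys k" using p assms by (simp add: polys_eq_poly_vars poly_vars_mult)
  moreover have "laurent_coeff k f = conv p (inv_coeff (pairs k))"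
    by (rule ext) (simp add: p laurent_Mclass)
  ultimately show ?thesis by (simp add: laurent_Mclass conv_mult)
qed

lemma conv_inv_coeff_empty:
  "conv p (inv_coeff {}) (\<lambda>i. int (Poly_Mapping.lookup b i)) = Poly_Mapping.lookup p b"
proof -
  have eq: "(\<lambda>i. int (Poly_Mapping.lookup b i) - int (Poly_Mapping.lookup b' i)) = (\<lambda>_. 0) \<longleftrightarrow> b' = b" for b'
    by (auto simp: fun_eq_iff poly_mapping_eq_iff)
  show ?thesis unfolding conv_def inv_coeff_empty eq
    by (cases "b \<in> Poly_Mapping.keys p") (auto simp: if_distrib in_keys_iff cong: if_cong)
qed

text \<open>
  The series of a polynomial is its action on \<open>inv_coeff {}\<close>, the series of the constant 1.
\<close>

lemma poly_part_eqI:
  assumes P: "P \<in> polys k"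
    and eq: "\<And>e. (\<forall>i\<in>{1..k}. 0 \<le> e i) \<Longrightarrow> laurent_coeff k f e = conv P (inv_coeff {}) e"
  shows "poly_part k f = P"
proof (rule poly_mapping_eqI)
  fix b
  have "Poly_Mapping.lookup (poly_part k f) b = (if Poly_Mapping.keys b \<subseteq> {1..k}
      then laurent_coeff k f (\<lambda>i. int (Poly_Mapping.lookup b i)) else 0)"
    unfolding poly_part_def by (subst lookup_Abs_poly_mapping[OF finite_poly_part]) (rule refl)
  also have "\<dots> = Poly_Mapping.lookup P b"
    using P by (auto simp: eq conv_inv_coeff_empty polys_def in_keys_iff)
  finally show "Poly_Mapping.lookup (poly_part k f) b = Poly_Mapping.lookup P b" .
qed

section \<open>Evaluation and limits of rational functions\<close>

text \<open>
  The value of a rational function at a point through any representation whose denominator does not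
  vanish there. The functions with such a representation form a ring, whereas products lead out of
  \<open>Mclass k\<close> in general; so values can be computed factor by factor.
\<close>

definition reval :: "(nat \<Rightarrow> real) \<Rightarrow> ratfun \<Rightarrow> real \<Rightarrow> bool" where
  "reval a f r \<longleftrightarrow>
     (\<exists>p q. f = rf p / rf q \<and> poly_eval a q \<noteq> 0 \<and> r = poly_eval a p / poly_eval a q)"

lemma revalI: "f = rf p / rf q \<Longrightarrow> poly_eval a q \<noteq> 0 \<Longrightarrow> reval a f (poly_eval a p / poly_eval a q)"
  unfolding reval_def by blast

lemma nonzero_of_eval: "poly_eval a q \<noteq> 0 \<Longrightarrow> q \<noteq> 0" by auto

lemma reval_unique:
  assumes "reval a f r" "reval a f s"
  shows "r = s"
proof -
  obtain p q p' q' where pq: "f = rf p / rf q" "poly_eval a q \<noteq> 0" "r = poly_eval a p / poly_eval a q"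
    "f = rf p' / rf q'" "poly_eval a q' \<noteq> 0" "s = poly_eval a p' / poly_eval a q'"
    using assms unfolding reval_def by blast
  have "rf q \<noteq> 0" "rf q' \<noteq> 0" using pq nonzero_of_eval by auto
  then have "rf (p * q') = rf (p' * q)" using pq(1,4) by (simp add: rf_mult field_simps)
  then have "poly_eval a (p * q') = poly_eval a (p' * q)" by (simp add: rf_eq_iff)
  then show ?thesis unfolding pq(3,6) using pq(2,5) by (simp add: poly_eval_mult frac_eq_eq)
qed

lemma reval_rf: "reval a (rf p) (poly_eval a p)"
  using revalI[of "rf p" p 1 a] by simp

lemma reval_add:
  assumes "reval a f r" "reval a g s"
  shows "reval a (f + g) (r + s)"
proof -
  obtain p q p' q' where pq: "f = rf p / rf q" "poly_eval a q \<noteq> 0" "r = poly_eval a p / poly_eval a q"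
    "g = rf p' / rf q'" "poly_eval a q' \<noteq> 0" "s = poly_eval a p' / poly_eval a q'"
    using assms unfolding reval_def by blast
  have nz: "rf q \<noteq> 0" "rf q' \<noteq> 0" using pq nonzero_of_eval by auto
  have "f + g = rf (p * q' + p' * q) / rf (q * q')"
    using nz by (simp add: pq rf_simps add_frac_eq)
  moreover have "r + s = poly_eval a (p * q' + p' * q) / poly_eval a (q * q')"
    using pq by (simp add: poly_eval_simps add_frac_eq)
  moreover have "poly_eval a (q * q') \<noteq> 0" using pq by (simp add: poly_eval_mult)
  ultimately show ?thesis unfolding reval_def by blast
qed

lemma reval_mult:
  assumes "reval a f r" "reval a g s"
  shows "reval a (f * g) (r * s)"
proof -
  obtain p q p' q' where pq: "f = rf p / rf q" "poly_eval a q \<noteq> 0" "r = poly_eval a p / poly_eval a q"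
    "g = rf p' / rf q'" "poly_eval a q' \<noteq> 0" "s = poly_eval a p' / poly_eval a q'"
    using assms unfolding reval_def by blast
  have "f * g = rf (p * p') / rf (q * q')" by (simp add: pq rf_simps)
  moreover have "r * s = poly_eval a (p * p') / poly_eval a (q * q')"
    using pq by (simp add: poly_eval_mult)
  moreover have "poly_eval a (q * q') \<noteq> 0" using pq by (simp add: poly_eval_mult)
  ultimately show ?thesis unfolding reval_def by blast
qed

text \<open>
  The values at a point with natural coordinates, as in \<open>has_value\<close> but without the restriction to \<open>Mclass k\<close>.
\<close>

definition lim_at :: "ratfun \<Rightarrow> (nat \<Rightarrow> nat) \<Rightarrow> real \<Rightarrow> bool" where
  "lim_at f c y \<longleftrightarrow> (\<exists>h. (\<forall>\<^sub>F t in at_right 0. reval (curve (\<lambda>i. of_nat (c i)) t) f (h t)) \<and>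
      (h \<longlongrightarrow> y) (at_right 0))"

lemma lim_atI:
  "\<forall>\<^sub>F t in at_right 0. reval (curve (\<lambda>i. of_nat (c i)) t) f (h t) \<Longrightarrow>
    (h \<longlongrightarrow> y) (at_right 0) \<Longrightarrow> lim_at f c y"
  unfolding lim_at_def by (intro exI[of _ h] conjI)

lemma lim_at_unique:
  assumes "lim_at f c y" "lim_at f c z"
  shows "y = z"
proof -
  obtain h h' where h: "\<forall>\<^sub>F t in at_right 0. reval (curve (\<lambda>i. of_nat (c i)) t) f (h t)"
      "(h \<longlongrightarrow> y) (at_right 0)"
      "\<forall>\<^sub>F t in at_right 0. reval (curve (\<lambda>i. of_nat (c i)) t) f (h' t)" "(h' \<longlongrightarrow> z) (at_right 0)"
    using assms unfolding lim_at_def by blast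
  have "\<forall>\<^sub>F t in at_right 0. h t = h' t"
    using h(1,3) by eventually_elim (rule reval_unique)
  then have "(h' \<longlongrightarrow> y) (at_right 0)" using h(2) by (rule Lim_transform_eventually[rotated])
  then show ?thesis using h(4) by (intro tendsto_unique[of "at_right (0::real)"]) auto
qed

lemma lim_at_add:
  assumes "lim_at f c y" "lim_at g c z"
  shows "lim_at (f + g) c (y + z)"
proof -
  obtain h h' where h: "\<forall>\<^sub>F t in at_right 0. reval (curve (\<lambda>i. of_nat (c i)) t) f (h t)"
      "(h \<longlongrightarrow> y) (at_right 0)"
      "\<forall>\<^sub>F t in at_right 0. reval (curve (\<lambda>i. of_nat (c i)) t) g (h' t)" "(h' \<longlongrightarrow> z) (at_right 0)"
    using assms unfolding lim_at_def by blast
  have "\<forall>\<^sub>F t in at_right 0. reval (curve (\<lambda>i. of_nat (c i)) t) (f + g) (h t + h' t)"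
    using h(1,3) by eventually_elim (rule reval_add)
  then show ?thesis using tendsto_add[OF h(2,4)] by (rule lim_atI)
qed

lemma lim_at_mult:
  assumes "lim_at f c y" "lim_at g c z"
  shows "lim_at (f * g) c (y * z)"
proof -
  obtain h h' where h: "\<forall>\<^sub>F t in at_right 0. reval (curve (\<lambda>i. of_nat (c i)) t) f (h t)"
      "(h \<longlongrightarrow> y) (at_right 0)"
      "\<forall>\<^sub>F t in at_right 0. reval (curve (\<lambda>i. of_nat (c i)) t) g (h' t)" "(h' \<longlongrightarrow> z) (at_right 0)"
    using assms unfolding lim_at_def by blast
  have "\<forall>\<^sub>F t in at_right 0. reval (curve (\<lambda>i. of_nat (c i)) t) (f * g) (h t * h' t)"
    using h(1,3) by eventually_elim (rule reval_mult)
  then show ?thesis using tendsto_mult[OF h(2,4)] by (rule lim_atI)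
qed

lemma lim_at_Const: "lim_at (rf (Const r)) c (of_rat r)"
  unfolding lim_at_def
  by (intro exI[of _ "\<lambda>_. of_rat r"]) (use reval_rf[of _ "Const r"] in auto)

lemma lim_at_0: "lim_at 0 c 0" using lim_at_Const[of 0] by simp
lemma lim_at_1: "lim_at 1 c 1" using lim_at_Const[of 1] by simp

lemma lim_at_sum: "(\<And>x. x \<in> A \<Longrightarrow> lim_at (f x) c (y x)) \<Longrightarrow> lim_at (sum f A) c (sum y A)"
  by (induction A rule: infinite_finite_induct) (auto intro: lim_at_0 lim_at_add)

lemma lim_at_prod: "(\<And>x. x \<in> A \<Longrightarrow> lim_at (f x) c (y x)) \<Longrightarrow> lim_at (prod f A) c (prod y A)"
  by (induction A rule: infinite_finite_induct) (auto intro: lim_at_1 lim_at_mult)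

lemma curve_nat: "curve (\<lambda>i. of_nat (c i)) t i =
    (if c i = 0 then t ^ card {j \<in> {1..i}. c j = 0} else of_nat (c i))"
  by (simp add: curve_def)

lemma curve_tendsto:
  assumes "1 \<le> i"
  shows "((\<lambda>t. curve (\<lambda>i. of_nat (c i)) t i) \<longlongrightarrow> of_nat (c i)) (at_right 0)"
proof (cases "c i = 0")
  case True
  have "i \<in> {j \<in> {1..i}. c j = 0}" using True assms by auto
  then have "card {j \<in> {1..i}. c j = 0} \<noteq> 0" by (subst card_0_eq) auto
  then have "((\<lambda>t::real. t ^ card {j \<in> {1..i}. c j = 0}) \<longlongrightarrow> 0) (at_right 0)"
    by (auto intro!: tendsto_eq_intros simp: power_0_left)
  then show ?thesis using True by (simp add: curve_nat)
qed (simp add: curve_nat)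

lemma lim_at_poly:
  assumes "p \<in> poly_vars S" "0 \<notin> S"
  shows "lim_at (rf p) c (poly_eval (\<lambda>i. of_nat (c i)) p)"
  unfolding lim_at_def
proof (intro exI conjI)
  show "((\<lambda>t. poly_eval (curve (\<lambda>i. of_nat (c i)) t) p) \<longlongrightarrow> poly_eval (\<lambda>i. of_nat (c i)) p) (at_right 0)"
    unfolding poly_eval_def
  proof (intro tendsto_intros curve_tendsto)
    fix b i assume "b \<in> Poly_Mapping.keys p" "i \<in> Poly_Mapping.keys b"
    then have "i \<in> S" using assms(1) unfolding poly_vars_def by blast
    then show "1 \<le> i" using assms(2) by (cases i) auto
  qed
qed (simp add: reval_rf)

definition pair_quot :: "nat \<Rightarrow> nat \<Rightarrow> ratfun" where
  "pair_quot a b = (X a - X b) / (X a + X b)"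

text \<open>
  The value of $(x_a-x_b)/(x_a+x_b)$ at \<open>c\<close>. If both coordinates vanish, the one with the larger index
  tends to 0 faster along the curve, hence the sign.
\<close>

definition pair_quot_val :: "(nat \<Rightarrow> nat) \<Rightarrow> nat \<Rightarrow> nat \<Rightarrow> real" where
  "pair_quot_val c a b = (if c a = 0 \<and> c b = 0 then (if a < b then 1 else -1)
     else (of_nat (c a) - of_nat (c b)) / (of_nat (c a) + of_nat (c b)))"

lemma X_add_nonzero: "X a + X b \<noteq> 0"
  by (simp flip: rf_add add: Var_add_nonzero)

lemma X_diff_nonzero: "a \<noteq> b \<Longrightarrow> X a - X b \<noteq> 0"
proof
  assume ab: "a \<noteq> b" and "X a - X b = 0"
  then have "Var a = Var b" by (simp add: rf_eq_iff)
  then have "poly_eval (\<lambda>i. if i = a then 1 else 0) (Var a) = poly_eval (\<lambda>i. if i = a then 1 else 0) (Var b)"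
    by simp
  then show False using ab by simp
qed

lemma pair_quot_swap: "pair_quot b a = - pair_quot a b"
  by (simp add: pair_quot_def add.commute minus_divide_left)

lemma pair_quot_val_swap: "a \<noteq> b \<Longrightarrow> pair_quot_val c b a = - pair_quot_val c a b"
  by (auto simp: pair_quot_val_def add.commute minus_divide_left)

lemma pair_quot_val_Rats: "pair_quot_val c a b \<in> \<rat>"
  by (auto simp: pair_quot_val_def)

lemma curve_pos: "0 < t \<Longrightarrow> 0 < curve (\<lambda>i. of_nat (c i)) t i"
  by (simp add: curve_nat)

lemma reval_pair_quot:
  assumes "a i + a j \<noteq> 0"
  shows "reval a (pair_quot i j) ((a i - a j) / (a i + a j))"
proof -
  have "reval a (pair_quot i j) (poly_eval a (Var i - Var j) / poly_eval a (Var i + Var j))"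
    using assms by (intro revalI) (auto simp: pair_quot_def rf_simps poly_eval_simps)
  then show ?thesis by (simp add: poly_eval_simps)
qed

lemma lim_at_pair_quot_less:
  assumes "a < b" "1 \<le> a"
  shows "lim_at (pair_quot a b) c (pair_quot_val c a b)"
proof -
  let ?x = "\<lambda>i t. curve (\<lambda>i. of_nat (c i)) t i"
  have ev: "\<forall>\<^sub>F t in at_right 0. reval (curve (\<lambda>i. of_nat (c i)) t) (pair_quot a b)
      ((?x a t - ?x b t) / (?x a t + ?x b t))"
    using eventually_at_right_less[of "0::real"]
  proof eventually_elim
    fix t :: real assume "0 < t"
    then have "0 < ?x a t + ?x b t" by (intro add_pos_pos curve_pos)
    then show "reval (curve (\<lambda>i. of_nat (c i)) t) (pair_quot a b) ((?x a t - ?x b t) / (?x a t + ?x b t))"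
      by (intro reval_pair_quot) simp
  qed
  have "((\<lambda>t. (?x a t - ?x b t) / (?x a t + ?x b t)) \<longlongrightarrow> pair_quot_val c a b) (at_right 0)"
  proof (cases "c a = 0 \<and> c b = 0")
    case False
    have "((\<lambda>t. (?x a t - ?x b t) / (?x a t + ?x b t)) \<longlongrightarrow>
        (of_nat (c a) - of_nat (c b)) / (of_nat (c a) + of_nat (c b))) (at_right 0)"
      by (intro tendsto_intros curve_tendsto) (use assms False in auto)
    moreover have "pair_quot_val c a b = (of_nat (c a) - of_nat (c b)) / (of_nat (c a) + of_nat (c b))"
      unfolding pair_quot_val_def using False by (rule if_not_P)
    ultimately show ?thesis by simp
  next
    case True
    \<comment> \<open>The curve is $(t^A,t^B)$ in these two coordinates with $A<B$; divide by $t^A$.\<close>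
    define A where "A = card {j \<in> {1..a}. c j = 0}"
    define B where "B = card {j \<in> {1..b}. c j = 0}"
    have "b \<in> {j \<in> {1..b}. c j = 0}" "b \<notin> {j \<in> {1..a}. c j = 0}"
      using assms True by auto
    then have "{j \<in> {1..a}. c j = 0} \<noteq> {j \<in> {1..b}. c j = 0}" by blast
    moreover have "{j \<in> {1..a}. c j = 0} \<subseteq> {j \<in> {1..b}. c j = 0}" using assms by auto
    ultimately have "{j \<in> {1..a}. c j = 0} \<subset> {j \<in> {1..b}. c j = 0}" by (rule psubsetI[rotated])
    then have AB: "A < B" unfolding A_def B_def by (intro psubset_card_mono) auto
    have "((\<lambda>t::real. (1 - t ^ (B - A)) / (1 + t ^ (B - A))) \<longlongrightarrow> (1 - 0) / (1 + 0)) (at_right 0)"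
      by (intro tendsto_intros) (use AB in \<open>auto intro!: tendsto_eq_intros\<close>)
    moreover have "\<forall>\<^sub>F t in at_right 0.
        (1 - t ^ (B - A)) / (1 + t ^ (B - A)) = (?x a t - ?x b t) / (?x a t + ?x b t)"
      using eventually_at_right_less[of "0::real"]
    proof eventually_elim
      fix t :: real assume t: "0 < t"
      have "t ^ B = t ^ A * t ^ (B - A)" using AB by (simp flip: power_add)
      then have "(t ^ A - t ^ B) / (t ^ A + t ^ B)
          = (t ^ A * (1 - t ^ (B - A))) / (t ^ A * (1 + t ^ (B - A)))"
        by (simp add: algebra_simps)
      then show "(1 - t ^ (B - A)) / (1 + t ^ (B - A)) = (?x a t - ?x b t) / (?x a t + ?x b t)"
        using t True by (simp add: curve_nat A_def B_def)
    qed
    ultimately show ?thesis using True assms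
      by (simp add: pair_quot_val_def) (rule Lim_transform_eventually)
  qed
  with ev show ?thesis by (rule lim_atI)
qed

lemma lim_at_pair_quot:
  assumes "a \<noteq> b" "1 \<le> a" "1 \<le> b"
  shows "lim_at (pair_quot a b) c (pair_quot_val c a b)"
proof (cases "a < b")
  case False
  then have "lim_at (rf (Const (-1)) * pair_quot b a) c (of_rat (-1) * pair_quot_val c b a)"
    using assms by (intro lim_at_mult lim_at_Const lim_at_pair_quot_less) auto
  then show ?thesis using assms pair_quot_swap[of a b] pair_quot_val_swap[of a b c] by (simp add: Const_minus rf_minus)
qed (use assms lim_at_pair_quot_less in auto)

text \<open>
  Along the curve all coordinates are positive, so the denominator \<open>den k\<close> does not vanish there.
\<close>

lemma has_value_lim_at:
  assumes f: "f \<in> Mclass k" and y: "lim_at f c (of_rat y)"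
  shows "has_value k f (\<lambda>i. of_nat (c i)) y"
proof -
  obtain p where p: "p \<in> polys k" "f = rf p / rf (den k)" using f unfolding Mclass_iff by blast
  have num: "numer k f = p" unfolding p(2) by (rule numer_unique[OF p(1)])
  let ?a = "\<lambda>t. curve (\<lambda>i. of_nat (c i)) t"
  obtain h where h: "\<forall>\<^sub>F t in at_right 0. reval (?a t) f (h t)" "(h \<longlongrightarrow> of_rat y) (at_right 0)"
    using y unfolding lim_at_def by blast
  have "\<forall>\<^sub>F t in at_right 0. h t = poly_eval (?a t) p / poly_eval (?a t) (den k)"
    using h(1) eventually_at_right_less[of "0::real"]
  proof eventually_elim
    fix t :: real assume r: "reval (?a t) f (h t)" and t: "0 < t"
    have "0 < poly_eval (?a t) (den k)"
      unfolding den_def poly_eval_prod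
      by (intro prod_pos) (auto simp: poly_eval_add intro!: add_pos_pos curve_pos t)
    then have "reval (?a t) f (poly_eval (?a t) p / poly_eval (?a t) (den k))"
      by (intro revalI p) simp
    then show "h t = poly_eval (?a t) p / poly_eval (?a t) (den k)"
      using r by (rule reval_unique[rotated])
  qed
  then have "((\<lambda>t. poly_eval (?a t) p / poly_eval (?a t) (den k)) \<longlongrightarrow> of_rat y) (at_right 0)"
    using h(2) by (rule Lim_transform_eventually[rotated])
  then show ?thesis unfolding has_value_def num using f by blast
qed

section \<open>The span of products of falling factorials\<close>

definition comps :: "nat set \<Rightarrow> nat \<Rightarrow> (nat \<Rightarrow> nat) set" where
  "comps S n = {c. (\<forall>i. i \<notin> S \<longrightarrow> c i = 0) \<and> sum c S = n}"

definition ffact_monom :: "nat set \<Rightarrow> (nat \<Rightarrow> nat) \<Rightarrow> mpoly" where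
  "ffact_monom S c = (\<Prod>i\<in>S. ffact (Var i) (c i))"

text \<open>
  Spans are defined inductively with the linear closure among the rules, so that a property that is
  stable under linear combinations is proved by one induction, on the generators.
\<close>

inductive ffact_span :: "nat set \<Rightarrow> nat \<Rightarrow> mpoly \<Rightarrow> bool" where
  zero: "finite S \<Longrightarrow> ffact_span S n 0"
| gen: "finite S \<Longrightarrow> c \<in> comps S n \<Longrightarrow> ffact_span S n (ffact_monom S c)"
| add: "ffact_span S n p \<Longrightarrow> ffact_span S n q \<Longrightarrow> ffact_span S n (p + q)"
| scale: "ffact_span S n p \<Longrightarrow> ffact_span S n (Const r * p)"

lemma ffact_span_finite: "ffact_span S n p \<Longrightarrow> finite S"
  by (induction rule: ffact_span.induct) auto

lemma ffact_span_vars: "ffact_span S n p \<Longrightarrow> p \<in> poly_vars S"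
proof (induction rule: ffact_span.induct)
  case (gen S c n)
  show ?case unfolding ffact_monom_def by (intro poly_vars_prod poly_vars_ffact poly_vars_Var)
qed (auto intro: poly_vars_0 poly_vars_add poly_vars_mult poly_vars_Const)

lemma ffact_span_sum:
  "finite S \<Longrightarrow> (\<And>x. x \<in> A \<Longrightarrow> ffact_span S n (f x)) \<Longrightarrow> ffact_span S n (sum f A)"
  by (induction A rule: infinite_finite_induct) (auto intro: ffact_span.zero ffact_span.add)

lemma ffact_span_mult:
  assumes "ffact_span R r p" "ffact_span S n q" "R \<inter> S = {}"
  shows "ffact_span (R \<union> S) (r + n) (p * q)"
  using assms
proof (induction R r p rule: ffact_span.induct)
  case (zero R r)
  then show ?case by (auto intro: ffact_span.zero dest: ffact_span_finite)
next
  case (add R r p p')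
  then show ?case by (simp add: distrib_right ffact_span.add)
next
  case (scale R r p x)
  then show ?case by (simp add: mult.assoc ffact_span.scale)
next
  case (gen R c r)
  from gen.prems gen.hyps show ?case
  proof (induction S n q rule: ffact_span.induct)
    case (zero S n)
    then show ?case by (auto intro: ffact_span.zero)
  next
    case (add S n p p')
    then show ?case by (simp add: distrib_left ffact_span.add)
  next
    case (scale S n p x)
    then show ?case by (simp add: mult.left_commute ffact_span.scale)
  next
    case (gen S d n)
    have cd: "c i = 0" if "i \<in> S" for i
      using that gen.prems by (auto simp: comps_def)
    have dc: "d i = 0" if "i \<in> R" for i
      using that gen.prems gen.hyps by (auto simp: comps_def)
    let ?e = "\<lambda>i. c i + d i"
    have "ffact_monom (R \<union> S) ?e = ffact_monom R ?e * ffact_monom S ?e"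
      unfolding ffact_monom_def by (rule prod.union_disjoint) (use gen in auto)
    also have "ffact_monom R ?e = ffact_monom R c" unfolding ffact_monom_def by (rule prod.cong) (auto simp: dc)
    also have "ffact_monom S ?e = ffact_monom S d" unfolding ffact_monom_def by (rule prod.cong) (auto simp: cd)
    finally have eq: "ffact_monom R c * ffact_monom S d = ffact_monom (R \<union> S) ?e" ..
    have "sum ?e (R \<union> S) = sum ?e R + sum ?e S" by (rule sum.union_disjoint) (use gen in auto)
    also have "\<dots> = sum c R + sum d S" by (simp add: sum.distrib cd dc)
    finally have "?e \<in> comps (R \<union> S) (r + n)" using gen by (auto simp: comps_def)
    then show ?case unfolding eq using gen by (intro ffact_span.gen) auto
  qed
qed

lemma ffact_span_one: "finite S \<Longrightarrow> ffact_span S 0 1"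
  using ffact_span.gen[of S "\<lambda>_. 0" 0] by (simp add: comps_def ffact_monom_def ffact_def)

lemma ffact_span_extend: "ffact_span S n p \<Longrightarrow> finite R \<Longrightarrow> R \<inter> S = {} \<Longrightarrow> ffact_span (R \<union> S) n p"
  using ffact_span_mult[OF ffact_span_one[of R], of S n p] by simp

lemma ffact_Suc: "ffact x (Suc n) = ffact x n * (x - of_nat n)"
  by (simp add: ffact_def)

text \<open>
  Write the factor as $\sum_i(x_i-c_i)$; the \<open>i\<close>-th summand turns $x_i^{\underline{c_i}}$ into
  $x_i^{\underline{c_i+1}}$.
\<close>

lemma ffact_span_step:
  assumes "ffact_span S n p"
  shows "ffact_span S (Suc n) (((\<Sum>i\<in>S. Var i) - of_nat n) * p)"
  using assms
proof (induction rule: ffact_span.induct)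
  case (gen S c n)
  have "((\<Sum>i\<in>S. Var i) - of_nat n) * ffact_monom S c = (\<Sum>i\<in>S. (Var i - of_nat (c i)) * ffact_monom S c)"
    using gen by (simp add: comps_def sum_distrib_right[symmetric] sum_subtractf flip: of_nat_sum)
  also have "\<dots> = (\<Sum>i\<in>S. ffact_monom S (c(i := Suc (c i))))"
  proof (rule sum.cong)
    fix i assume i: "i \<in> S"
    have "ffact_monom S (c(i := Suc (c i))) = ffact (Var i) (Suc (c i)) * (\<Prod>j\<in>S - {i}. ffact (Var j) (c j))"
      unfolding ffact_monom_def using gen i by (subst prod.remove[of S i]) auto
    also have "\<dots> = (Var i - of_nat (c i)) * ffact_monom S c"
      unfolding ffact_monom_def using gen i by (simp add: ffact_Suc prod.remove[of S i])
    finally show "(Var i - of_nat (c i)) * ffact_monom S c = ffact_monom S (c(i := Suc (c i)))" ..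
  qed simp
  finally have eq: "((\<Sum>i\<in>S. Var i) - of_nat n) * ffact_monom S c = (\<Sum>i\<in>S. ffact_monom S (c(i := Suc (c i))))" .
  show ?case unfolding eq
  proof (rule ffact_span_sum)
    fix i assume i: "i \<in> S"
    have "sum (c(i := Suc (c i))) S = Suc (sum c S)"
      using gen i by (simp add: sum.remove[of S i])
    then show "ffact_span S (Suc n) (ffact_monom S (c(i := Suc (c i))))"
      using gen i by (intro ffact_span.gen) (auto simp: comps_def)
  qed (use gen in simp)
qed (auto simp: distrib_left mult.left_commute intro: ffact_span.intros)

lemma ffact_of_nat_less: "x < n \<Longrightarrow> ffact (of_nat x :: 'a :: idom) n = 0"
  by (auto simp: ffact_def)

lemma ffact_of_nat_self: "ffact (of_nat n :: 'a :: {idom, semiring_char_0}) n = fact n"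
proof -
  have "(\<Prod>i<n. of_nat n - of_nat i :: 'a) = (\<Prod>i<n. of_nat (Suc i))"
    by (rule prod.reindex_bij_witness[where i = "\<lambda>i. n - Suc i" and j = "\<lambda>i. n - Suc i"])
       (auto simp: of_nat_diff)
  then show ?thesis by (simp add: ffact_def fact_prod_Suc atLeast0LessThan)
qed

text \<open>
  Both sides are $x^{\underline{n+1}}$.
\<close>

lemma ffact_shift:
  "of_nat x * ffact (of_nat (x - 1)) n = (of_nat x - of_nat n) * ffact (of_nat x :: 'a :: idom) n"
proof (cases x)
  case 0
  then show ?thesis using ffact_of_nat_less[of 0 n, where 'a = 'a] by (cases n) auto
next
  case (Suc y)
  have "of_nat x * ffact (of_nat (x - 1)) n = ffact (of_nat x :: 'a) (Suc n)"
    by (simp add: ffact_def prod.lessThan_Suc_shift Suc del: prod.lessThan_Suc)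
  then show ?thesis by (simp add: ffact_Suc mult.commute)
qed

abbreviation (input) nat_eval :: "(nat \<Rightarrow> nat) \<Rightarrow> mpoly \<Rightarrow> real" where
  "nat_eval d \<equiv> poly_eval (\<lambda>i. of_nat (d i))"

lemma nat_eval_ffact_monom: "nat_eval d (ffact_monom S c) = (\<Prod>i\<in>S. ffact (of_nat (d i)) (c i))"
  by (simp add: ffact_monom_def poly_eval_simps)

lemma sum_less_ex: "finite S \<Longrightarrow> sum d S < sum c S \<Longrightarrow> \<exists>i\<in>S. d i < (c i :: nat)"
  by (meson not_le sum_mono)

text \<open>
  If the coordinates sum to less than \<open>n\<close>, in each product some coordinate is smaller than its exponent.
\<close>

lemma ffact_span_eval_vanish:
  "ffact_span S n p \<Longrightarrow> sum d S < n \<Longrightarrow> nat_eval d p = 0"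
proof (induction rule: ffact_span.induct)
  case (gen S c n)
  then obtain i where "i \<in> S" "d i < c i" using sum_less_ex[of S d c] by (auto simp: comps_def)
  then show ?case unfolding nat_eval_ffact_monom using gen.hyps(1) ffact_of_nat_less
    by (intro prod_zero) auto
qed (auto simp: poly_eval_simps)

lemma ffact_span_eval_Rats: "ffact_span S n p \<Longrightarrow> nat_eval d p \<in> \<rat>"
proof (induction rule: ffact_span.induct)
  case (gen S c n)
  show ?case unfolding nat_eval_ffact_monom ffact_def by (intro Rats_prod Rats_diff) auto
qed (auto simp: poly_eval_simps)

lemma ffact_span_eval_recursion:
  "ffact_span S n p \<Longrightarrow>
    (\<Sum>i\<in>S. of_nat (d i) * nat_eval (d(i := d i - 1)) p) = (of_nat (sum d S) - of_nat n) * nat_eval d p"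
proof (induction rule: ffact_span.induct)
  case (gen S c n)
  let ?P = "\<lambda>d. \<Prod>i\<in>S. ffact (real (d i)) (c i)"
  have "(\<Sum>i\<in>S. real (d i) * ?P (d(i := d i - 1))) = (\<Sum>i\<in>S. (real (d i) - real (c i)) * ?P d)"
  proof (rule sum.cong)
    fix i assume i: "i \<in> S"
    have "?P (d(i := d i - 1)) = ffact (real (d i - 1)) (c i) * (\<Prod>j\<in>S - {i}. ffact (real (d j)) (c j))"
      using gen i by (subst prod.remove[of S i]) auto
    moreover have "?P d = ffact (real (d i)) (c i) * (\<Prod>j\<in>S - {i}. ffact (real (d j)) (c j))"
      using gen i by (subst prod.remove[of S i]) auto
    ultimately show "real (d i) * ?P (d(i := d i - 1)) = (real (d i) - real (c i)) * ?P d"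
      using ffact_shift[of "d i" "c i", where 'a = real] by (simp flip: mult.assoc)
  qed simp
  also have "\<dots> = (of_nat (sum d S) - of_nat n) * ?P d"
    using gen by (simp add: comps_def sum_distrib_right[symmetric] sum_subtractf flip: of_nat_sum)
  finally show ?case by (simp only: nat_eval_ffact_monom)
next
  case (add S n p q)
  then show ?case by (simp add: poly_eval_simps distrib_left sum.distrib)
next
  case (scale S n p r)
  have "(\<Sum>i\<in>S. of_nat (d i) * nat_eval (d(i := d i - 1)) (Const r * p))
      = of_rat r * (\<Sum>i\<in>S. of_nat (d i) * nat_eval (d(i := d i - 1)) p)"
    by (simp add: poly_eval_simps sum_distrib_left mult.left_commute)
  then show ?case using scale.IH by (simp add: poly_eval_simps)
qed simp

lemma finite_comps: "finite S \<Longrightarrow> finite (comps S n)"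
proof -
  assume S: "finite S"
  have "comps S n \<subseteq> {c. \<forall>i. (i \<in> S \<longrightarrow> c i \<in> {..n}) \<and> (i \<notin> S \<longrightarrow> c i = 0)}"
    using S by (auto simp: comps_def intro: member_le_sum)
  then show ?thesis
    by (rule finite_subset) (rule finite_set_of_finite_funs; simp add: S)
qed

lemma ffact_span_normal_form:
  assumes "ffact_span S n p"
  obtains a where "p = (\<Sum>c\<in>comps S n. Const (a c) * ffact_monom S c)"
proof -
  have "\<exists>a. p = (\<Sum>c\<in>comps S n. Const (a c) * ffact_monom S c)"
    using assms
  proof (induction rule: ffact_span.induct)
    case (zero S n)
    show ?case by (rule exI[of _ "\<lambda>_. 0"]) simp
  next
    case (gen S c n)
    have "(\<Sum>d\<in>comps S n. Const (if d = c then 1 else 0) * ffact_monom S d)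
        = (\<Sum>d\<in>comps S n. if d = c then ffact_monom S d else 0)"
      by (rule sum.cong) auto
    also have "\<dots> = ffact_monom S c" using gen finite_comps by simp
    finally show ?case by (intro exI[of _ "\<lambda>d. if d = c then 1 else 0"]) simp
  next
    case (add S n p q)
    then obtain a b where "p = (\<Sum>c\<in>comps S n. Const (a c) * ffact_monom S c)"
      "q = (\<Sum>c\<in>comps S n. Const (b c) * ffact_monom S c)" by blast
    then show ?case
      by (intro exI[of _ "\<lambda>c. a c + b c"]) (simp add: Const_add distrib_right sum.distrib)
  next
    case (scale S n p r)
    then obtain a where "p = (\<Sum>c\<in>comps S n. Const (a c) * ffact_monom S c)" by blast
    then show ?case
      by (intro exI[of _ "\<lambda>c. r * a c"]) (simp add: Const_mult sum_distrib_left mult.assoc)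
  qed
  then show thesis using that by blast
qed

lemma nat_eval_ffact_monom_comps:
  assumes "finite S" "c \<in> comps S n" "d \<in> comps S n"
  shows "nat_eval d (ffact_monom S c) = (if c = d then \<Prod>i\<in>S. fact (c i) else 0)"
proof (cases "c = d")
  case False
  have "\<exists>i\<in>S. d i < c i"
  proof (rule ccontr)
    assume "\<not> ?thesis"
    then have le: "\<And>i. i \<in> S \<Longrightarrow> c i \<le> d i" by (auto simp: not_less)
    have "c i = d i" for i
    proof (cases "i \<in> S")
      case True
      show ?thesis
      proof (rule ccontr)
        assume "c i \<noteq> d i"
        then have "sum c S < sum d S"
          using le True assms(1) by (intro sum_strict_mono_ex1) (auto intro!: bexI[of _ i] simp: order.strict_iff_order)
        then show False using assms by (simp add: comps_def)
      qed
    qed (use assms in \<open>auto simp: comps_def\<close>)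
    then show False using False by auto
  qed
  then have "nat_eval d (ffact_monom S c) = 0" unfolding nat_eval_ffact_monom using assms(1) ffact_of_nat_less
    by (intro prod_zero) auto
  then show ?thesis using False by simp
qed (simp add: nat_eval_ffact_monom ffact_of_nat_self)

lemma of_rat_fact: "of_rat (fact n) = fact n"
  by (metis of_nat_fact of_rat_of_nat_eq)

text \<open>
  At a composition \<open>d\<close> of \<open>n\<close> all products but the one with exponent \<open>d\<close> vanish, so the coefficients are read
  off from the values at the compositions of \<open>n\<close>.
\<close>

lemma ffact_span_coefficients:
  assumes "ffact_span S n p" "\<And>c. c \<in> comps S n \<Longrightarrow> nat_eval c p = of_rat (v c)"
  shows "p = (\<Sum>c\<in>comps S n. Const (v c / (\<Prod>i\<in>S. fact (c i))) * ffact_monom S c)"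
proof -
  have fin: "finite S" using assms(1) by (rule ffact_span_finite)
  obtain a where a: "p = (\<Sum>c\<in>comps S n. Const (a c) * ffact_monom S c)"
    using assms(1) by (rule ffact_span_normal_form)
  have "a d = v d / (\<Prod>i\<in>S. fact (d i))" if d: "d \<in> comps S n" for d
  proof -
    have "nat_eval d p = (\<Sum>c\<in>comps S n. of_rat (a c) * (if c = d then \<Prod>i\<in>S. fact (c i) else 0))"
      unfolding a using nat_eval_ffact_monom_comps[OF fin _ d] by (simp add: poly_eval_simps)
    also have "\<dots> = (\<Sum>c\<in>comps S n. if c = d then of_rat (a d) * (\<Prod>i\<in>S. fact (d i)) else 0)"
      by (rule sum.cong) auto
    also have "\<dots> = of_rat (a d) * (\<Prod>i\<in>S. fact (d i))"
      using d finite_comps[OF fin] by simp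
    also have "\<dots> = of_rat (a d * (\<Prod>i\<in>S. fact (d i)))"      by (simp add: of_rat_mult of_rat_prod of_rat_fact)
    finally have "v d = a d * (\<Prod>i\<in>S. fact (d i))" using assms(2)[OF d] by simp
    then show ?thesis by (simp add: fin)
  qed
  then show ?thesis unfolding a by simp
qed

section \<open>The span of falling factorials and pair quotients\<close>

text \<open>
  A product is built by adjoining disjoint blocks of variables: a product of falling factorials, or a
  single quotient $(x_a-x_b)/(x_a+x_b)$. The index \<open>n\<close> counts the falling factorial steps, to which
  quotients do not contribute.
\<close>

inductive pfaffian_span :: "nat set \<Rightarrow> nat \<Rightarrow> ratfun \<Rightarrow> bool" where
  one: "pfaffian_span {} 0 1"
| ffact: "pfaffian_span S n f \<Longrightarrow> ffact_span R r q \<Longrightarrow> R \<inter> S = {} \<Longrightarrow> pfaffian_span (R \<union> S) (r + n) (rf q * f)"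
| pair: "pfaffian_span S n f \<Longrightarrow> a < b \<Longrightarrow> a \<notin> S \<Longrightarrow> b \<notin> S \<Longrightarrow> pfaffian_span (insert a (insert b S)) n (pair_quot a b * f)"
| add: "pfaffian_span S n f \<Longrightarrow> pfaffian_span S n g \<Longrightarrow> pfaffian_span S n (f + g)"
| scale: "pfaffian_span S n f \<Longrightarrow> pfaffian_span S n (rf (Const r) * f)"

lemma pfaffian_span_finite: "pfaffian_span S n f \<Longrightarrow> finite S"
  by (induction rule: pfaffian_span.induct) (auto dest: ffact_span_finite)

lemma pfaffian_span_ffact_span: "ffact_span R r q \<Longrightarrow> pfaffian_span R r (rf q)"
  using pfaffian_span.ffact[OF pfaffian_span.one, of R r q] by simp

lemma pfaffian_span_uminus: "pfaffian_span S n f \<Longrightarrow> pfaffian_span S n (- f)"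
  using pfaffian_span.scale[of S n f "-1"] by (simp add: Const_minus rf_minus)

lemma pfaffian_span_sum:
  assumes "A \<noteq> {}" "finite A" "\<And>x. x \<in> A \<Longrightarrow> pfaffian_span S n (f x)"
  shows "pfaffian_span S n (sum f A)"
  using assms(2,1,3)
  by (induction A rule: finite_ne_induct) (auto intro: pfaffian_span.add)

lemma Var_diff_ffact_span: "a \<noteq> b \<Longrightarrow> ffact_span {a, b} 1 (Var a - Var b)"
proof -
  assume ab: "a \<noteq> b"
  have "ffact_span {a, b} 1 (ffact_monom {a, b} (\<lambda>i. if i = a then 1 else 0) +
      Const (-1) * ffact_monom {a, b} (\<lambda>i. if i = b then 1 else 0))"
    using ab by (intro ffact_span.add ffact_span.scale ffact_span.gen) (auto simp: comps_def)
  then show ?thesis using ab by (simp add: ffact_monom_def ffact_def Const_minus)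
qed

text \<open>
  The factor splits over the blocks of a product. A quotient multiplied by $x_a+x_b$ becomes $x_a-x_b$,
  which has index 1.
\<close>

lemma pfaffian_span_step:
  assumes "pfaffian_span S n f"
  shows "pfaffian_span S (Suc n) (((\<Sum>i\<in>S. X i) - of_nat n) * f)"
  using assms
proof (induction rule: pfaffian_span.induct)
  case one
  show ?case using pfaffian_span_ffact_span[OF ffact_span.zero[of "{}" 1]] by simp
next
  case (ffact S n f R r q)
  have fin: "finite S" "finite R" using ffact pfaffian_span_finite ffact_span_finite by auto
  have "pfaffian_span (R \<union> S) (Suc r + n) (rf (((\<Sum>i\<in>R. Var i) - of_nat r) * q) * f)"
    using ffact by (intro pfaffian_span.ffact ffact_span_step)
  moreover have "pfaffian_span (R \<union> S) (r + Suc n) (rf q * (((\<Sum>i\<in>S. X i) - of_nat n) * f))"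
    using ffact by (intro pfaffian_span.ffact)
  ultimately have "pfaffian_span (R \<union> S) (Suc (r + n)) (rf (((\<Sum>i\<in>R. Var i) - of_nat r) * q) * f +
      rf q * (((\<Sum>i\<in>S. X i) - of_nat n) * f))"
    by (intro pfaffian_span.add) auto
  also have "rf (((\<Sum>i\<in>R. Var i) - of_nat r) * q) * f + rf q * (((\<Sum>i\<in>S. X i) - of_nat n) * f)
      = ((\<Sum>i\<in>R \<union> S. X i) - of_nat (r + n)) * (rf q * f)"
    using fin ffact by (simp add: sum.union_disjoint rf_simps algebra_simps)
  finally show ?case .
next
  case (pair S n f a b)
  have fin: "finite S" using pair pfaffian_span_finite by auto
  have "pfaffian_span ({a, b} \<union> S) (1 + n) (rf (Var a - Var b) * f)"
    using pair by (intro pfaffian_span.ffact Var_diff_ffact_span) auto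
  moreover have "pfaffian_span (insert a (insert b S)) (Suc n) (pair_quot a b * (((\<Sum>i\<in>S. X i) - of_nat n) * f))"
    using pair by (intro pfaffian_span.pair)
  ultimately have "pfaffian_span (insert a (insert b S)) (Suc n)
      (rf (Var a - Var b) * f + pair_quot a b * (((\<Sum>i\<in>S. X i) - of_nat n) * f))"
    by (intro pfaffian_span.add) auto
  also have "rf (Var a - Var b) * f = pair_quot a b * (X a + X b) * f"
    using X_add_nonzero[of a b] by (simp add: pair_quot_def rf_diff)
  also have "pair_quot a b * (X a + X b) * f + pair_quot a b * (((\<Sum>i\<in>S. X i) - of_nat n) * f)
     = ((\<Sum>i\<in>insert a (insert b S). X i) - of_nat n) * (pair_quot a b * f)"
    using pair fin by (simp add: algebra_simps)
  finally show ?case .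
next
  case (add S n f g)
  then show ?case by (simp add: distrib_left pfaffian_span.add)
next
  case (scale S n f r)
  then show ?case by (simp add: mult.left_commute pfaffian_span.scale)
qed

lemma pfaffian_span_ffact:
  assumes "pfaffian_span S m f"
  shows "pfaffian_span S (m + N) (f * ffact ((\<Sum>i\<in>S. X i) - of_nat m) N)"
proof (induction N)
  case 0
  then show ?case using assms by (simp add: ffact_def)
next
  case (Suc N)
  have eq: "(\<Sum>i\<in>S. X i) - of_nat m - of_nat N = (\<Sum>i\<in>S. X i) - of_nat (m + N)" by simp
  show ?case using pfaffian_span_step[OF Suc] unfolding ffact_Suc eq by (simp only: ac_simps add_Suc_right)
qed

definition pairs_on :: "nat \<Rightarrow> nat set \<Rightarrow> (nat \<times> nat) set" where
  "pairs_on k S = pairs k \<inter> S \<times> S"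

text \<open>
  Numerator and denominator in the variables of \<open>S\<close> only; this makes it possible to adjoin a new pair of
  variables and to see which exponents occur in the expansion.
\<close>

definition frac_on :: "nat \<Rightarrow> nat set \<Rightarrow> ratfun \<Rightarrow> bool" where
  "frac_on k S f \<longleftrightarrow> (\<exists>p\<in>poly_vars S. f = rf p / rf (den_on (pairs_on k S)))"

lemma frac_onI:
  assumes "p \<in> poly_vars S" "M \<subseteq> pairs_on k S"
  shows "frac_on k S (rf p / rf (den_on M))"
proof -
  have "rf p / rf (den_on M) = rf (p * den_on (pairs_on k S - M)) / rf (den_on (M \<union> (pairs_on k S - M)))"
    using assms(2) by (intro fraction_extend[of _ _ k]) (auto simp: pairs_on_def)
  also have "M \<union> (pairs_on k S - M) = pairs_on k S" using assms(2) by auto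
  finally show ?thesis unfolding frac_on_def
    using assms(1) by (intro bexI[of _ "p * den_on (pairs_on k S - M)"] poly_vars_mult poly_vars_den_on)
      (auto simp: pairs_on_def)
qed

lemma den_on_insert: "(a, b) \<notin> M \<Longrightarrow> finite M \<Longrightarrow> den_on (insert (a, b) M) = (Var a + Var b) * den_on M"
  by (simp add: den_on_def)

lemma pfaffian_span_frac_on:
  "pfaffian_span S n f \<Longrightarrow> S \<subseteq> {1..k} \<Longrightarrow> frac_on k S f"
proof (induction rule: pfaffian_span.induct)
  case one
  show ?case using frac_onI[of 1 "{}" "{}" k] by (simp add: poly_vars_1 den_on_def)
next
  case (ffact S n f R r q)
  then obtain p where p: "p \<in> poly_vars S" "f = rf p / rf (den_on (pairs_on k S))"
    by (auto simp: frac_on_def)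
  have "frac_on k (R \<union> S) (rf (q * p) / rf (den_on (pairs_on k S)))"
    using p(1) ffact_span_vars[OF ffact(2)]
    by (intro frac_onI poly_vars_mult) (auto intro: poly_vars_mono simp: pairs_on_def)
  then show ?case by (simp add: p rf_mult)
next
  case (pair S n f a b)
  then obtain p where p: "p \<in> poly_vars S" "f = rf p / rf (den_on (pairs_on k S))"
    by (auto simp: frac_on_def)
  let ?T = "insert a (insert b S)"
  have "frac_on k ?T (rf ((Var a - Var b) * p) / rf (den_on (insert (a, b) (pairs_on k S))))"
    using p(1) pair
    by (intro frac_onI poly_vars_mult poly_vars_diff poly_vars_Var)
       (auto intro: poly_vars_mono simp: pairs_on_def pairs_def)
  also have "rf ((Var a - Var b) * p) / rf (den_on (insert (a, b) (pairs_on k S))) = pair_quot a b * f"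
    using pair(3) by (subst den_on_insert) (auto simp: pairs_on_def p pair_quot_def rf_simps)
  finally show ?case .
next
  case (add S n f g)
  then show ?case by (auto simp: frac_on_def)
    (metis add_divide_distrib poly_vars_add rf_add)
next
  case (scale S n f r)
  then show ?case by (auto simp: frac_on_def)
    (metis poly_vars_Const poly_vars_mult rf_mult times_divide_eq_right)
qed

lemma frac_on_Mclass: "frac_on k S f \<Longrightarrow> S \<subseteq> {1..k} \<Longrightarrow> f \<in> Mclass k"
  unfolding frac_on_def polys_eq_poly_vars[symmetric]
  by (auto simp: pairs_on_def polys_eq_poly_vars intro!: laurent_fraction(1) intro: poly_vars_mono)

section \<open>Values on the span\<close>

text \<open>
  With $x=c_a$, $y=c_b$ this is $x\frac{x-1-y}{x+y-1}+y\frac{x-y+1}{x+y-1}=x-y$. The hypothesis excludes the point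
  $(0,1)$, where it fails: stepping back from there reaches $(0,0)$, whose value is 1.
\<close>

lemma pair_quot_val_recursion:
  assumes "a < b" "c a = 0 \<longrightarrow> c b = 0"
  shows "of_nat (c a) * pair_quot_val (c(a := c a - 1)) a b + of_nat (c b) * pair_quot_val (c(b := c b - 1)) a b
    = (of_nat (c a) + of_nat (c b)) * pair_quot_val c a b"
proof (cases "c a = 0")
  case False
  then obtain x where x: "c a = Suc x" by (cases "c a") auto
  show ?thesis
  proof (cases "c b")
    case 0
    then show ?thesis using x assms(1) by (simp add: pair_quot_val_def)
  next
    case (Suc y)
    have "real x + real y + 1 \<noteq> 0" "real x + real y + 2 \<noteq> 0" by linarith+
    then show ?thesis using x Suc assms(1) by (simp add: pair_quot_val_def divide_simps) (simp add: algebra_simps)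
  qed
qed (use assms in simp)

text \<open>
  The properties of the value function of an element of index \<open>n\<close> that are multiplicative over disjoint
  sets of variables. In the recursion the subtraction \<open>c i - 1\<close> truncates only where the factor \<open>c i\<close>
  vanishes, and the condition on \<open>c\<close> says that the vanishing coordinates come last.
\<close>

definition has_value_fun :: "nat set \<Rightarrow> nat \<Rightarrow> ratfun \<Rightarrow> ((nat \<Rightarrow> nat) \<Rightarrow> real) \<Rightarrow> bool" where
  "has_value_fun S n f h \<longleftrightarrow>
    (\<forall>c. lim_at f c (h c) \<and> h c \<in> \<rat> \<and> (sum c S < n \<longrightarrow> h c = 0)) \<and>
    (\<forall>c c'. (\<forall>i\<in>S. c i = c' i) \<longrightarrow> h c = h c') \<and>
    (\<forall>c. (\<forall>a\<in>S. \<forall>b\<in>S. a < b \<and> c a = 0 \<longrightarrow> c b = 0) \<longrightarrow>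
      (\<Sum>i\<in>S. of_nat (c i) * h (c(i := c i - 1))) = (of_nat (sum c S) - of_nat n) * h c)"

lemma has_value_funD:
  assumes "has_value_fun S n f h"
  shows "lim_at f c (h c)" "h c \<in> \<rat>" "sum c S < n \<Longrightarrow> h c = 0"
    "(\<And>i. i \<in> S \<Longrightarrow> c i = c' i) \<Longrightarrow> h c = h c'"
    "(\<And>a b. a \<in> S \<Longrightarrow> b \<in> S \<Longrightarrow> a < b \<Longrightarrow> c a = 0 \<Longrightarrow> c b = 0) \<Longrightarrow>
      (\<Sum>i\<in>S. of_nat (c i) * h (c(i := c i - 1))) = (of_nat (sum c S) - of_nat n) * h c"
  using assms unfolding has_value_fun_def by blast+

text \<open>
  A step back in one set of variables leaves the other factor unchanged, so the recursion follows the
  product rule.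
\<close>

lemma has_value_fun_mult:
  assumes "has_value_fun R r f h" "has_value_fun S n g h'" "R \<inter> S = {}" "finite R" "finite S"
  shows "has_value_fun (R \<union> S) (r + n) (f * g) (\<lambda>c. h c * h' c)"
  unfolding has_value_fun_def
proof (intro conjI allI impI)
  fix c
  note F = has_value_funD[OF assms(1)] and G = has_value_funD[OF assms(2)]
  show "lim_at (f * g) c (h c * h' c)" by (intro lim_at_mult F G)
  show "h c * h' c \<in> \<rat>" by (intro Rats_mult F G)
  have sum: "sum c (R \<union> S) = sum c R + sum c S" by (rule sum.union_disjoint) (use assms in auto)
  show "h c * h' c = 0" if "sum c (R \<union> S) < r + n"
  proof -
    have "sum c R < r \<or> sum c S < n" using that sum by linarith
    then show ?thesis using F(3) G(3) by auto
  qed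
  show "h c * h' c = h c' * h' c'" if "\<forall>i\<in>R \<union> S. c i = c' i" for c'
    using F(4)[of c c'] G(4)[of c c'] that by auto
  show "(\<Sum>i\<in>R \<union> S. of_nat (c i) * (h (c(i := c i - 1)) * h' (c(i := c i - 1))))
      = (of_nat (sum c (R \<union> S)) - of_nat (r + n)) * (h c * h' c)"
    if z: "\<forall>a\<in>R \<union> S. \<forall>b\<in>R \<union> S. a < b \<and> c a = 0 \<longrightarrow> c b = 0"
  proof -
    have 1: "h' (c(i := c i - 1)) = h' c" if "i \<in> R" for i
      using that assms(3) by (intro G(4)) auto
    have 2: "h (c(i := c i - 1)) = h c" if "i \<in> S" for i
      using that assms(3) by (intro F(4)) auto
    have "(\<Sum>i\<in>R \<union> S. of_nat (c i) * (h (c(i := c i - 1)) * h' (c(i := c i - 1))))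
      = (\<Sum>i\<in>R. of_nat (c i) * (h (c(i := c i - 1)) * h' (c(i := c i - 1))))
      + (\<Sum>i\<in>S. of_nat (c i) * (h (c(i := c i - 1)) * h' (c(i := c i - 1))))"
      by (rule sum.union_disjoint) (use assms in auto)
    also have "(\<Sum>i\<in>R. of_nat (c i) * (h (c(i := c i - 1)) * h' (c(i := c i - 1))))
      = (\<Sum>i\<in>R. of_nat (c i) * h (c(i := c i - 1))) * h' c"
      by (simp add: sum_distrib_right 1 mult.assoc del: One_nat_def)
    also have "(\<Sum>i\<in>S. of_nat (c i) * (h (c(i := c i - 1)) * h' (c(i := c i - 1))))
      = h c * (\<Sum>i\<in>S. of_nat (c i) * h' (c(i := c i - 1)))"
      by (simp add: sum_distrib_left 2 mult.left_commute del: One_nat_def)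
    also have "(\<Sum>i\<in>R. of_nat (c i) * h (c(i := c i - 1))) = (of_nat (sum c R) - of_nat r) * h c"
      by (rule F(5)) (use z in blast)
    also have "(\<Sum>i\<in>S. of_nat (c i) * h' (c(i := c i - 1))) = (of_nat (sum c S) - of_nat n) * h' c"
      by (rule G(5)) (use z in blast)
    also have "(of_nat (sum c R) - of_nat r) * h c * h' c + h c * ((of_nat (sum c S) - of_nat n) * h' c)
      = (of_nat (sum c (R \<union> S)) - of_nat (r + n)) * (h c * h' c)"
      by (simp add: sum algebra_simps)
    finally show ?thesis .
  qed
qed

lemma has_value_fun_pair:
  assumes "a < b" "1 \<le> a"
  shows "has_value_fun {a, b} 0 (pair_quot a b) (\<lambda>c. pair_quot_val c a b)"
  unfolding has_value_fun_def
proof (intro conjI allI impI)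
  fix c
  show "lim_at (pair_quot a b) c (pair_quot_val c a b)" using assms by (rule lim_at_pair_quot_less)
  show "pair_quot_val c a b \<in> \<rat>" by (rule pair_quot_val_Rats)
  show "pair_quot_val c a b = pair_quot_val c' a b" if "\<forall>i\<in>{a, b}. c i = c' i" for c'
    using that by (simp add: pair_quot_val_def)
  show "(\<Sum>i\<in>{a, b}. of_nat (c i) * pair_quot_val (c(i := c i - 1)) a b)
      = (of_nat (sum c {a, b}) - of_nat 0) * pair_quot_val c a b"
    if "\<forall>x\<in>{a, b}. \<forall>y\<in>{a, b}. x < y \<and> c x = 0 \<longrightarrow> c y = 0"
    using pair_quot_val_recursion[OF assms(1), of c] that assms(1) by simp
qed simp

lemma pfaffian_span_has_value_fun:
  "pfaffian_span S n f \<Longrightarrow> 0 \<notin> S \<Longrightarrow> \<exists>h. has_value_fun S n f h"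
proof (induction rule: pfaffian_span.induct)
  case one
  have "has_value_fun {} 0 1 (\<lambda>_. 1)" by (simp add: has_value_fun_def lim_at_1)
  then show ?case by blast
next
  case (ffact S n f R r q)
  then obtain h where h: "has_value_fun S n f h" by blast
  have "has_value_fun R r (rf q) (\<lambda>c. nat_eval c q)"
    unfolding has_value_fun_def
  proof (intro conjI allI impI)
    fix c
    note q = ffact_span_vars[OF ffact(2)]
    show "lim_at (rf q) c (nat_eval c q)" using ffact by (intro lim_at_poly[OF q]) auto
    show "nat_eval c q \<in> \<rat>" using ffact by (intro ffact_span_eval_Rats)
    show "nat_eval c q = 0" if "sum c R < r" using ffact(2) that by (rule ffact_span_eval_vanish)
    show "nat_eval c q = nat_eval c' q" if "\<forall>i\<in>R. c i = c' i" for c'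
      using that by (intro poly_eval_cong[OF q]) auto
    show "(\<Sum>i\<in>R. of_nat (c i) * nat_eval (c(i := c i - 1)) q)
        = (of_nat (sum c R) - of_nat r) * nat_eval c q"
      using ffact(2) by (rule ffact_span_eval_recursion)
  qed
  then have "has_value_fun (R \<union> S) (r + n) (rf q * f) (\<lambda>c. nat_eval c q * h c)"
    using h ffact pfaffian_span_finite ffact_span_finite by (intro has_value_fun_mult) auto
  then show ?case by blast
next
  case (pair S n f a b)
  then obtain h where h: "has_value_fun S n f h" by blast
  have a: "1 \<le> a" using pair by (cases a) auto
  have "has_value_fun ({a, b} \<union> S) (0 + n) (pair_quot a b * f) (\<lambda>c. pair_quot_val c a b * h c)"
    using h pair pfaffian_span_finite a by (intro has_value_fun_mult has_value_fun_pair) auto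
  then show ?case by auto
next
  case (add S n f g)
  then obtain h h' where h: "has_value_fun S n f h" "has_value_fun S n g h'" by blast
  have "has_value_fun S n (f + g) (\<lambda>c. h c + h' c)"
    unfolding has_value_fun_def
  proof (intro conjI allI impI)
    fix c
    note F = has_value_funD[OF h(1)] and G = has_value_funD[OF h(2)]
    show "lim_at (f + g) c (h c + h' c)" by (intro lim_at_add F G)
    show "h c + h' c \<in> \<rat>" by (intro Rats_add F G)
    show "h c + h' c = 0" if "sum c S < n" using F(3) G(3) that by simp
    show "h c + h' c = h c' + h' c'" if "\<forall>i\<in>S. c i = c' i" for c'
      using F(4)[of c c'] G(4)[of c c'] that by auto
    show "(\<Sum>i\<in>S. of_nat (c i) * (h (c(i := c i - 1)) + h' (c(i := c i - 1))))
        = (of_nat (sum c S) - of_nat n) * (h c + h' c)"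
      if z: "\<forall>a\<in>S. \<forall>b\<in>S. a < b \<and> c a = 0 \<longrightarrow> c b = 0"
    proof -
      have "(\<Sum>i\<in>S. of_nat (c i) * h (c(i := c i - 1))) = (of_nat (sum c S) - of_nat n) * h c"
        by (rule F(5)) (use z in blast)
      moreover have "(\<Sum>i\<in>S. of_nat (c i) * h' (c(i := c i - 1))) = (of_nat (sum c S) - of_nat n) * h' c"
        by (rule G(5)) (use z in blast)
      ultimately show ?thesis unfolding distrib_left sum.distrib by (simp only:)
    qed
  qed
  then show ?case by blast
next
  case (scale S n f r)
  then obtain h where h: "has_value_fun S n f h" by blast
  have "has_value_fun {} 0 (rf (Const r)) (\<lambda>_. of_rat r)"
    by (simp add: has_value_fun_def lim_at_Const)
  then have "has_value_fun ({} \<union> S) (0 + n) (rf (Const r) * f) (\<lambda>c. of_rat r * h c)"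
    using h scale pfaffian_span_finite by (intro has_value_fun_mult) auto
  then show ?case by auto
qed

section \<open>Polynomial components on the span\<close>

text \<open>
  What is carried through the induction on the span. The condition on the coefficients only looks at the
  exponents on \<open>S\<close>, so it can be extended when further variables are adjoined.
\<close>

definition is_poly_component :: "nat \<Rightarrow> nat set \<Rightarrow> nat \<Rightarrow> ratfun \<Rightarrow> mpoly \<Rightarrow> bool" where
  "is_poly_component k S n f P \<longleftrightarrow> ffact_span S n P \<and>
     (\<forall>e. (\<forall>i\<in>S. 0 \<le> e i) \<longrightarrow> laurent_coeff k f e = conv P (inv_coeff {}) e) \<and>
     (\<forall>c y. lim_at f c y \<longrightarrow> sum c S \<le> n \<longrightarrow> y = nat_eval c P)"

lemma pfaffian_span_Mclass: "pfaffian_span S n f \<Longrightarrow> S \<subseteq> {1..k} \<Longrightarrow> f \<in> Mclass k"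
  by (blast intro: frac_on_Mclass pfaffian_span_frac_on)

text \<open>
  Multiplication by a polynomial in new variables does not change the exponents on \<open>S\<close>, so it commutes
  with taking the polynomial component. Adjoining a quotient of new variables leaves the polynomial component
  unchanged. The equality of values survives because points where it could fail have a coordinate sum
  on \<open>S\<close> that is too small for a nonzero value.
\<close>

lemma pfaffian_span_poly_component:
  "pfaffian_span S n f \<Longrightarrow> S \<subseteq> {1..k} \<Longrightarrow> \<exists>P. is_poly_component k S n f P"
proof (induction rule: pfaffian_span.induct)
  case one
  have "laurent_coeff k 1 e = conv 1 (inv_coeff {}) e" for e
    using laurent_fraction(2)[of 1 k "{}" e] by (simp add: polys_eq_poly_vars poly_vars_1 den_on_def)
  moreover have "y = 1" if "lim_at 1 c y" for c y
    using lim_at_unique[OF that lim_at_1] .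
  ultimately have "is_poly_component k {} 0 1 1"
    by (simp add: is_poly_component_def ffact_span_one)
  then show ?case by blast
next
  case (ffact S n f R r q)
  then obtain P where P: "ffact_span S n P"
      "\<And>e. (\<forall>i\<in>S. 0 \<le> e i) \<Longrightarrow> laurent_coeff k f e = conv P (inv_coeff {}) e"
      "\<And>c y. lim_at f c y \<Longrightarrow> sum c S \<le> n \<Longrightarrow> y = nat_eval c P"
    by (auto simp: is_poly_component_def)
  have fin: "finite S" "finite R" using ffact pfaffian_span_finite ffact_span_finite by auto
  have fM: "f \<in> Mclass k" using ffact by (intro pfaffian_span_Mclass) auto
  have q: "q \<in> poly_vars R" using ffact(2) by (rule ffact_span_vars)
  have "q \<in> polys k" unfolding polys_eq_poly_vars using q by (rule poly_vars_mono) (use ffact in auto)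
  then have L: "laurent_coeff k (rf q * f) e = conv q (laurent_coeff k f) e" for e
    using fM by (intro laurent_poly_mult)
  have "laurent_coeff k (rf q * f) e = conv (q * P) (inv_coeff {}) e" if e: "\<forall>i\<in>R \<union> S. 0 \<le> e i" for e
    unfolding L conv_mult unfolding conv_def[of q]
  proof (rule sum.cong)
    fix b assume b: "b \<in> Poly_Mapping.keys q"
    have "0 \<le> e i - int (Poly_Mapping.lookup b i)" if "i \<in> S" for i
    proof -
      have "i \<notin> Poly_Mapping.keys b" using b q that ffact(3) unfolding poly_vars_def by blast
      then show ?thesis using e that by (simp add: in_keys_iff)
    qed
    then show "Poly_Mapping.lookup q b * laurent_coeff k f (\<lambda>i. e i - int (Poly_Mapping.lookup b i))
        = Poly_Mapping.lookup q b * conv P (inv_coeff {}) (\<lambda>i. e i - int (Poly_Mapping.lookup b i))"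
      by (subst P(2)) auto
  qed simp
  moreover have "y = nat_eval c (q * P)" if y: "lim_at (rf q * f) c y" and c: "sum c (R \<union> S) \<le> r + n" for c y
  proof -
    have z: "0 \<notin> S" "0 \<notin> R" using ffact.prems by auto
    obtain h where h: "has_value_fun S n f h"
      using pfaffian_span_has_value_fun[OF ffact(1) z(1)] by blast
    have "lim_at (rf q * f) c (nat_eval c q * h c)"
      by (intro lim_at_mult lim_at_poly[OF q z(2)] has_value_funD(1)[OF h])
    with y have y: "y = nat_eval c q * h c" by (rule lim_at_unique)
    have s: "sum c (R \<union> S) = sum c R + sum c S" by (rule sum.union_disjoint) (use fin ffact in auto)
    show ?thesis
    proof (cases "sum c R < r")
      case True
      then show ?thesis using ffact_span_eval_vanish[OF ffact(2)] by (simp add: y poly_eval_mult)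
    next
      case False
      then have "sum c S \<le> n" using c s by linarith
      then have "h c = nat_eval c P" by (rule P(3)[OF has_value_funD(1)[OF h]])
      then show ?thesis by (simp add: y poly_eval_mult)
    qed
  qed
  moreover have "ffact_span (R \<union> S) (r + n) (q * P)" using ffact P by (intro ffact_span_mult)
  ultimately have "is_poly_component k (R \<union> S) (r + n) (rf q * f) (q * P)"
    by (simp add: is_poly_component_def)
  then show ?case by blast
next
  case (pair S n f a b)
  let ?T = "insert a (insert b S)"
  let ?M = "pairs_on k S"
  have T: "?T \<subseteq> {1..k}" using pair by blast
  have S: "S \<subseteq> {1..k}" using pair by auto
  obtain P where P: "ffact_span S n P"
      "\<And>e. (\<forall>i\<in>S. 0 \<le> e i) \<Longrightarrow> laurent_coeff k f e = conv P (inv_coeff {}) e"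
      "\<And>c y. lim_at f c y \<Longrightarrow> sum c S \<le> n \<Longrightarrow> y = nat_eval c P"
    using pair.IH[OF S] by (auto simp: is_poly_component_def)
  have fin: "finite S" using pair pfaffian_span_finite by auto
  have fM: "f \<in> Mclass k" using pair(1) S by (rule pfaffian_span_Mclass)
  obtain p where p: "p \<in> poly_vars S" "f = rf p / rf (den_on ?M)"
    using pfaffian_span_frac_on[OF pair(1) S] by (auto simp: frac_on_def)
  have M: "insert (a, b) ?M \<subseteq> pairs k" "finite ?M"
    using pair by (auto simp: pairs_on_def pairs_def intro: finite_subset[OF _ finite_pairs[of k]])
  \<comment> \<open>The decomposition $(x_a-x_b)/(x_a+x_b)=1-2x_b/(x_a+x_b)$, times \<open>f\<close>. Every term of the second
      part has a negative power of $x_a$.\<close>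
  define p' where "p' = Const (-2) * Var b * p"
  define g where "g = rf p' / rf (den_on (insert (a, b) ?M))"
  have p'v: "p' \<in> poly_vars (insert b S)" unfolding p'_def
    using p(1) by (intro poly_vars_mult poly_vars_Const poly_vars_Var) (auto intro: poly_vars_mono)
  have p'k: "p' \<in> polys k" unfolding polys_eq_poly_vars
    using p'v by (rule poly_vars_mono) (use T in auto)
  have gM: "g \<in> Mclass k" unfolding g_def using p'k M(1) by (rule laurent_fraction)
  have "rf (den_on (insert (a, b) ?M)) = (X a + X b) * rf (den_on ?M)"
    using M pair by (subst den_on_insert) (auto simp: pairs_on_def rf_simps)
  then have "g = - 2 * X b / (X a + X b) * f"
    by (simp add: g_def p'_def p rf_simps Const_minus Const_numeral)
  moreover have "pair_quot a b = 1 + - 2 * X b / (X a + X b)"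
  proof -
    have "pair_quot a b = ((X a + X b) + - 2 * X b) / (X a + X b)" by (simp add: pair_quot_def)
    also have "\<dots> = 1 + - 2 * X b / (X a + X b)"
      unfolding add_divide_distrib[of "X a + X b"] using X_add_nonzero[of a b] by simp
    finally show ?thesis .
  qed
  ultimately have split: "pair_quot a b * f = f + g" by (simp only: distrib_right mult_1)
  have "laurent_coeff k (pair_quot a b * f) e = conv P (inv_coeff {}) e" if e: "\<forall>i\<in>?T. 0 \<le> e i" for e
  proof -
    have "conv p' (inv_coeff (insert (a, b) ?M)) e = 0"
    proof (rule ccontr)
      assume "conv p' (inv_coeff (insert (a, b) ?M)) e \<noteq> 0"
      then obtain e' where e': "inv_coeff (insert (a, b) ?M) e' \<noteq> 0" "\<And>i. i \<notin> insert b S \<Longrightarrow> e' i = e i"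
        using p'v by (rule conv_vars_support) auto
      have "e' a < 0"
        by (rule inv_coeff_negative_exponent[OF e'(1)]) (use M(2) pair in \<open>auto simp: pairs_on_def\<close>)
      then show False using e'(2)[of a] e pair by auto
    qed
    then have "laurent_coeff k g e = 0"
      unfolding g_def by (subst laurent_fraction(2)[OF p'k M(1)])
    then show ?thesis unfolding split laurent_add[OF fM gM] using e by (simp add: P(2))
  qed
  moreover have "y = nat_eval c P" if y: "lim_at (pair_quot a b * f) c y" and c: "sum c ?T \<le> n" for c y
  proof -
    have "0 \<notin> S" using S by auto
    then obtain h where h: "has_value_fun S n f h"
      using pfaffian_span_has_value_fun[OF pair(1)] by blast
    have "lim_at (pair_quot a b * f) c (pair_quot_val c a b * h c)"
      using pair T by (intro lim_at_mult lim_at_pair_quot_less has_value_funD(1)[OF h]) auto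
    with y have y: "y = pair_quot_val c a b * h c" by (rule lim_at_unique)
    have s: "sum c ?T = c a + c b + sum c S" using fin pair by simp
    then have hP: "h c = nat_eval c P" using c by (intro P(3)[OF has_value_funD(1)[OF h]]) simp
    show ?thesis
    proof (cases "c a = 0 \<and> c b = 0")
      case True
      then show ?thesis using pair(2) hP by (simp add: y pair_quot_val_def)
    next
      case False
      then have "sum c S < n" using c s by auto
      then have "h c = 0" by (rule has_value_funD(3)[OF h])
      then show ?thesis using hP y by simp
    qed
  qed
  moreover have "ffact_span ?T n P"
    using ffact_span_extend[OF P(1), of "{a, b}"] pair by auto
  ultimately have "is_poly_component k ?T n (pair_quot a b * f) P"
    by (simp add: is_poly_component_def)
  then show ?case by blast
next
  case (add S n f g)
  then obtain P Q where P: "is_poly_component k S n f P" and Q: "is_poly_component k S n g Q" by blast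
  have M: "f \<in> Mclass k" "g \<in> Mclass k" using add.hyps add.prems by (simp_all add: pfaffian_span_Mclass)
  have "y = nat_eval c (P + Q)" if y: "lim_at (f + g) c y" and c: "sum c S \<le> n" for c y
  proof -
    have "0 \<notin> S" using add.prems by auto
    then obtain h h' where h: "has_value_fun S n f h" "has_value_fun S n g h'"
      using pfaffian_span_has_value_fun add.hyps by blast
    note v = has_value_funD(1)[OF h(1), of c] has_value_funD(1)[OF h(2), of c]
    have "y = h c + h' c" using y lim_at_add[OF v] by (rule lim_at_unique)
    then show ?thesis using P Q v c by (auto simp: is_poly_component_def poly_eval_add)
  qed
  then have "is_poly_component k S n (f + g) (P + Q)"
    using P Q M by (auto simp: is_poly_component_def laurent_add conv_add intro: ffact_span.add)
  then show ?case by blast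
next
  case (scale S n f r)
  then obtain P where P: "is_poly_component k S n f P" by blast
  have M: "f \<in> Mclass k" using scale.hyps scale.prems by (rule pfaffian_span_Mclass)
  have "y = nat_eval c (Const r * P)" if y: "lim_at (rf (Const r) * f) c y" and c: "sum c S \<le> n" for c y
  proof -
    have "0 \<notin> S" using scale.prems by auto
    then obtain h where h: "has_value_fun S n f h"
      using pfaffian_span_has_value_fun scale.hyps by blast
    note v = has_value_funD(1)[OF h, of c]
    have "y = of_rat r * h c" using y lim_at_mult[OF lim_at_Const v] by (rule lim_at_unique)
    then show ?thesis using P v c by (auto simp: is_poly_component_def poly_eval_mult)
  qed
  moreover have "laurent_coeff k (rf (Const r) * f) e = r * laurent_coeff k f e" for e
    using M poly_vars_Const[of r "{1..k}"]
    by (simp add: laurent_poly_mult polys_eq_poly_vars) (simp add: Const_def conv_single)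
  ultimately have "is_poly_component k S n (rf (Const r) * f) (Const r * P)"
    using P by (auto simp: is_poly_component_def conv_Const_mult intro: ffact_span.scale)
  then show ?case by blast
qed

section \<open>A partial fraction identity\<close>

text \<open>
  Up to the factor $-2y_k$, the new residue, at $z=-y_k$, is a value of the product for the smaller
  set, so the induction is over all \<open>z\<close> at once.
\<close>

lemma partial_fraction_product:
  fixes y :: "'i \<Rightarrow> 'a :: field"
  assumes "finite J" "inj_on y J" "\<And>j. j \<in> J \<Longrightarrow> z + y j \<noteq> 0"
  shows "(\<Prod>j\<in>J. (z - y j) / (z + y j)) =
    1 - (\<Sum>j\<in>J. 2 * y j / (z + y j) * (\<Prod>i\<in>J - {j}. (y j + y i) / (y j - y i)))"
  using assms
proof (induction J arbitrary: z rule: finite_induct)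
  case empty
  show ?case by simp
next
  case (insert k J)
  define w where "w j = (\<Prod>i\<in>J - {j}. (y j + y i) / (y j - y i))" for j
  define w' where "w' j = (\<Prod>i\<in>insert k J - {j}. (y j + y i) / (y j - y i))" for j
  have inj: "inj_on y J" using insert.prems(1) by simp
  have ne: "y j \<noteq> y k" if "j \<in> J" for j
    using insert.prems(1) insert.hyps(2) that by (auto simp: inj_on_def)
  have F: "(\<Prod>j\<in>J. (x - y j) / (x + y j)) = 1 - (\<Sum>j\<in>J. 2 * y j / (x + y j) * w j)"
    if "\<And>j. j \<in> J \<Longrightarrow> x + y j \<noteq> 0" for x
    unfolding w_def using inj that by (rule insert.IH)
  \<comment> \<open>The weight of the new point is the product for \<open>J\<close> at $z=-y_k$.\<close>
  have "w' k = (\<Prod>j\<in>J. (- y k - y j) / (- y k + y j))"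
    unfolding w'_def using insert.hyps(2)
  proof (intro prod.cong)
    fix j
    have "- y k - y j = - (y k + y j)" "- y k + y j = - (y k - y j)" by simp_all
    then show "(y k + y j) / (y k - y j) = (- y k - y j) / (- y k + y j)"
      by (simp only: minus_divide_divide)
  qed auto
  also have "\<dots> = 1 - (\<Sum>j\<in>J. 2 * y j / (- y k + y j) * w j)"
    by (rule F) (use ne in auto)
  finally have wk: "w' k = 1 - (\<Sum>j\<in>J. 2 * y j / (- y k + y j) * w j)" .
  have wj: "w' j = (y j + y k) / (y j - y k) * w j" if "j \<in> J" for j
  proof -
    have "insert k J - {j} = insert k (J - {j})" using insert.hyps(2) that by auto
    then show ?thesis unfolding w'_def w_def using insert.hyps by simp
  qed
  have zk: "z + y k \<noteq> 0" and zj: "\<And>j. j \<in> J \<Longrightarrow> z + y j \<noteq> 0" using insert.prems(2) by auto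
  have step: "(z - y k) / (z + y k) * (2 * y j / (z + y j) * w j)
      = 2 * y j / (z + y j) * w' j - 2 * y k / (z + y k) * (2 * y j / (- y k + y j) * w j)"
    if j: "j \<in> J" for j
  proof -
    have d: "y j - y k \<noteq> 0" using ne[OF j] by simp
    have "(z - y k) / ((z + y k) * (z + y j))
        = (y j + y k) / ((z + y j) * (y j - y k)) - 2 * y k / ((z + y k) * (y j - y k))"
      using d zk zj[OF j] by (simp add: divide_simps) (simp add: algebra_simps)
    then have "(z - y k) / ((z + y k) * (z + y j)) * (2 * y j * w j)
        = (y j + y k) / ((z + y j) * (y j - y k)) * (2 * y j * w j)
          - 2 * y k / ((z + y k) * (y j - y k)) * (2 * y j * w j)"
      by (simp only: left_diff_distrib)
    moreover have "(z - y k) / ((z + y k) * (z + y j)) * (2 * y j * w j)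
        = (z - y k) / (z + y k) * (2 * y j / (z + y j) * w j)" by simp
    moreover have "(y j + y k) / ((z + y j) * (y j - y k)) * (2 * y j * w j) = 2 * y j / (z + y j) * w' j"
      unfolding wj[OF j] by (simp add: ac_simps)
    moreover have "2 * y k / ((z + y k) * (y j - y k)) * (2 * y j * w j)
        = 2 * y k / (z + y k) * (2 * y j / (- y k + y j) * w j)" by (simp add: ac_simps)
    ultimately show ?thesis by simp
  qed
  have "(\<Prod>j\<in>insert k J. (z - y j) / (z + y j))
      = (z - y k) / (z + y k) * (1 - (\<Sum>j\<in>J. 2 * y j / (z + y j) * w j))"
    using insert.hyps F[OF zj] by simp
  also have "\<dots> = (z - y k) / (z + y k) - (\<Sum>j\<in>J. (z - y k) / (z + y k) * (2 * y j / (z + y j) * w j))"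
    by (simp add: right_diff_distrib sum_distrib_left)
  also have "\<dots> = (z - y k) / (z + y k) - (\<Sum>j\<in>J. 2 * y j / (z + y j) * w' j)
      + 2 * y k / (z + y k) * (\<Sum>j\<in>J. 2 * y j / (- y k + y j) * w j)"
    using step by (simp add: sum_subtractf sum_distrib_left)
  also have "(\<Sum>j\<in>J. 2 * y j / (- y k + y j) * w j) = 1 - w' k" using wk by simp
  also have "(z - y k) / (z + y k) = 1 - 2 * y k / (z + y k)"
    using zk by (simp add: divide_simps)
  finally have prod: "(\<Prod>j\<in>insert k J. (z - y j) / (z + y j))
      = 1 - 2 * y k / (z + y k) - (\<Sum>j\<in>J. 2 * y j / (z + y j) * w' j) + 2 * y k / (z + y k) * (1 - w' k)" .
  have "1 - A - S + A * (1 - B) = 1 - (A * B + S)" for A B S :: 'a by (simp add: algebra_simps)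
  then have "(\<Prod>j\<in>insert k J. (z - y j) / (z + y j))
      = 1 - (\<Sum>j\<in>insert k J. 2 * y j / (z + y j) * w' j)"
    unfolding prod sum.insert[OF insert.hyps] by blast
  then show ?case unfolding w'_def .
qed

section \<open>Signs of permutations as products over pairs\<close>

definition incr_pairs :: "nat set \<Rightarrow> (nat \<times> nat) set" where
  "incr_pairs A = {(i, j). i \<in> A \<and> j \<in> A \<and> i < j}"

lemma finite_incr_pairs [simp]: "finite A \<Longrightarrow> finite (incr_pairs A)"
  by (rule finite_subset[of _ "A \<times> A"]) (auto simp: incr_pairs_def)

lemma pairs_eq_incr_pairs: "pairs k = incr_pairs {1..k}"
  by (auto simp: pairs_def incr_pairs_def)

text \<open>
  The sign by which an antisymmetric function changes when its two arguments are put in increasing order.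
\<close>

definition ord_sign :: "nat \<Rightarrow> nat \<Rightarrow> 'a :: comm_ring_1" where
  "ord_sign a b = (if a < b then 1 else -1)"

lemma ord_sign_swap: "a \<noteq> b \<Longrightarrow> ord_sign b a = - ord_sign a b"
  by (auto simp: ord_sign_def)

lemma prod_incr_pairs_insert:
  fixes t :: "nat \<Rightarrow> nat \<Rightarrow> 'a :: comm_monoid_mult"
  assumes "finite B" "z \<notin> B" "\<And>a b. t a b = t b a"
  shows "(\<Prod>(a, b)\<in>incr_pairs (insert z B). t a b) = (\<Prod>j\<in>B. t z j) * (\<Prod>(a, b)\<in>incr_pairs B. t a b)"
proof -
  let ?N = "(\<lambda>j. (min z j, max z j)) ` B"
  have "incr_pairs (insert z B) = ?N \<union> incr_pairs B" (is "?L = ?R")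
  proof
    show "?L \<subseteq> ?R"
    proof
      fix q assume "q \<in> ?L"
      then obtain a b where q: "q = (a, b)" "a \<in> insert z B" "b \<in> insert z B" "a < b"
        by (auto simp: incr_pairs_def)
      consider "a \<in> B" "b \<in> B" | "a = z" "b \<in> B" | "b = z" "a \<in> B" using q by auto
      then show "q \<in> ?R"
      proof cases
        case 1 then show ?thesis using q by (auto simp: incr_pairs_def)
      next
        case 2 then show ?thesis using q by (auto simp: image_iff intro!: bexI[of _ b])
      next
        case 3 then show ?thesis using q by (auto simp: image_iff intro!: bexI[of _ a])
      qed
    qed
    show "?R \<subseteq> ?L"
    proof
      fix q assume "q \<in> ?R"
      then consider j where "j \<in> B" "q = (min z j, max z j)" | "q \<in> incr_pairs B" by auto
      then show "q \<in> ?L"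
      proof cases
        case 1
        then have "z \<noteq> j" using assms(2) by auto
        then show ?thesis using 1 by (cases "z < j") (auto simp: incr_pairs_def)
      qed (auto simp: incr_pairs_def)
    qed
  qed
  moreover have "?N \<inter> incr_pairs B = {}"
    using assms(2) by (auto simp: incr_pairs_def min_def max_def split: if_splits)
  ultimately have "(\<Prod>(a, b)\<in>incr_pairs (insert z B). t a b)
      = (\<Prod>(a, b)\<in>?N. t a b) * (\<Prod>(a, b)\<in>incr_pairs B. t a b)"
    using prod.union_disjoint[of ?N "incr_pairs B" "\<lambda>(a, b). t a b"] assms(1) by simp
  also have "(\<Prod>(a, b)\<in>?N. t a b) = (\<Prod>j\<in>B. t (min z j) (max z j))"
    by (subst prod.reindex) (auto simp: inj_on_def min_def max_def split: if_splits)
  also have "\<dots> = (\<Prod>j\<in>B. t z j)"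
    by (rule prod.cong) (use assms(3) in \<open>auto simp: min_def max_def\<close>)
  finally show ?thesis .
qed

text \<open>
  Up to order, \<open>\<pi>\<close> maps the increasing pairs bijectively to those of the image; each pair whose order
  it reverses costs a sign.
\<close>

lemma prod_incr_pairs_reindex:
  fixes s :: "nat \<Rightarrow> nat \<Rightarrow> 'a :: comm_ring_1"
  assumes inj: "inj_on \<pi> A" and anti: "\<And>a b. a \<noteq> b \<Longrightarrow> s b a = - s a b"
  shows "(\<Prod>(i, j)\<in>incr_pairs A. s (\<pi> i) (\<pi> j)) =
    (\<Prod>(i, j)\<in>incr_pairs A. ord_sign (\<pi> i) (\<pi> j)) * (\<Prod>(a, b)\<in>incr_pairs (\<pi> ` A). s a b)"
proof -
  let ?h = "\<lambda>(i, j). (min (\<pi> i) (\<pi> j), max (\<pi> i) (\<pi> j))"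
  have neq: "\<pi> i \<noteq> \<pi> j" if "(i, j) \<in> incr_pairs A" for i j
    using that inj by (auto simp: incr_pairs_def inj_on_def)
  have "inj_on ?h (incr_pairs A)"
  proof (rule inj_onI)
    fix p q assume pq: "p \<in> incr_pairs A" "q \<in> incr_pairs A" "?h p = ?h q"
    obtain i j i' j' where e: "p = (i, j)" "q = (i', j')" by fastforce
    have "(\<pi> i = \<pi> i' \<and> \<pi> j = \<pi> j') \<or> (\<pi> i = \<pi> j' \<and> \<pi> j = \<pi> i')"
      using pq(3) by (auto simp: e min_def max_def split: if_splits)
    then have "(i = i' \<and> j = j') \<or> (i = j' \<and> j = i')"
      using inj pq(1,2) by (auto simp: e incr_pairs_def inj_on_def)
    then show "p = q" using pq(1,2) by (auto simp: e incr_pairs_def)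
  qed
  moreover have "?h ` incr_pairs A = incr_pairs (\<pi> ` A)"
  proof
    show "?h ` incr_pairs A \<subseteq> incr_pairs (\<pi> ` A)"
    proof
      fix q assume "q \<in> ?h ` incr_pairs A"
      then obtain i j where "(i, j) \<in> incr_pairs A" "q = ?h (i, j)" by auto
      then show "q \<in> incr_pairs (\<pi> ` A)" using neq[of i j] by (auto simp: incr_pairs_def min_def max_def)
    qed
    show "incr_pairs (\<pi> ` A) \<subseteq> ?h ` incr_pairs A"
    proof
      fix q assume "q \<in> incr_pairs (\<pi> ` A)"
      then obtain i j where ij: "i \<in> A" "j \<in> A" "q = (\<pi> i, \<pi> j)" "\<pi> i < \<pi> j"
        by (auto simp: incr_pairs_def)
      then have "i \<noteq> j" by auto
      then have "(if i < j then (i, j) else (j, i)) \<in> incr_pairs A" using ij by (auto simp: incr_pairs_def)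
      moreover have "q = ?h (if i < j then (i, j) else (j, i))" using ij by (auto simp: min_def max_def)
      ultimately show "q \<in> ?h ` incr_pairs A" by blast
    qed
  qed
  ultimately have "(\<Prod>(a, b)\<in>incr_pairs (\<pi> ` A). s a b) = (\<Prod>q\<in>incr_pairs A. case ?h q of (a, b) \<Rightarrow> s a b)"
    using prod.reindex[of ?h "incr_pairs A" "\<lambda>(a, b). s a b"] by simp
  then have "(\<Prod>(i, j)\<in>incr_pairs A. ord_sign (\<pi> i) (\<pi> j)) * (\<Prod>(a, b)\<in>incr_pairs (\<pi> ` A). s a b)
     = (\<Prod>q\<in>incr_pairs A. (case q of (i, j) \<Rightarrow> ord_sign (\<pi> i) (\<pi> j)) * (case ?h q of (a, b) \<Rightarrow> s a b))"
    by (simp add: prod.distrib)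
  also have "\<dots> = (\<Prod>(i, j)\<in>incr_pairs A. s (\<pi> i) (\<pi> j))"
  proof (rule prod.cong)
    fix q assume q: "q \<in> incr_pairs A"
    obtain i j where e: "q = (i, j)" by fastforce
    show "(case q of (i, j) \<Rightarrow> ord_sign (\<pi> i) (\<pi> j)) * (case ?h q of (a, b) \<Rightarrow> s a b)
       = (case q of (i, j) \<Rightarrow> s (\<pi> i) (\<pi> j))"
      using neq[of i j] anti[of "\<pi> i" "\<pi> j"] q by (auto simp: e ord_sign_def min_def max_def)
  qed simp
  finally show ?thesis ..
qed

text \<open>
  The parity of the number of inversions of \<open>\<pi>\<close> on \<open>A\<close>, as a sign. This form is what products over pairs
  produce; for a permutation of \<open>A\<close> it is the usual sign.
\<close>

definition inv_sign :: "(nat \<Rightarrow> nat) \<Rightarrow> nat set \<Rightarrow> 'a :: comm_ring_1" where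
  "inv_sign \<pi> A = (\<Prod>(i, j)\<in>incr_pairs A. ord_sign (\<pi> i) (\<pi> j))"

lemma inv_sign_compose:
  assumes "inj_on \<pi> A" "inj \<sigma>"
  shows "inv_sign (\<sigma> \<circ> \<pi>) A = inv_sign \<pi> A * inv_sign \<sigma> (\<pi> ` A)"
  unfolding inv_sign_def comp_def
  using assms by (intro prod_incr_pairs_reindex[of \<pi> A "\<lambda>a b. ord_sign (\<sigma> a) (\<sigma> b)"])
    (auto intro!: ord_sign_swap dest: injD)

text \<open>
  For $j\ne a,b$ the transposition affects the order of $j$ and $a$ exactly as it affects that of $j$ and $b$,
  so these signs cancel in pairs and only the pair of $a$ and $b$ remains.
\<close>

lemma inv_sign_transpose:
  assumes "a \<in> A" "b \<in> A" "a \<noteq> b" "finite A"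
  shows "inv_sign (Transposition.transpose a b) A = (-1 :: 'a :: comm_ring_1)"
proof -
  let ?\<tau> = "Transposition.transpose a b"
  define t where "t i j = (if (?\<tau> i < ?\<tau> j) = (i < j) then 1 else -1 :: 'a)" for i j
  have tt: "t i j = t j i" for i j
  proof (cases "i = j")
    case False
    then have "?\<tau> i \<noteq> ?\<tau> j" by (metis transpose_eq_imp_eq)
    then show ?thesis using False unfolding t_def by (metis linorder_neqE_nat order.asym)
  qed simp
  have "inv_sign ?\<tau> A = (\<Prod>(i, j)\<in>incr_pairs A. t i j)"
    unfolding inv_sign_def by (rule prod.cong) (auto simp: incr_pairs_def t_def ord_sign_def)
  also have "incr_pairs A = incr_pairs (insert a (insert b (A - {a, b})))"
    by (rule arg_cong[of _ _ incr_pairs]) (use assms in auto)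
  also have "(\<Prod>(i, j)\<in>\<dots>. t i j) = (\<Prod>j\<in>insert b (A - {a, b}). t a j) *
      ((\<Prod>j\<in>A - {a, b}. t b j) * (\<Prod>(i, j)\<in>incr_pairs (A - {a, b}). t i j))"
    using assms by (subst prod_incr_pairs_insert[OF _ _ tt], simp, simp, subst prod_incr_pairs_insert[OF _ _ tt]) auto
  also have "(\<Prod>(i, j)\<in>incr_pairs (A - {a, b}). t i j) = 1"
    by (rule prod.neutral) (auto simp: incr_pairs_def t_def transpose_def)
  also have "(\<Prod>j\<in>insert b (A - {a, b}). t a j) * ((\<Prod>j\<in>A - {a, b}. t b j) * 1)
      = t a b * (\<Prod>j\<in>A - {a, b}. t a j * t b j)"
    using assms by (simp add: prod.distrib mult.assoc)
  also have "(\<Prod>j\<in>A - {a, b}. t a j * t b j) = 1"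
    by (rule prod.neutral) (auto simp: t_def transpose_def)
  also have "t a b = -1" using assms by (auto simp: t_def)
  finally show ?thesis by simp
qed

lemma inv_sign_eq_sign:
  assumes "\<pi> permutes A" "finite A"
  shows "inv_sign \<pi> A = (of_int (sign \<pi>) :: 'a :: comm_ring_1)"
  using assms
proof (induction \<pi> rule: permutes_induct)
  case id
  then show ?case by (auto simp: inv_sign_def incr_pairs_def ord_sign_def intro!: prod.neutral)
next
  case (swap a b p)
  have p: "p permutes A" using swap by auto
  have "inv_sign (Transposition.transpose a b \<circ> p) A
      = inv_sign p A * (inv_sign (Transposition.transpose a b) (p ` A) :: 'a)"
    using permutes_inj[OF p] by (intro inv_sign_compose) (auto intro: inj_on_subset inj_swap)
  also have "p ` A = A" using p by (rule permutes_image)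
  also have "inv_sign p A = (of_int (sign p) :: 'a)" using swap by auto
  also have "inv_sign (Transposition.transpose a b) A = (-1 :: 'a)"
    using swap assms(2) by (intro inv_sign_transpose) auto
  also have "of_int (sign p) * (-1 :: 'a) = of_int (sign (Transposition.transpose a b \<circ> p))"
  proof -
    have "permutation p" using p assms(2) permutation_permutes by blast
    then have "sign (Transposition.transpose a b \<circ> p) = - sign p"
      using swap by (subst sign_compose) (auto simp: sign_swap_id permutation_swap_id)
    then show ?thesis by simp
  qed
  finally show ?case .
qed

section \<open>Expansion of the Schur product\<close>

text \<open>
  This is the Schur Pfaffian of the variables indexed by \<open>B\<close>.
\<close>

definition schur :: "nat set \<Rightarrow> ratfun" where
  "schur B = (\<Prod>(a, b)\<in>incr_pairs B. pair_quot a b)"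

lemma schur_insert:
  assumes "finite B" "z \<notin> B"
  shows "schur (insert z B) = (\<Prod>j\<in>B. ord_sign z j) * (\<Prod>j\<in>B. pair_quot z j) * schur B"
proof -
  define t where "t a b = (if a < b then pair_quot a b else pair_quot b a)" for a b
  have tt: "t a b = t b a" for a b by (cases a b rule: linorder_cases) (auto simp: t_def)
  have eq: "schur C = (\<Prod>(a, b)\<in>incr_pairs C. t a b)" for C
    unfolding schur_def by (rule prod.cong) (auto simp: incr_pairs_def t_def)
  have "(\<Prod>j\<in>B. t z j) = (\<Prod>j\<in>B. ord_sign z j * pair_quot z j)"
  proof (rule prod.cong)
    fix j assume "j \<in> B"
    then have "z \<noteq> j" using assms by auto
    then show "t z j = ord_sign z j * pair_quot z j" using pair_quot_swap[of j z] by (auto simp: t_def ord_sign_def)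
  qed simp
  then show ?thesis unfolding eq using prod_incr_pairs_insert[OF assms tt] by (simp add: prod.distrib)
qed

lemma prod_ord_sign_cases: "(\<Prod>j\<in>B. ord_sign z j) = (1 :: 'a :: comm_ring_1) \<or> (\<Prod>j\<in>B. ord_sign z j) = (-1 :: 'a)"
  by (induction B rule: infinite_finite_induct) (auto simp: ord_sign_def)

lemma inv_sign_cases: "inv_sign \<pi> A = (1 :: 'a :: comm_ring_1) \<or> inv_sign \<pi> A = (-1 :: 'a)"
proof -
  have "(\<Prod>(i, j)\<in>F. ord_sign (\<pi> i) (\<pi> j)) = (1 :: 'a) \<or> (\<Prod>(i, j)\<in>F. ord_sign (\<pi> i) (\<pi> j)) = (-1 :: 'a)" for F
    by (induction F rule: infinite_finite_induct) (auto simp: ord_sign_def)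
  then show ?thesis unfolding inv_sign_def .
qed

lemma pfaffian_span_sign: "pfaffian_span S n f \<Longrightarrow> e = 1 \<or> e = -1 \<Longrightarrow> pfaffian_span S n (e * f)"
  using pfaffian_span_uminus by auto

lemma X_nonzero: "X j \<noteq> 0"
proof
  assume "X j = 0"
  then have "X j + X j = 0" by simp
  then show False using X_add_nonzero by blast
qed

lemma inj_X: "inj X"
  using X_diff_nonzero by (auto simp: inj_def)

lemma two_ratfun: "(2 :: ratfun) \<noteq> 0"
  using X_add_nonzero[of 0 0] by (metis mult_2 mult_zero_left)

text \<open>
  Up to the factor $-2x_j$, the residue at $z=-x_j$ of $\prod_{j\in J}(z-x_j)/(z+x_j)$.
\<close>

definition pf_weight :: "nat set \<Rightarrow> nat \<Rightarrow> ratfun" where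
  "pf_weight J j = (\<Prod>i\<in>J - {j}. (X j + X i) / (X j - X i))"

text \<open>
  The weight consists of the inverses of the quotients that contain $x_j$.
\<close>

lemma pf_weight_schur:
  assumes "finite J" "j \<in> J"
  shows "pf_weight J j * schur J = (\<Prod>i\<in>J - {j}. ord_sign j i) * schur (J - {j})"
proof -
  have J: "J = insert j (J - {j})" using assms by auto
  have "pf_weight J j * (\<Prod>i\<in>J - {j}. pair_quot j i) = 1"
    unfolding pf_weight_def pair_quot_def prod.distrib[symmetric]
    by (rule prod.neutral) (use X_add_nonzero X_diff_nonzero in auto)
  moreover have "schur J = (\<Prod>i\<in>J - {j}. ord_sign j i) * (\<Prod>i\<in>J - {j}. pair_quot j i) * schur (J - {j})"
    using assms by (subst J, subst schur_insert) auto
  ultimately show ?thesis    by (simp add: mult.assoc mult.left_commute)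
qed

text \<open>
  The partial fraction decomposition at $z=0$, where the product is $(-1)^{|J|}$.
\<close>

lemma sum_pf_weight_odd:
  assumes "finite J" "odd (card J)"
  shows "(\<Sum>j\<in>J. pf_weight J j) = 1"
proof -
  have "(\<Prod>j\<in>J. (0 - X j) / (0 + X j)) = 1 - (\<Sum>j\<in>J. 2 * X j / (0 + X j) * pf_weight J j)"
    unfolding pf_weight_def using assms X_nonzero
    by (intro partial_fraction_product) (auto intro: inj_on_subset[OF inj_X])
  moreover have "(\<Prod>j\<in>J. (0 - X j) / (0 + X j)) = -1"
    using assms X_nonzero by simp
  moreover have "(\<Sum>j\<in>J. 2 * X j / (0 + X j) * pf_weight J j) = 2 * (\<Sum>j\<in>J. pf_weight J j)"
    using X_nonzero by (simp add: sum_distrib_left)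
  ultimately have "2 * (\<Sum>j\<in>J. pf_weight J j) = 2 * 1" by (simp add: algebra_simps)
  then show ?thesis using two_ratfun mult_left_cancel by blast
qed

lemma prod_pair_quot_odd:
  assumes "finite J" "odd (card J)" "z \<notin> J"
  shows "(\<Prod>j\<in>J. pair_quot z j) = (\<Sum>j\<in>J. pf_weight J j * pair_quot z j)"
proof -
  have "(\<Prod>j\<in>J. pair_quot z j) = 1 - (\<Sum>j\<in>J. 2 * X j / (X z + X j) * pf_weight J j)"
    unfolding pf_weight_def pair_quot_def using assms X_add_nonzero
    by (intro partial_fraction_product) (auto intro: inj_on_subset[OF inj_X])
  also have "\<dots> = (\<Sum>j\<in>J. pf_weight J j - 2 * X j / (X z + X j) * pf_weight J j)"
    using sum_pf_weight_odd[OF assms(1,2)] by (simp add: sum_subtractf)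
  also have "\<dots> = (\<Sum>j\<in>J. pf_weight J j * pair_quot z j)"
  proof (rule sum.cong)
    fix j
    have "pair_quot z j = ((X z + X j) - 2 * X j) / (X z + X j)" by (simp add: pair_quot_def)
    also have "\<dots> = 1 - 2 * X j / (X z + X j)"
      unfolding diff_divide_distrib[of "X z + X j"] using X_add_nonzero[of z j] by simp
    finally show "pf_weight J j - 2 * X j / (X z + X j) * pf_weight J j = pf_weight J j * pair_quot z j"
      by (simp add: right_diff_distrib mult.commute)
  qed simp
  finally show ?thesis .
qed

text \<open>
  Odd sets: the weights sum to 1, so the product is the signed sum of the products with one variable
  left out. Even sets: take out one variable $z$ and expand its quotients $\prod_j(z-x_j)/(z+x_j)$ into
  single quotients $(z-x_j)/(z+x_j)$, each of which makes a pair.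
\<close>

lemma pfaffian_span_schur: "finite B \<Longrightarrow> pfaffian_span B 0 (schur B)"
proof (induction B rule: finite_psubset_induct)
  case (psubset B)
  show ?case
  proof (cases "odd (card B)")
    case True
    then have ne: "B \<noteq> {}" by auto
    have "schur B = (\<Sum>j\<in>B. pf_weight B j * schur B)"
      using sum_pf_weight_odd[OF psubset.hyps True] by (simp flip: sum_distrib_right)
    also have "\<dots> = (\<Sum>j\<in>B. (\<Prod>i\<in>B - {j}. ord_sign j i) * schur (B - {j}))"
      by (rule sum.cong) (use psubset.hyps in \<open>auto intro: pf_weight_schur\<close>)
    also have "pfaffian_span B 0 \<dots>"
    proof (rule pfaffian_span_sum[OF ne psubset.hyps])
      fix j assume j: "j \<in> B"
      have "pfaffian_span (B - {j}) 0 (schur (B - {j}))" using psubset j by (intro psubset.IH) auto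
      then have "pfaffian_span ({j} \<union> (B - {j})) (0 + 0) (rf 1 * schur (B - {j}))"
        by (intro pfaffian_span.ffact ffact_span_one) auto
      then have "pfaffian_span B 0 (schur (B - {j}))" using j by (simp add: insert_absorb)
      then show "pfaffian_span B 0 ((\<Prod>i\<in>B - {j}. ord_sign j i) * schur (B - {j}))"
        by (rule pfaffian_span_sign) (rule prod_ord_sign_cases)
    qed
    finally show ?thesis .
  next
    case False
    show ?thesis
    proof (cases "B = {}")
      case True
      then show ?thesis using pfaffian_span.one by (simp add: schur_def incr_pairs_def)
    next
      case ne: False
      then obtain z where z: "z \<in> B" by auto
      define J where "J = B - {z}"
      have J: "finite J" "z \<notin> J" "B = insert z J" using z psubset.hyps by (auto simp: J_def)
      have odd: "odd (card J)" using False J by simp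
      then have Jne: "J \<noteq> {}" by auto
      let ?e = "\<lambda>z B. (\<Prod>j\<in>B. ord_sign z j) :: ratfun"
      have "schur B = ?e z J * (\<Prod>j\<in>J. pair_quot z j) * schur J"
        unfolding J(3) using J by (intro schur_insert)
      also have "\<dots> = ?e z J * (\<Sum>j\<in>J. pair_quot z j * (pf_weight J j * schur J))"
        using prod_pair_quot_odd[OF J(1) odd J(2)] by (simp add: sum_distrib_right mult.assoc mult.left_commute)
      also have "(\<Sum>j\<in>J. pair_quot z j * (pf_weight J j * schur J)) = (\<Sum>j\<in>J. ?e j (J - {j}) * (pair_quot z j * schur (J - {j})))"
        by (rule sum.cong) (use J in \<open>auto simp: pf_weight_schur mult.left_commute\<close>)
      also have "pfaffian_span B 0 (?e z J * \<dots>)"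
      proof (rule pfaffian_span_sign[OF _ prod_ord_sign_cases], rule pfaffian_span_sum[OF Jne J(1)],
          rule pfaffian_span_sign[OF _ prod_ord_sign_cases])
        fix j assume j: "j \<in> J"
        then have zj: "z \<noteq> j" using J by auto
        have IH: "pfaffian_span (J - {j}) 0 (schur (J - {j}))" using J j by (intro psubset.IH) auto
        show "pfaffian_span B 0 (pair_quot z j * schur (J - {j}))"
        proof (cases "z < j")
          case True
          then have "pfaffian_span (insert z (insert j (J - {j}))) 0 (pair_quot z j * schur (J - {j}))"
            using IH J by (intro pfaffian_span.pair) auto
          then show ?thesis using j J by (simp add: insert_absorb)
        next
          case False
          then have "pfaffian_span (insert j (insert z (J - {j}))) 0 (pair_quot j z * schur (J - {j}))"
            using IH J zj by (intro pfaffian_span.pair) auto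
          moreover have "insert j (insert z (J - {j})) = B" using j J by auto
          ultimately have "pfaffian_span B 0 (- (pair_quot j z * schur (J - {j})))" by (metis pfaffian_span_uminus)
          then show ?thesis using pair_quot_swap[of j z] by simp
        qed
      qed
      finally show ?thesis .
    qed
  qed
qed

section \<open>The function of a strict partition in the span\<close>

text \<open>
  Applying $\pi$ to the antisymmetric product over all pairs yields the sign of $\pi$. The quotients for the
  pairs with $i\le\ell$ then cancel.
\<close>

lemma phi_expansion:
  assumes "l \<le> k"
  shows "phi k l mu = rf (Const (1 / of_nat (fact (k - l)))) *
    (\<Sum>\<pi> | \<pi> permutes {1..k}. rf (Const (of_int (sign \<pi>))) *
       ((\<Prod>i=1..l. ffact (X (\<pi> i)) (mu i)) * (\<Prod>(i, j)\<in>incr_pairs {l<..k}. pair_quot (\<pi> i) (\<pi> j))))"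
proof -
  let ?P1 = "{(i, j) \<in> pairs k. i \<le> l}" and ?P2 = "incr_pairs {l<..k}"
  have P: "pairs k = ?P1 \<union> ?P2" "?P1 \<inter> ?P2 = {}"
    using assms by (auto simp: pairs_def incr_pairs_def)
  have fin: "finite ?P1" "finite ?P2" using finite_subset[OF _ finite_pairs, of ?P1 k] by auto
  have cint: "rf (Const (of_int z)) = of_int z" for z
    by (cases z) (auto simp: Const_minus rf_minus Const_of_nat Const_add[of 1, simplified] rf_add simp flip: of_nat_Suc)
  have summand: "(\<Prod>(i, j) \<in> pairs k. (X i - X j) / (X i + X j)) *
      ((\<Prod>i=1..l. ffact (X (\<pi> i)) (mu i)) *
       (\<Prod>(i, j)\<in>?P1. (X (\<pi> i) + X (\<pi> j)) / (X (\<pi> i) - X (\<pi> j))))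
    = rf (Const (of_int (sign \<pi>))) *
       ((\<Prod>i=1..l. ffact (X (\<pi> i)) (mu i)) * (\<Prod>(i, j)\<in>?P2. pair_quot (\<pi> i) (\<pi> j)))"
    if \<pi>: "\<pi> permutes {1..k}" for \<pi>
  proof -
    have inj: "\<pi> i = \<pi> j \<longleftrightarrow> i = j" for i j using permutes_inj[OF \<pi>] by (auto dest: injD)
    have "(\<Prod>(i, j)\<in>pairs k. pair_quot (\<pi> i) (\<pi> j)) = inv_sign \<pi> {1..k} * (\<Prod>(i, j)\<in>pairs k. pair_quot i j)"
      using prod_incr_pairs_reindex[of \<pi> "{1..k}" pair_quot] permutes_inj[OF \<pi>] permutes_image[OF \<pi>] pair_quot_swap
      unfolding inv_sign_def pairs_eq_incr_pairs by (metis inj_on_subset subset_UNIV)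
    also have "inv_sign \<pi> {1..k} = (of_int (sign \<pi>) :: ratfun)"
      using \<pi> by (intro inv_sign_eq_sign) auto
    finally have "of_int (sign \<pi>) * (\<Prod>(i, j)\<in>pairs k. pair_quot (\<pi> i) (\<pi> j))
        = of_int (sign \<pi> * sign \<pi>) * (\<Prod>(i, j)\<in>pairs k. pair_quot i j)"
      by (simp only: of_int_mult mult.assoc)
    then have 1: "(\<Prod>(i, j)\<in>pairs k. pair_quot i j) = of_int (sign \<pi>) * (\<Prod>(i, j)\<in>pairs k. pair_quot (\<pi> i) (\<pi> j))"
      by simp
    have 2: "(\<Prod>(i, j)\<in>pairs k. pair_quot (\<pi> i) (\<pi> j))
        = (\<Prod>(i, j)\<in>?P1. pair_quot (\<pi> i) (\<pi> j)) * (\<Prod>(i, j)\<in>?P2. pair_quot (\<pi> i) (\<pi> j))"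
      using prod.union_disjoint[OF fin P(2), of "\<lambda>(i, j). pair_quot (\<pi> i) (\<pi> j)"]
      unfolding P(1)[symmetric] .
    have "(\<Prod>(i, j)\<in>?P1. pair_quot (\<pi> i) (\<pi> j)) * (\<Prod>(i, j)\<in>?P1. (X (\<pi> i) + X (\<pi> j)) / (X (\<pi> i) - X (\<pi> j)))
       = (\<Prod>q\<in>?P1. (case q of (i, j) \<Rightarrow> pair_quot (\<pi> i) (\<pi> j)) *
            (case q of (i, j) \<Rightarrow> (X (\<pi> i) + X (\<pi> j)) / (X (\<pi> i) - X (\<pi> j))))"
      by (rule prod.distrib[symmetric])
    also have "\<dots> = 1"
    proof (rule prod.neutral, rule ballI)
      fix q assume q: "q \<in> ?P1"
      obtain i j where e: "q = (i, j)" by fastforce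
      have "i \<noteq> j" using q e by (auto simp: pairs_def)
      then have "X (\<pi> i) - X (\<pi> j) \<noteq> 0" using inj by (intro X_diff_nonzero) auto
      then show "(case q of (i, j) \<Rightarrow> pair_quot (\<pi> i) (\<pi> j)) *
            (case q of (i, j) \<Rightarrow> (X (\<pi> i) + X (\<pi> j)) / (X (\<pi> i) - X (\<pi> j))) = 1"
        using X_add_nonzero[of "\<pi> i" "\<pi> j"] by (simp add: e pair_quot_def)
    qed
    finally have 3: "(\<Prod>(i, j)\<in>?P1. pair_quot (\<pi> i) (\<pi> j)) *
      (\<Prod>(i, j)\<in>?P1. (X (\<pi> i) + X (\<pi> j)) / (X (\<pi> i) - X (\<pi> j))) = 1" .
    have cancel: "s * (A * C) * (F * B) = s * (F * C)" if "A * B = 1" for A B C F s :: ratfun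
    proof -
      have "s * (A * C) * (F * B) = s * (F * C) * (A * B)" by (simp only: ac_simps)
      then show ?thesis using that by simp
    qed
    show ?thesis
      unfolding pair_quot_def[symmetric] 1 2 cint by (rule cancel[OF 3])
  qed
  have "p * (r * sum G A) = r * sum H A" if "\<And>x. x \<in> A \<Longrightarrow> p * G x = H x"
    for p r :: ratfun and G H and A :: "(nat \<Rightarrow> nat) set"
    unfolding mult.left_commute[of p r] sum_distrib_left[of p] using that by simp
  note factor_out = this
  have c: "rf (Const (1 / of_nat (fact (k - l)))) = 1 / of_nat (fact (k - l))"
    by (rule rf_Const_inverse) simp
  show ?thesis
    unfolding phi_def psi_def Sym_def c by (rule factor_out, rule summand) simp
qed

lemma pfaffian_span_phi:
  assumes "l \<le> k"
  shows "pfaffian_span {1..k} (\<Sum>i=1..l. mu i) (phi k l mu)"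
  unfolding phi_expansion[OF assms]
proof (rule pfaffian_span.scale, rule pfaffian_span_sum)
  show "{\<pi>. \<pi> permutes {1..k}} \<noteq> {}" using permutes_id by blast
  show "finite {\<pi>. \<pi> permutes {1..k}}" by (rule finite_permutations) simp
  fix \<pi> assume "\<pi> \<in> {\<pi>. \<pi> permutes {1..k}}"
  then have \<pi>: "\<pi> permutes {1..k}" by simp
  have inj: "inj_on \<pi> A" for A using permutes_inj[OF \<pi>] by (rule inj_on_subset) simp
  let ?A = "\<pi> ` {1..l}" and ?B = "\<pi> ` {l<..k}"
  let ?c = "\<lambda>a. if a \<in> ?A then mu (inv \<pi> a) else 0"
  have inv: "inv \<pi> (\<pi> i) = i" for i using permutes_inverses(2)[OF \<pi>] .
  have "?A \<union> ?B = \<pi> ` ({1..l} \<union> {l<..k})" by (simp add: image_Un)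
  also have "{1..l} \<union> {l<..k} = {1..k}" using assms by auto
  finally have AB: "?A \<union> ?B = {1..k}" using permutes_image[OF \<pi>] by simp
  have dis: "?A \<inter> ?B = {}" using inj[of "{1..k}"] by (auto simp: inj_on_def dest!: injD[OF permutes_inj[OF \<pi>]])
  have "ffact_monom ?A ?c = (\<Prod>i=1..l. ffact (Var (\<pi> i)) (mu i))"
    unfolding ffact_monom_def using inj by (subst prod.reindex) (auto simp: inv intro!: prod.cong)
  then have q: "rf (ffact_monom ?A ?c) = (\<Prod>i=1..l. ffact (X (\<pi> i)) (mu i))" by (simp add: rf_simps)
  have "sum ?c ?A = (\<Sum>i=1..l. mu i)"
    using inj by (subst sum.reindex) (auto simp: inv intro!: sum.cong)
  then have "ffact_span ?A (\<Sum>i=1..l. mu i) (ffact_monom ?A ?c)"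
    by (intro ffact_span.gen) (auto simp: comps_def)
  then have "pfaffian_span (?A \<union> ?B) ((\<Sum>i=1..l. mu i) + 0) (rf (ffact_monom ?A ?c) * (inv_sign \<pi> {l<..k} * schur ?B))"
    using dis by (intro pfaffian_span.ffact pfaffian_span_sign[OF _ inv_sign_cases] pfaffian_span_schur) auto
  also have "inv_sign \<pi> {l<..k} * schur ?B = (\<Prod>(i, j)\<in>incr_pairs {l<..k}. pair_quot (\<pi> i) (\<pi> j))"
    unfolding inv_sign_def schur_def using inj by (intro prod_incr_pairs_reindex[symmetric] pair_quot_swap)
  finally show "pfaffian_span {1..k} (\<Sum>i=1..l. mu i) (rf (Const (of_int (sign \<pi>))) *
      ((\<Prod>i=1..l. ffact (X (\<pi> i)) (mu i)) * (\<Prod>(i, j)\<in>incr_pairs {l<..k}. pair_quot (\<pi> i) (\<pi> j))))"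
    unfolding q AB by (intro pfaffian_span.scale) simp
qed

section \<open>Values of the function of a strict partition\<close>

definition phi_term :: "nat \<Rightarrow> nat \<Rightarrow> (nat \<Rightarrow> nat) \<Rightarrow> (nat \<Rightarrow> nat) \<Rightarrow> (nat \<Rightarrow> nat) \<Rightarrow> real" where
  "phi_term k l mu c \<pi> = of_int (sign \<pi>) *
     ((\<Prod>i=1..l. ffact (of_nat (c (\<pi> i))) (mu i)) * (\<Prod>(i, j)\<in>incr_pairs {l<..k}. pair_quot_val c (\<pi> i) (\<pi> j)))"

definition phi_val :: "nat \<Rightarrow> nat \<Rightarrow> (nat \<Rightarrow> nat) \<Rightarrow> (nat \<Rightarrow> nat) \<Rightarrow> real" where
  "phi_val k l mu c = 1 / fact (k - l) * (\<Sum>\<pi> | \<pi> permutes {1..k}. phi_term k l mu c \<pi>)"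

lemma lim_at_ffact_X:
  assumes "1 \<le> a"
  shows "lim_at (ffact (X a) n) c (ffact (of_nat (c a)) n)"
proof -
  have "lim_at (rf (ffact (Var a) n)) c (nat_eval c (ffact (Var a) n))"
    by (rule lim_at_poly[of _ "{a}"]) (use assms in \<open>auto intro: poly_vars_ffact poly_vars_Var\<close>)
  then show ?thesis by (simp add: rf_simps poly_eval_simps)
qed

lemma lim_at_phi:
  assumes "l \<le> k"
  shows "lim_at (phi k l mu) c (phi_val k l mu c)"
proof -
  have 1: "lim_at (rf (Const (1 / of_nat (fact (k - l))))) c (1 / fact (k - l))"
    using lim_at_Const[of "1 / of_nat (fact (k - l))" c] by (simp add: of_rat_divide of_rat_fact)
  have 2: "lim_at (rf (Const (of_int (sign \<pi>)))) c (of_int (sign \<pi>))" for \<pi> :: "nat \<Rightarrow> nat"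
    using lim_at_Const[of "of_int (sign \<pi>)" c] by simp
  show ?thesis unfolding phi_expansion[OF assms] phi_val_def phi_term_def
  proof (intro lim_at_mult lim_at_sum 1 2)
    fix \<pi> assume "\<pi> \<in> {\<pi>. \<pi> permutes {1..k}}"
    then have \<pi>: "\<pi> permutes {1..k}" by simp
    have ge: "1 \<le> \<pi> i" if "i \<in> {1..k}" for i
      using permutes_in_image[OF \<pi>, of i] that by simp
    show "lim_at (\<Prod>i=1..l. ffact (X (\<pi> i)) (mu i)) c (\<Prod>i=1..l. ffact (of_nat (c (\<pi> i))) (mu i))"
      by (intro lim_at_prod lim_at_ffact_X ge) (use assms in auto)
    show "lim_at (\<Prod>(i, j)\<in>incr_pairs {l<..k}. pair_quot (\<pi> i) (\<pi> j)) c
        (\<Prod>(i, j)\<in>incr_pairs {l<..k}. pair_quot_val c (\<pi> i) (\<pi> j))"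
    proof (rule lim_at_prod)
      fix q assume q: "q \<in> incr_pairs {l<..k}"
      obtain i j where e: "q = (i, j)" by fastforce
      have "\<pi> i \<noteq> \<pi> j" using q e permutes_inj[OF \<pi>] by (auto simp: incr_pairs_def dest: injD)
      then show "lim_at (case q of (i, j) \<Rightarrow> pair_quot (\<pi> i) (\<pi> j)) c (case q of (i, j) \<Rightarrow> pair_quot_val c (\<pi> i) (\<pi> j))"
        using q ge[of i] ge[of j] by (auto simp: e incr_pairs_def intro!: lim_at_pair_quot)
    qed
  qed
qed

text \<open>
  Composition with the transposition of \<open>a\<close> and \<open>b\<close> reverses the sign of every summand and fixes its other
  factors. Nonzero coordinates are needed: the value of a quotient at two vanishing coordinates
  depends on their order.
\<close>

lemma phi_val_antisymmetric:
  assumes ab: "a \<in> {1..k}" "b \<in> {1..k}" "a \<noteq> b" and c: "c a = c b" "c a \<noteq> 0"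
  shows "phi_val k l mu c = 0"
proof -
  let ?\<tau> = "Transposition.transpose a b"
  have \<tau>: "?\<tau> permutes {1..k}" using ab by (intro permutes_swap_id)
  have c\<tau>: "c (?\<tau> x) = c x" for x using c by (simp add: transpose_def)
  have s\<tau>: "pair_quot_val c (?\<tau> x) (?\<tau> y) = pair_quot_val c x y" for x y
  proof (cases "c x = 0 \<and> c y = 0")
    case True
    then have "?\<tau> x = x" "?\<tau> y = y" using c by (auto simp: transpose_def)
    then show ?thesis by simp
  next
    case False
    then show ?thesis unfolding pair_quot_val_def c\<tau> by auto
  qed
  have "phi_term k l mu c (?\<tau> \<circ> \<pi>) = - phi_term k l mu c \<pi>" if "\<pi> permutes {1..k}" for \<pi>
  proof -
    have "permutation \<pi>" using that finite_atLeastAtMost permutation_permutes by blast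
    then have "sign (?\<tau> \<circ> \<pi>) = - sign \<pi>"
      using ab by (subst sign_compose) (auto simp: sign_swap_id permutation_swap_id)
    then show ?thesis by (simp add: phi_term_def c\<tau> s\<tau>)
  qed
  then have "(\<Sum>\<pi> | \<pi> permutes {1..k}. phi_term k l mu c (?\<tau> \<circ> \<pi>))
      = - (\<Sum>\<pi> | \<pi> permutes {1..k}. phi_term k l mu c \<pi>)"
    by (simp add: sum_negf)
  moreover have "(\<Sum>\<pi> | \<pi> permutes {1..k}. phi_term k l mu c \<pi>)
      = (\<Sum>\<pi> | \<pi> permutes {1..k}. phi_term k l mu c (?\<tau> \<circ> \<pi>))"
    using \<tau> by (rule setum_permutations_compose_left)
  ultimately show ?thesis by (simp add: phi_val_def)
qed

lemma le_card_antimono_iff: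
  fixes c :: "nat \<Rightarrow> nat"
  assumes "\<And>i j. 1 \<le> i \<Longrightarrow> i \<le> j \<Longrightarrow> j \<le> k \<Longrightarrow> c j \<le> c i" and i: "i \<in> {1..k}"
  shows "x \<le> c i \<longleftrightarrow> i \<le> card {j \<in> {1..k}. x \<le> c j}"
proof
  assume "x \<le> c i"
  then have "{1..i} \<subseteq> {j \<in> {1..k}. x \<le> c j}"
    using assms(1)[of _ i] i by (auto intro: order_trans)
  then show "i \<le> card {j \<in> {1..k}. x \<le> c j}"
    using card_mono[of "{j \<in> {1..k}. x \<le> c j}" "{1..i}"] by simp
next
  assume le: "i \<le> card {j \<in> {1..k}. x \<le> c j}"
  show "x \<le> c i"
  proof (rule ccontr)
    assume n: "\<not> x \<le> c i"
    have "{j \<in> {1..k}. x \<le> c j} \<subseteq> {1..<i}"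
    proof safe
      fix j assume j: "j \<in> {1..k}" "x \<le> c j"
      then have "\<not> i \<le> j" using assms(1)[of i j] i n by auto
      then show "j \<in> {1..<i}" using j by auto
    qed
    then have "card {j \<in> {1..k}. x \<le> c j} \<le> card {1..<i}" by (intro card_mono) auto
    moreover have "1 \<le> i" using i by simp
    ultimately show False using le by simp
  qed
qed

text \<open>
  A decreasing sequence is determined by the numbers of its entries above each threshold.
\<close>

lemma antimono_rearrangement_unique:
  fixes c d :: "nat \<Rightarrow> nat"
  assumes c: "\<And>i j. 1 \<le> i \<Longrightarrow> i \<le> j \<Longrightarrow> j \<le> k \<Longrightarrow> c j \<le> c i"
    and d: "\<And>i j. 1 \<le> i \<Longrightarrow> i \<le> j \<Longrightarrow> j \<le> k \<Longrightarrow> d j \<le> d i"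
    and \<pi>: "\<pi> permutes {1..k}" "\<And>i. i \<in> {1..k} \<Longrightarrow> c (\<pi> i) = d i" and i: "i \<in> {1..k}"
  shows "c i = d i"
proof -
  have "card {j \<in> {1..k}. x \<le> c j} = card {j \<in> {1..k}. x \<le> d j}" for x
  proof -
    have "{j \<in> {1..k}. x \<le> c j} = \<pi> ` {j \<in> {1..k}. x \<le> d j}"
    proof
      show "{j \<in> {1..k}. x \<le> c j} \<subseteq> \<pi> ` {j \<in> {1..k}. x \<le> d j}"
      proof
        fix j assume j: "j \<in> {j \<in> {1..k}. x \<le> c j}"
        then obtain i where "i \<in> {1..k}" "j = \<pi> i" using permutes_image[OF \<pi>(1)] by blast
        then show "j \<in> \<pi> ` {j \<in> {1..k}. x \<le> d j}" using j \<pi>(2) by auto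
      qed
      show "\<pi> ` {j \<in> {1..k}. x \<le> d j} \<subseteq> {j \<in> {1..k}. x \<le> c j}"
        using permutes_in_image[OF \<pi>(1)] \<pi>(2) by auto
    qed
    then show ?thesis using permutes_inj[OF \<pi>(1)] by (simp add: card_image inj_on_def inj_def)
  qed
  then have "x \<le> c i \<longleftrightarrow> x \<le> d i" for x
    using le_card_antimono_iff[of k c i x] le_card_antimono_iff[of k d i x] c d i by simp
  then show ?thesis by (meson order_antisym order_refl)
qed

text \<open>
  A nonzero summand has $c_{\pi i}\ge m_i$ for all $i$, and both sides have the same sum.
\<close>

lemma phi_term_nonzero_imp:
  assumes nz: "phi_term k l mu c \<pi> \<noteq> 0" and \<pi>: "\<pi> permutes {1..k}" and l: "l \<le> k"
    and sum: "(\<Sum>i=1..k. c i) = (\<Sum>i=1..l. mu i)" and mu0: "\<And>i. i \<in> {l<..k} \<Longrightarrow> mu i = 0"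
    and i: "i \<in> {1..k}"
  shows "c (\<pi> i) = mu i"
proof -
  have "ffact (of_nat (c (\<pi> i)) :: real) (mu i) \<noteq> 0" if "i \<in> {1..l}" for i
    using nz that by (auto simp: phi_term_def)
  then have le: "mu i \<le> c (\<pi> i)" if "i \<in> {1..k}" for i
    using that ffact_of_nat_less[of "c (\<pi> i)" "mu i", where 'a = real] mu0[of i]
    by (cases "i \<le> l") (force simp: not_less[symmetric])+
  have "(\<Sum>i=1..k. c (\<pi> i)) = (\<Sum>i=1..k. c i)" using sum.permute[OF \<pi>, of c] by (simp add: comp_def)
  also have "\<dots> = (\<Sum>i=1..k. mu i)"
    unfolding sum using l mu0 by (intro sum.mono_neutral_left) auto
  finally have eq: "(\<Sum>i=1..k. c (\<pi> i)) = (\<Sum>i=1..k. mu i)" .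
  show ?thesis
  proof (rule ccontr)
    assume "c (\<pi> i) \<noteq> mu i"
    then have "(\<Sum>i=1..k. mu i) < (\<Sum>i=1..k. c (\<pi> i))"
      using le i by (intro sum_strict_mono_ex1) (auto intro!: bexI[of _ i] simp: order.strict_iff_order)
    then show False using eq by simp
  qed
qed

text \<open>
  A nonzero summand makes \<open>c\<close> a rearrangement of \<open>mu\<close>, and since both decrease they are equal. In that
  case the surviving permutations move only the vanishing coordinates; the quotients then give the
  sign of the permutation once more, so each of the $(k-\ell)!$ summands is positive.
\<close>

lemma phi_val_base:
  assumes l: "l \<le> k"
    and dec: "\<And>i j. 1 \<le> i \<Longrightarrow> i < j \<Longrightarrow> j \<le> l \<Longrightarrow> mu j < mu i"
    and pos: "\<And>i. i \<in> {1..l} \<Longrightarrow> 0 < mu i" and mu0: "\<And>i. i \<in> {l<..k} \<Longrightarrow> mu i = 0"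
    and c: "\<And>i j. 1 \<le> i \<Longrightarrow> i \<le> j \<Longrightarrow> j \<le> k \<Longrightarrow> c j \<le> c i"
    and sum: "(\<Sum>i=1..k. c i) = (\<Sum>i=1..l. mu i)"
  shows "phi_val k l mu c = (if \<forall>i\<in>{1..k}. c i = mu i then \<Prod>i=1..k. fact (mu i) else 0)"
proof (cases "\<forall>i\<in>{1..k}. c i = mu i")
  case False
  have mu: "mu j \<le> mu i" if "1 \<le> i" "i \<le> j" "j \<le> k" for i j
    using dec[of i j] mu0[of j] that by (cases "j \<le> l"; cases "i = j") auto
  have "phi_term k l mu c \<pi> = 0" if \<pi>: "\<pi> permutes {1..k}" for \<pi>
  proof (rule ccontr)
    assume "phi_term k l mu c \<pi> \<noteq> 0"
    then have "c (\<pi> i) = mu i" if "i \<in> {1..k}" for i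
      using phi_term_nonzero_imp[OF _ \<pi> l sum mu0 that] by blast
    then have "c i = mu i" if "i \<in> {1..k}" for i
      using antimono_rearrangement_unique[of k c mu \<pi> i, OF c mu \<pi>] that by blast
    then show False using False by blast
  qed
  then show ?thesis using False by (simp add: phi_val_def)
next
  case True
  have "{\<pi>. \<pi> permutes {l<..k}} \<subseteq> {\<pi>. \<pi> permutes {1..k}}" by (auto intro: permutes_subset)
  moreover have "phi_term k l mu c \<pi> = 0" if "\<pi> permutes {1..k}" "\<not> \<pi> permutes {l<..k}" for \<pi>
  proof (rule ccontr)
    assume nz: "phi_term k l mu c \<pi> \<noteq> 0"
    have "\<pi> i = i" if i: "i \<in> {1..l}" for i
    proof -
      have ik: "i \<in> {1..k}" using i l by auto
      have \<pi>i: "\<pi> i \<in> {1..k}" using permutes_in_image[OF \<open>\<pi> permutes {1..k}\<close>] ik by blast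
      have eq: "mu (\<pi> i) = mu i"
        using phi_term_nonzero_imp[OF nz \<open>\<pi> permutes {1..k}\<close> l sum mu0 ik] True \<pi>i by simp
      then have "\<pi> i \<le> l" using pos[OF i] mu0[of "\<pi> i"] \<pi>i by (cases "\<pi> i \<le> l") auto
      then show ?thesis using dec[of i "\<pi> i"] dec[of "\<pi> i" i] eq i \<pi>i
        by (cases i "\<pi> i" rule: linorder_cases) auto
    qed
    then have "\<pi> i = i" if "i \<notin> {l<..k}" for i
      using that permutes_not_in[OF \<open>\<pi> permutes {1..k}\<close>, of i] by (cases "i \<in> {1..l}") auto
    then have "\<pi> permutes {l<..k}"
      using \<open>\<pi> permutes {1..k}\<close> by (auto simp: permutes_def)
    then show False using that by simp
  qed
  ultimately have "(\<Sum>\<pi> | \<pi> permutes {1..k}. phi_term k l mu c \<pi>) = (\<Sum>\<pi> | \<pi> permutes {l<..k}. phi_term k l mu c \<pi>)"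
    by (intro sum.mono_neutral_right finite_permutations) auto
  also have "\<dots> = (\<Sum>\<pi> | \<pi> permutes {l<..k}. \<Prod>i=1..k. fact (mu i))"
  proof (rule sum.cong)
    fix \<pi> assume "\<pi> \<in> {\<pi>. \<pi> permutes {l<..k}}"
    then have \<pi>: "\<pi> permutes {l<..k}" by simp
    have "(\<Prod>i=1..l. ffact (real (c (\<pi> i))) (mu i)) = (\<Prod>i=1..l. fact (mu i))"
    proof (rule prod.cong)
      fix i assume i: "i \<in> {1..l}"
      then have "c (\<pi> i) = mu i" using permutes_not_in[OF \<pi>, of i] True l by simp
      then show "ffact (real (c (\<pi> i))) (mu i) = fact (mu i)" by (simp add: ffact_of_nat_self)
    qed simp
    also have "\<dots> = (\<Prod>i=1..k. fact (mu i))"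
      using l mu0 by (intro prod.mono_neutral_left) auto
    finally have 1: "(\<Prod>i=1..l. ffact (real (c (\<pi> i))) (mu i)) = (\<Prod>i=1..k. fact (mu i))" .
    have "(\<Prod>(i, j)\<in>incr_pairs {l<..k}. pair_quot_val c (\<pi> i) (\<pi> j)) = inv_sign \<pi> {l<..k}"
      unfolding inv_sign_def
    proof (rule prod.cong)
      fix q assume q: "q \<in> incr_pairs {l<..k}"
      obtain i j where e: "q = (i, j)" by fastforce
      have "\<pi> i \<in> {l<..k}" "\<pi> j \<in> {l<..k}" using q permutes_in_image[OF \<pi>] by (auto simp: e incr_pairs_def)
      then have "c (\<pi> i) = 0" "c (\<pi> j) = 0" using True mu0 by auto
      then show "(case q of (i, j) \<Rightarrow> pair_quot_val c (\<pi> i) (\<pi> j)) = (case q of (i, j) \<Rightarrow> ord_sign (\<pi> i) (\<pi> j))"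
        by (simp add: e pair_quot_val_def ord_sign_def)
    qed simp
    also have "\<dots> = of_int (sign \<pi>)" using \<pi> by (rule inv_sign_eq_sign) simp
    finally show "phi_term k l mu c \<pi> = (\<Prod>i=1..k. fact (mu i))"
      unfolding phi_term_def 1 by (simp add: mult.left_commute flip: of_int_mult)
  qed simp
  also have "\<dots> = fact (k - l) * (\<Prod>i=1..k. fact (mu i))"
    by (simp add: card_permutations[of "{l<..k}" "k - l"])
  finally show ?thesis using True by (simp add: phi_val_def)
qed

section \<open>Counting paths in the graph of strict partitions\<close>

lemma sum_fun_upd:
  "finite A \<Longrightarrow> i \<in> A \<Longrightarrow> (\<Sum>j\<in>A. (x(i := y)) j) = y + (\<Sum>j\<in>A - {i}. x j)"
  by (subst sum.remove[of A i]) (auto intro: sum.cong)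

abbreviation (input) intvec :: "(nat \<Rightarrow> nat) \<Rightarrow> nat \<Rightarrow> int" where
  "intvec u \<equiv> (\<lambda>i. int (u i))"

lemma intvec_eq_iff: "intvec u = intvec w \<longleftrightarrow> u = w"
  by (auto simp: fun_eq_iff)

lemma intvec_SYgraph_iff:
  "intvec u \<in> verts (SYgraph k) \<longleftrightarrow> (\<forall>i. i \<notin> {1..k} \<longrightarrow> u i = 0) \<and> (\<forall>i\<in>{1..<k}. u (Suc i) \<le> u i) \<and>
     (\<forall>i\<in>{1..k}. \<forall>j\<in>{1..k}. i \<noteq> j \<and> u i = u j \<longrightarrow> u i = 0)"
  by (simp add: SYgraph_def Zvecs_def)

lemma vertex_outside: "intvec u \<in> verts (SYgraph k) \<Longrightarrow> i \<notin> {1..k} \<Longrightarrow> u i = 0"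
  unfolding intvec_SYgraph_iff by blast

lemma vertex_strict:
  "intvec u \<in> verts (SYgraph k) \<Longrightarrow> i \<in> {1..k} \<Longrightarrow> j \<in> {1..k} \<Longrightarrow> i \<noteq> j \<Longrightarrow> u i = u j \<Longrightarrow> u i = 0"
  unfolding intvec_SYgraph_iff by blast

lemma vertex_antimono:
  assumes "intvec u \<in> verts (SYgraph k)" "1 \<le> i" "i \<le> j" "j \<le> k"
  shows "u j \<le> u i"
  using assms(3,4)
proof (induction j rule: dec_induct)
  case (step j)
  then have "u (Suc j) \<le> u j" using assms(1,2) unfolding intvec_SYgraph_iff by auto
  then show ?case using step by simp
qed simp

lemma vertex_nonneg:
  assumes "w \<in> verts (SYgraph k)"
  obtains u where "w = intvec u"
proof
  have "0 \<le> w i" for i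
    using assms by (cases "i \<in> {1..k}") (auto simp: SYgraph_def Zvecs_def)
  then show "w = intvec (\<lambda>i. nat (w i))" by auto
qed

lemma SYgraph_arc_iff:
  "e \<in> arcs (SYgraph k) \<longleftrightarrow> (\<exists>w i. e = (w, w(i := w i + 1)) \<and> i \<in> {1..k} \<and>
     w \<in> verts (SYgraph k) \<and> w(i := w i + 1) \<in> verts (SYgraph k))"
proof -
  have "verts (SYgraph k) \<subseteq> Zvecs k" by (auto simp: SYgraph_def)
  moreover have "arcs (SYgraph k) =
      {e \<in> arcs (Zgraph k). fst e \<in> verts (SYgraph k) \<and> snd e \<in> verts (SYgraph k)}"
    by (simp add: SYgraph_def Zgraph_def)
  moreover have "e \<in> arcs (Zgraph k) \<longleftrightarrow> (\<exists>w i. e = (w, w(i := w i + 1)) \<and> w \<in> Zvecs k \<and> i \<in> {1..k})"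
    by (simp add: Zgraph_def)
  ultimately show ?thesis by fastforce
qed

lemma SYgraph_tail_head [simp]: "tail (SYgraph k) = fst" "head (SYgraph k) = snd"
  by (simp_all add: SYgraph_def Zgraph_def)

lemma wf_SYgraph: "wf_digraph (SYgraph k)"
  by unfold_locales (auto simp: SYgraph_arc_iff)

context
  fixes k :: nat
begin

interpretation wf_digraph "SYgraph k" by (rule wf_SYgraph)

text \<open>
  Each arc raises the coordinate sum by one, so no vertex is visited twice.
\<close>

lemma awalk_weight:
  assumes "awalk x p y"
  shows "(\<Sum>i=1..k. y i) = (\<Sum>i=1..k. x i) + int (length p)" "distinct (awalk_verts x p)"
    and "\<And>z. z \<in> set (awalk_verts x p) \<Longrightarrow> (\<Sum>i=1..k. x i) \<le> (\<Sum>i=1..k. z i)"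
proof -
  have "(\<Sum>i=1..k. y i) = (\<Sum>i=1..k. x i) + int (length p) \<and> distinct (awalk_verts x p) \<and>
    (\<forall>z\<in>set (awalk_verts x p). (\<Sum>i=1..k. x i) \<le> (\<Sum>i=1..k. z i))"
    using assms
  proof (induction p arbitrary: x)
    case Nil
    then show ?case by (simp add: awalk_Nil_iff)
  next
    case (Cons e p)
    then have e: "e \<in> arcs (SYgraph k)" "fst e = x" "awalk (snd e) p y"
      by (auto simp: awalk_Cons_iff)
    then obtain i where i: "i \<in> {1..k}" "snd e = x(i := x i + 1)"
      by (auto simp: SYgraph_arc_iff)
    have "(\<Sum>j=1..k. snd e j) = (\<Sum>j=1..k. x j) + 1"
      unfolding i(2) sum_fun_upd[OF finite_atLeastAtMost i(1)] sum.remove[OF finite_atLeastAtMost i(1)] by simp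
    then show ?case using Cons.IH[OF e(3)] e(2) by fastforce
  qed
  then show "(\<Sum>i=1..k. y i) = (\<Sum>i=1..k. x i) + int (length p)" "distinct (awalk_verts x p)"
    "\<And>z. z \<in> set (awalk_verts x p) \<Longrightarrow> (\<Sum>i=1..k. x i) \<le> (\<Sum>i=1..k. z i)" by blast+
qed

lemma apath_iff_awalk: "apath x p y \<longleftrightarrow> awalk x p y"
  using awalk_weight(2) by (auto simp: apath_def)

lemma paths_by_last_arc:
  assumes u: "intvec u \<in> verts (SYgraph k)" and neq: "v \<noteq> intvec u"
  shows "{p. apath v p (intvec u)} =
    (\<Union>i\<in>{i \<in> {1..k}. 0 < u i \<and> intvec (u(i := u i - 1)) \<in> verts (SYgraph k)}.
      (\<lambda>p. p @ [(intvec (u(i := u i - 1)), intvec u)]) ` {p. apath v p (intvec (u(i := u i - 1)))})"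
    (is "?L = ?R")
proof
  show "?L \<subseteq> ?R"
  proof
    fix p assume "p \<in> ?L"
    then have p: "awalk v p (intvec u)" by (simp add: apath_iff_awalk)
    then have "p \<noteq> []" using neq by (auto simp: awalk_Nil_iff)
    then obtain q e where q: "p = q @ [e]" by (metis rev_exhaust)
    define w where "w = fst e"
    have qe: "awalk v q w" "awalk w [e] (intvec u)"
      using p unfolding q awalk_append_iff by (auto simp: awalk_Cons_iff w_def)
    then have e: "e \<in> arcs (SYgraph k)" "snd e = intvec u" by (auto simp: awalk_Cons_iff awalk_Nil_iff)
    then obtain i where i: "i \<in> {1..k}" "intvec u = w(i := w i + 1)" "w \<in> verts (SYgraph k)"
      by (auto simp: SYgraph_arc_iff w_def)
    obtain u' where u': "w = intvec u'" using i(3) by (rule vertex_nonneg)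
    have "intvec u = intvec (u'(i := Suc (u' i)))" using i(2) by (auto simp: u' fun_eq_iff)
    then have uu': "u = u'(i := Suc (u' i))" by (simp only: intvec_eq_iff)
    then have "u' = u(i := u i - 1)" "0 < u i" by auto
    moreover have "e = (intvec u', intvec u)" using e(2) u' w_def by (metis prod.collapse)
    ultimately show "p \<in> ?R" using i qe(1) u' q by (auto simp: apath_iff_awalk)
  qed
  show "?R \<subseteq> ?L"
  proof
    fix p assume "p \<in> ?R"
    then obtain i q where i: "i \<in> {1..k}" "0 < u i" "intvec (u(i := u i - 1)) \<in> verts (SYgraph k)"
      "awalk v q (intvec (u(i := u i - 1)))" "p = q @ [(intvec (u(i := u i - 1)), intvec u)]"
      by (auto simp: apath_iff_awalk)
    let ?w = "intvec (u(i := u i - 1))"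
    have "intvec u = ?w(i := ?w i + 1)" using i(2) by (auto simp: fun_eq_iff)
    then have "(?w, intvec u) \<in> arcs (SYgraph k)"
      unfolding SYgraph_arc_iff using i(1,3) u by (intro exI[of _ ?w] exI[of _ i]) auto
    then have "awalk ?w [(?w, intvec u)] (intvec u)" using i(3) u by (simp add: awalk_Cons_iff awalk_Nil_iff)
    then have "awalk v p (intvec u)" unfolding i(5) using i(4) by (rule awalk_appendI[rotated])
    then show "p \<in> ?L" by (simp add: apath_iff_awalk)
  qed
qed

lemma num_paths_recursion:
  assumes u: "intvec u \<in> verts (SYgraph k)" and neq: "v \<noteq> intvec u"
    and fin: "\<And>i. i \<in> {1..k} \<Longrightarrow> 0 < u i \<Longrightarrow> intvec (u(i := u i - 1)) \<in> verts (SYgraph k) \<Longrightarrow>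
      finite {p. apath v p (intvec (u(i := u i - 1)))}"
  shows "finite {p. apath v p (intvec u)}"
    and "num_paths (SYgraph k) v (intvec u) =
      (\<Sum>i | i \<in> {1..k} \<and> 0 < u i \<and> intvec (u(i := u i - 1)) \<in> verts (SYgraph k).
         num_paths (SYgraph k) v (intvec (u(i := u i - 1))))"
proof -
  let ?I = "{i \<in> {1..k}. 0 < u i \<and> intvec (u(i := u i - 1)) \<in> verts (SYgraph k)}"
  let ?w = "\<lambda>i. intvec (u(i := u i - 1))"
  let ?F = "\<lambda>i. (\<lambda>p. p @ [(?w i, intvec u)]) ` {p. apath v p (?w i)}"
  show "finite {p. apath v p (intvec u)}"
    unfolding paths_by_last_arc[OF u neq] using fin by (intro finite_UN_I finite_imageI) auto
  have dis: "?F i \<inter> ?F j = {}" if "i \<in> ?I" "j \<in> ?I" "i \<noteq> j" for i j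
  proof -
    have "?w i i \<noteq> ?w j i" using that by auto
    then have "?w i \<noteq> ?w j" by metis
    then show ?thesis by auto
  qed
  have "num_paths (SYgraph k) v (intvec u) = card (\<Union>i\<in>?I. ?F i)"
    unfolding num_paths_def paths_by_last_arc[OF u neq] ..
  also have "\<dots> = (\<Sum>i\<in>?I. card (?F i))"
    using fin dis by (intro card_UN_disjoint) auto
  also have "\<dots> = (\<Sum>i\<in>?I. num_paths (SYgraph k) v (?w i))"
    unfolding num_paths_def by (intro sum.cong card_image) (auto simp: inj_on_def)
  finally show "num_paths (SYgraph k) v (intvec u) = (\<Sum>i\<in>?I. num_paths (SYgraph k) v (?w i))" .
qed

lemma paths_weight_le:
  assumes "(\<Sum>i=1..k. u i) \<le> (\<Sum>i=1..k. v i)" "intvec v \<in> verts (SYgraph k)"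
  shows "{p. apath (intvec v) p (intvec u)} = (if u = v then {[]} else {})"
proof -
  have "p = []" if "awalk (intvec v) p (intvec u)" for p
  proof -
    have "int (\<Sum>i=1..k. u i) = int (\<Sum>i=1..k. v i) + int (length p)"
      using awalk_weight(1)[OF that] by simp
    then have "(\<Sum>i=1..k. u i) = (\<Sum>i=1..k. v i) + length p"
      by (simp only: of_nat_add[symmetric] of_nat_eq_iff)
    then show ?thesis using assms(1) by simp
  qed
  then have "{p. apath (intvec v) p (intvec u)} = {p. p = [] \<and> awalk (intvec v) p (intvec u)}"
    unfolding apath_iff_awalk by blast
  also have "\<dots> = (if u = v then {[]} else {})"
    using assms(2) by (auto simp: awalk_Nil_iff intvec_eq_iff)
  finally show ?thesis .
qed

text \<open>
  Induction on the coordinate sum of \<open>u\<close>. Above the level of \<open>mu\<close> both sides satisfy the recursion by the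
  last step; on and below that level they are computed directly.
\<close>

lemma num_paths_formula:
  fixes mu :: "nat \<Rightarrow> nat"
  assumes l: "l \<le> k" and v: "intvec mu \<in> verts (SYgraph k)"
    and dec: "\<forall>i\<in>{1..<l}. mu (Suc i) < mu i" and pos: "\<forall>i\<in>{1..l}. 0 < mu i"
    and mu0: "\<forall>i\<in>{l<..k}. mu i = 0" and m: "m = (\<Sum>i=1..k. mu i)"
    and h: "has_value_fun {1..k} m (phi k l mu) (phi_val k l mu)"
    and u: "intvec u \<in> verts (SYgraph k)"
  shows "finite {p. apath (intvec mu) p (intvec u)} \<and>
    real (num_paths (SYgraph k) (intvec mu) (intvec u)) =
      fact ((\<Sum>i=1..k. u i) - m) / (\<Prod>i=1..k. fact (u i)) * phi_val k l mu u"
  using u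
proof (induction "\<Sum>i=1..k. u i" arbitrary: u rule: less_induct)
  case less
  note u = less.prems
  let ?s = "\<Sum>i=1..k. u i"
  have ml: "m = (\<Sum>i=1..l. mu i)"
    unfolding m using l mu0 by (intro sum.mono_neutral_right) auto
  consider "?s < m" | "?s = m" | "m < ?s" by linarith
  then show ?case
  proof cases
    case 1
    have "u \<noteq> mu" using 1 m by auto
    then have "{p. apath (intvec mu) p (intvec u)} = {}"
      using paths_weight_le[of u mu] v 1 m by simp
    moreover have "phi_val k l mu u = 0" using has_value_funD(3)[OF h] 1 by simp
    ultimately show ?thesis by (simp add: num_paths_def)
  next
    case 2
    have eq: "(\<forall>i\<in>{1..k}. u i = mu i) \<longleftrightarrow> u = mu"
      using vertex_outside[OF u] vertex_outside[OF v] by (auto simp: fun_eq_iff)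
    have dec': "mu j < mu i" if "1 \<le> i" "i < j" "j \<le> l" for i j
    proof -
      have "mu j \<le> mu i" using vertex_antimono[OF v] that l by auto
      moreover have "mu j \<noteq> mu i" using vertex_strict[OF v, of i j] pos that l by force
      ultimately show ?thesis by simp
    qed
    have "phi_val k l mu u = (if u = mu then \<Prod>i=1..k. fact (mu i) else 0)"
      unfolding eq[symmetric]
      by (rule phi_val_base[OF l]) (use dec' pos mu0 vertex_antimono[OF u] 2 ml in auto)
    moreover have "{p. apath (intvec mu) p (intvec u)} = (if u = mu then {[]} else {})"
      using paths_weight_le[of u mu] v 2 m by simp
    ultimately show ?thesis using 2 by (simp add: num_paths_def)
  next
    case 3
    let ?w = "\<lambda>i. u(i := u i - 1)"
    let ?I = "{i \<in> {1..k}. 0 < u i \<and> intvec (?w i) \<in> verts (SYgraph k)}"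
    have neq: "intvec mu \<noteq> intvec u" using 3 m by (auto simp: intvec_eq_iff)
    have sw: "Suc (\<Sum>j=1..k. ?w i j) = ?s" if "i \<in> {1..k}" "0 < u i" for i
      unfolding sum_fun_upd[OF finite_atLeastAtMost that(1)] sum.remove[OF finite_atLeastAtMost that(1), of u]
      using that(2) by simp
    have IH: "finite {p. apath (intvec mu) p (intvec (?w i))} \<and>
      real (num_paths (SYgraph k) (intvec mu) (intvec (?w i))) =
      fact (?s - 1 - m) / (\<Prod>j=1..k. fact (?w i j)) * phi_val k l mu (?w i)" if "i \<in> ?I" for i
    proof -
      have "(\<Sum>j=1..k. ?w i j) = ?s - 1" "(\<Sum>j=1..k. ?w i j) < ?s" using sw[of i] that by auto
      then show ?thesis using less.hyps[of "?w i"] that by simp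
    qed
    \<comment> \<open>A step back that leaves the graph creates two equal nonzero coordinates, unless $u_i=0$.\<close>
    have rest: "real (u i) * phi_val k l mu (?w i) = 0" if i: "i \<in> {1..k} - ?I" for i
    proof (cases "u i = 0")
      case False
      then have nv: "intvec (?w i) \<notin> verts (SYgraph k)" using i by auto
      have suc: "?w i (Suc j) \<le> ?w i j" if j: "j \<in> {1..<k}" for j
      proof (cases "j = i")
        case True
        have "u (Suc i) \<le> u i" using vertex_antimono[OF u, of i "Suc i"] j True by auto
        moreover have "u (Suc i) \<noteq> u i"
          using vertex_strict[OF u, of i "Suc i"] False j True by auto
        ultimately show ?thesis using True by simp
      next
        case False
        then show ?thesis using vertex_antimono[OF u, of j "Suc j"] j by auto
      qed
      have out: "?w i j = 0" if "j \<notin> {1..k}" for j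
        using vertex_outside[OF u that] i that by auto
      obtain a b where "a \<in> {1..k}" "b \<in> {1..k}" "a \<noteq> b" "?w i a = ?w i b" "?w i a \<noteq> 0"
        using nv suc out unfolding intvec_SYgraph_iff by blast
      then have "phi_val k l mu (?w i) = 0" by (rule phi_val_antisymmetric)
      then show ?thesis by simp
    qed simp
    have rec: "(\<Sum>i=1..k. real (u i) * phi_val k l mu (?w i)) = (real ?s - real m) * phi_val k l mu u"
    proof (rule has_value_funD(5)[OF h])
      fix a b assume "a \<in> {1..k}" "b \<in> {1..k}" "a < b" "u a = 0"
      then show "u b = 0" using vertex_antimono[OF u, of a b] by simp
    qed
    let ?P = "\<Prod>i=1..k. fact (u i) :: real"
    have step: "1 / (\<Prod>j=1..k. fact (?w i j)) = real (u i) / ?P" if i: "i \<in> ?I" for i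
    proof -
      have "?P = fact (u i) * (\<Prod>j\<in>{1..k} - {i}. fact (u j))"
        using i by (intro prod.remove) auto
      moreover have "(\<Prod>j=1..k. fact (?w i j) :: real) = fact (u i - 1) * (\<Prod>j\<in>{1..k} - {i}. fact (u j))"
        using i by (subst prod.remove[of _ i]) auto
      moreover have "fact (u i) = real (u i) * fact (u i - 1)" using i by (intro fact_reduce) auto
      ultimately show ?thesis using i by simp
    qed
    note R = num_paths_recursion[OF u neq, OF IH[THEN conjunct1]]
    have "real (num_paths (SYgraph k) (intvec mu) (intvec u))
        = (\<Sum>i\<in>?I. fact (?s - 1 - m) / (\<Prod>j=1..k. fact (?w i j)) * phi_val k l mu (?w i))"
      using R(2) IH by simp
    also have "\<dots> = (\<Sum>i\<in>?I. fact (?s - 1 - m) / ?P * (real (u i) * phi_val k l mu (?w i)))"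
    proof (rule sum.cong)
      fix i assume "i \<in> ?I"
      then have "fact (?s - 1 - m) * (1 / (\<Prod>j=1..k. fact (?w i j))) * phi_val k l mu (?w i)
          = fact (?s - 1 - m) * (real (u i) / ?P) * phi_val k l mu (?w i)" using step by simp
      then show "fact (?s - 1 - m) / (\<Prod>j=1..k. fact (?w i j)) * phi_val k l mu (?w i)
          = fact (?s - 1 - m) / ?P * (real (u i) * phi_val k l mu (?w i))" by simp
    qed simp
    also have "\<dots> = fact (?s - 1 - m) / ?P * (\<Sum>i\<in>?I. real (u i) * phi_val k l mu (?w i))"
      by (simp only: sum_distrib_left)
    also have "(\<Sum>i\<in>?I. real (u i) * phi_val k l mu (?w i)) = (\<Sum>i=1..k. real (u i) * phi_val k l mu (?w i))"
      using rest by (intro sum.mono_neutral_left) auto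
    also have "\<dots> = real (?s - m) * phi_val k l mu u" unfolding rec using 3 by (simp add: of_nat_diff)
    also have "fact (?s - 1 - m) / ?P * (real (?s - m) * phi_val k l mu u)
        = (real (?s - m) * fact (?s - m - 1)) / ?P * phi_val k l mu u"
      by (simp add: diff_commute)
    also have "real (?s - m) * fact (?s - m - 1) = fact (?s - m)"
      using 3 by (intro fact_reduce[symmetric]) simp
    finally show ?thesis using R(1) by blast
  qed
qed

end

section \<open>Components of g and the number of paths\<close>

theorem theorem7:
  fixes k l m n :: nat and mu nu :: "nat \<Rightarrow> nat" and g :: ratfun
  assumes "k \<ge> 1"
    and "l \<le> k"
    and v_vertex: "(\<lambda>i. int (mu i)) \<in> verts (SYgraph k)"
    and "\<forall>i\<in>{1..<l}. mu (Suc i) < mu i"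
    and "\<forall>i\<in>{1..l}. 0 < mu i"
    and "\<forall>i\<in>{l<..k}. mu i = 0"
    and u_vertex: "(\<lambda>i. int (nu i)) \<in> verts (SYgraph k)"
    and "\<forall>i\<in>{1..k}. mu i \<le> nu i"
    and m_def: "m = (\<Sum>i=1..k. mu i)"
    and n_def: "n = (\<Sum>i=1..k. nu i)"
    and g_def: "g = phi k l mu * ffact ((\<Sum>i=1..k. X i) - of_nat m) (n - m)"
  shows "(\<forall>t\<in>Delta k n. has_value k (antipoly_part k g) (\<lambda>i. of_int (t i)) 0) \<and>
    poly_part k g =
      (\<Sum>c\<in>compositions k n.
        Const (of_nat (fact (n - m)) / of_nat (\<Prod>i=1..k. fact (c i)) *
               value_at k (phi k l mu) (\<lambda>i. of_nat (c i))) *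
        (\<Prod>i=1..k. ffact (Var i) (c i))) \<and>
    rat_of_nat (num_paths (SYgraph k) (\<lambda>i. int (mu i)) (\<lambda>i. int (nu i))) =
      of_nat (fact (n - m)) / of_nat (\<Prod>i=1..k. fact (nu i)) *
      value_at k (phi k l mu) (\<lambda>i. of_nat (nu i))"
proof -
  let ?S = "{1..k}"
  have mu0: "mu i = 0" if "i \<in> {l<..k}" for i using assms(6) that by blast
  have ml: "m = (\<Sum>i=1..l. mu i)"
    unfolding m_def using assms(2) mu0 by (intro sum.mono_neutral_right) auto
  have mn: "m \<le> n" unfolding m_def n_def using assms(8) by (intro sum_mono) auto
  have phi: "pfaffian_span ?S m (phi k l mu)" unfolding ml by (rule pfaffian_span_phi[OF assms(2)])
  have g: "pfaffian_span ?S n g" using pfaffian_span_ffact[OF phi, of "n - m"] mn by (simp add: g_def)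
  have S: "?S \<subseteq> {1..k}" "0 \<notin> ?S" by auto
  obtain P where P: "is_poly_component k ?S n g P" using pfaffian_span_poly_component[OF g S(1)] by blast
  have PS: "ffact_span ?S n P" using P by (simp add: is_poly_component_def)
  have Pk: "P \<in> polys k" unfolding polys_eq_poly_vars using PS by (rule ffact_span_vars)
  have part: "poly_part k g = P"
    using P by (intro poly_part_eqI[OF Pk]) (simp add: is_poly_component_def)
  obtain h where h: "has_value_fun ?S m (phi k l mu) h" using pfaffian_span_has_value_fun[OF phi S(2)] by blast
  have "h = phi_val k l mu"
    using lim_at_unique[OF has_value_funD(1)[OF h] lim_at_phi[OF assms(2)]] by blast
  note h = h[unfolded this]
  have val: "of_rat (value_at k (phi k l mu) (\<lambda>i. of_nat (c i))) = phi_val k l mu c" for c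
  proof -
    obtain y where y: "phi_val k l mu c = of_rat y"
      using has_value_funD(2)[OF h, of c] by (auto elim: Rats_cases)
    have "has_value k (phi k l mu) (\<lambda>i. of_nat (c i)) y"
      using pfaffian_span_Mclass[OF phi S(1)] has_value_funD(1)[OF h, of c] unfolding y by (rule has_value_lim_at)
    then show ?thesis using y by (simp add: value_at_eq)
  qed
  have anti: "has_value k (antipoly_part k g) (\<lambda>i. of_int (t i)) 0" if t: "t \<in> Delta k n" for t
  proof -
    define c where "c i = nat (t i)" for i
    have ti: "t i = int (c i)" for i using t by (cases "i \<in> {1..k}") (auto simp: Delta_def Zvecs_def c_def)
    have "int (sum c ?S) \<le> int n" using t by (simp add: Delta_def ti)
    then have cn: "sum c ?S \<le> n" by (simp only: of_nat_le_iff)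
    obtain h' where h': "has_value_fun ?S n g h'" using pfaffian_span_has_value_fun[OF g S(2)] by blast
    have eq: "h' c = nat_eval c P"
      using P has_value_funD(1)[OF h', of c] cn by (simp add: is_poly_component_def)
    have mP: "- P \<in> poly_vars ?S"
      using poly_vars_diff[OF poly_vars_0 ffact_span_vars[OF PS]] by simp
    have split: "antipoly_part k g = g + rf (- P)" by (simp add: antipoly_part_def part rf_minus)
    have "rf (- P) \<in> Mclass k"
      using laurent_fraction(1)[of "- P" k "{}"] mP by (simp add: polys_eq_poly_vars den_on_def)
    then have "antipoly_part k g \<in> Mclass k"
      unfolding split using pfaffian_span_Mclass[OF g S(1)] by (intro Mclass_add)
    moreover have "lim_at (antipoly_part k g) c (of_rat 0)"
      using lim_at_add[OF has_value_funD(1)[OF h', of c] lim_at_poly[OF mP S(2), of c]]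
      by (simp add: split eq poly_eval_minus)
    ultimately have "has_value k (antipoly_part k g) (\<lambda>i. of_nat (c i)) 0" by (rule has_value_lim_at)
    then show ?thesis by (simp add: ti)
  qed
  let ?v = "\<lambda>c. value_at k (phi k l mu) (\<lambda>i. of_nat (c i))"
  have comp: "compositions k n = comps ?S n" by (simp add: compositions_def comps_def)
  have Pv: "nat_eval c P = of_rat (of_nat (fact (n - m)) * ?v c)" if c: "c \<in> comps ?S n" for c
  proof -
    \<comment> \<open>At a point of coordinate sum \<open>n\<close> the second factor of \<open>g\<close> is $(n-m)^{\underline{n-m}}=(n-m)!$.\<close>
    have ev: "lim_at (ffact ((\<Sum>i=1..k. X i) - of_nat m) (n - m)) c (fact (n - m))"
    proof -
      let ?q = "ffact ((\<Sum>i=1..k. Var i) - of_nat m) (n - m)"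
      have "lim_at (rf ?q) c (nat_eval c ?q)"
        by (rule lim_at_poly[OF _ S(2)])
           (intro poly_vars_ffact poly_vars_diff poly_vars_of_nat poly_vars_sum poly_vars_Var)
      moreover have "nat_eval c ?q = ffact (of_nat (n - m)) (n - m)"
      proof -
        have "(\<Sum>i=1..k. real (c i)) = real n" using c by (simp add: comps_def flip: of_nat_sum)
        then show ?thesis using mn by (simp add: poly_eval_simps of_nat_diff)
      qed
      ultimately show ?thesis by (simp add: rf_simps ffact_of_nat_self)
    qed
    have "lim_at g c (phi_val k l mu c * fact (n - m))"
      unfolding g_def by (intro lim_at_mult has_value_funD(1)[OF h] ev)
    then have "phi_val k l mu c * fact (n - m) = nat_eval c P"
      using P c by (simp add: is_poly_component_def comps_def)
    then show ?thesis using val[of c] by (simp add: of_rat_mult of_rat_fact mult.commute)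
  qed
  have expansion: "poly_part k g = (\<Sum>c\<in>compositions k n.
        Const (of_nat (fact (n - m)) / of_nat (\<Prod>i=1..k. fact (c i)) * ?v c) *
        (\<Prod>i=1..k. ffact (Var i) (c i)))"
    unfolding part comp using ffact_span_coefficients[OF PS Pv]
    by (simp add: ffact_monom_def of_nat_prod)
  have "real (num_paths (SYgraph k) (intvec mu) (intvec nu))
      = fact (n - m) / (\<Prod>i=1..k. fact (nu i)) * phi_val k l mu nu"
    using num_paths_formula[OF assms(2) v_vertex assms(4-6) m_def h u_vertex] by (simp add: n_def)
  also have "\<dots> = of_rat (of_nat (fact (n - m)) / of_nat (\<Prod>i=1..k. fact (nu i)) * ?v nu)"
    by (simp add: of_rat_mult of_rat_divide of_rat_prod of_rat_fact val)
  finally have "(of_rat (of_nat (num_paths (SYgraph k) (intvec mu) (intvec nu))) :: real)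
      = of_rat (of_nat (fact (n - m)) / of_nat (\<Prod>i=1..k. fact (nu i)) * ?v nu)" by simp
  then have count: "rat_of_nat (num_paths (SYgraph k) (intvec mu) (intvec nu))
      = of_nat (fact (n - m)) / of_nat (\<Prod>i=1..k. fact (nu i)) * ?v nu" by (simp only: of_rat_eq_iff)
  show ?thesis using anti expansion count by blast
qed

end
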